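(* Let $\beta>1$, let $(H_N)_N$ be a Curie-Weiss($\beta$) ensemble, and let $c=c(\beta)$ be the unique solution in $(0,1)$ of $\tanh(\beta c)=c$. Let $s(z)=\frac1N\operatorname{tr}\big[\big((1-c^2)^{-1/2}H_N-z\big)^{-1}\big]$ be the Stieltjes transform of the empirical spectral distribution of the rescaled matrix $(1-c^2)^{-1/2}H_N$ and let $m$ be the Stieltjes transform of the semicircle distribution. Fix $\tau\in(0,1)$ and write $\eta=\operatorname{Im}z$, $E=\operatorname{Re}z$, $\kappa=\big||E|-2\big|$. Then $$|s(z)-m(z)|\prec\frac{\frac{1}{\sqrt{N\eta}}}{\sqrt{\kappa+\eta+\frac{1}{\sqrt{N\eta}}}}\quad\text{uniformly in } z\in\left[-\tfrac1\tau,\tfrac1\tau\right]+i\left[\tfrac{1}{N^{1-\tau}},\tfrac1\tau\right],$$ as well as $$|s(z)-m(z)|\prec\frac{1}{\sqrt{N\eta}}\quad\text{uniformly in } z\in\left[-2+\tau,2-\tau\right]+i\left[\tfrac{1}{N^{1-\tau}},\tfrac1\tau\right].$$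
   Context: Curie-Weiss distribution: for $\beta\ge0$, $M\in\mathbb{N}$, random variables $Y_1,\dots,Y_M$ are Curie-Weiss($\beta,M$)-distributed if $\mathbb{P}(Y_1=y_1,\dots,Y_M=y_M)=\frac{1}{Z_{\beta,M}}e^{\frac{\beta}{2M}(\sum_i y_i)^2}$ for all $y_1,\dots,y_M\in\{-1,1\}$, with $Z_{\beta,M}$ a normalization constant. Curie-Weiss($\beta$) ensemble: for each $N$ let $(\tilde X_N(i,j))_{1\le i,j\le N}$ be Curie-Weiss($\beta,N^2$)-distributed, and set $H_N(i,j)=\frac{1}{\sqrt N}\tilde X_N(i,j)$ if $i\le j$ and $H_N(i,j)=\frac{1}{\sqrt N}\tilde X_N(j,i)$ if $i>j$. Stochastic domination: for complex random variables $X^{(N)}(u)$ and non-negative random variables $Y^{(N)}(u)$, $u\in U^{(N)}$, we write $X\prec Y$ uniformly in $u\in U^{(N)}$ if for all $\epsilon,D>0$ there is $C_{\epsilon,D}\ge0$ with $\sup_{u\in U^{(N)}}\mathbb{P}(|X^{(N)}(u)|>N^\epsilon Y^{(N)}(u))\le C_{\epsilon,D}N^{-D}$ for all $N\in\mathbb{N}$. The semicircle distribution has Lebesgue density $x\mapsto\frac{1}{2\pi}\sqrt{(4-x^2)_+}$; the Stieltjes transform of a probability measure $\nu$ on $\mathbb{R}$ is $z\mapsto\int\frac{1}{x-z}\,d\nu(x)$ for $\operatorname{Im}z>0$. *)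

theory Defs
  imports
    "HOL-Probability.Probability"
    "Jordan_Normal_Form.Gauss_Jordan_Elimination"
begin

text \<open>The \<open>M\<close> spins are indexed by an arbitrary finite set \<open>I\<close> with \<open>card I = M\<close>. They are
  real-valued random variables; that they lie in \<open>{-1, 1}\<close> almost surely follows from the
  normalization.\<close>

definition cw_weight :: "real \<Rightarrow> 'i set \<Rightarrow> ('i \<Rightarrow> real) \<Rightarrow> real" where
  "cw_weight \<beta> I y = exp (\<beta> / (2 * real (card I)) * (\<Sum>i\<in>I. y i)\<^sup>2)"

definition cw_partition :: "real \<Rightarrow> 'i set \<Rightarrow> real" where
  "cw_partition \<beta> I = (\<Sum>y \<in> I \<rightarrow>\<^sub>E {-1, 1}. cw_weight \<beta> I y)"

definition curie_weiss :: "'a measure \<Rightarrow> real \<Rightarrow> 'i set \<Rightarrow> ('i \<Rightarrow> 'a \<Rightarrow> real) \<Rightarrow> bool" where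
  "curie_weiss P \<beta> I Y \<longleftrightarrow>
     prob_space P \<and> finite I \<and> I \<noteq> {} \<and>
     (\<forall>i\<in>I. Y i \<in> borel_measurable P) \<and>
     (\<forall>y \<in> I \<rightarrow>\<^sub>E {-1, 1}.
        measure P {\<omega> \<in> space P. \<forall>i\<in>I. Y i \<omega> = y i} = cw_weight \<beta> I y / cw_partition \<beta> I)"

text \<open>Each \<open>N\<close> has its own probability space \<open>P N\<close>, as no joint law across \<open>N\<close> is prescribed.
  Matrix indices start at 0.\<close>

definition curie_weiss_ensemble ::
  "real \<Rightarrow> (nat \<Rightarrow> 'a measure) \<Rightarrow> (nat \<Rightarrow> 'a \<Rightarrow> real mat) \<Rightarrow> bool" where
  "curie_weiss_ensemble \<beta> P H \<longleftrightarrow>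
     (\<forall>N\<ge>1. \<exists>X. curie_weiss (P N) \<beta> ({..<N} \<times> {..<N}) X \<and>
        (\<forall>\<omega> \<in> space (P N). H N \<omega> = Matrix.mat N N (\<lambda>(i, j).
           1 / sqrt (real N) * (if i \<le> j then X (i, j) \<omega> else X (j, i) \<omega>))))"

definition cw_magnetization :: "real \<Rightarrow> real" where
  "cw_magnetization \<beta> = (THE c. 0 < c \<and> c < 1 \<and> tanh (\<beta> * c) = c)"

text \<open>Measurability and non-negativity are part of the definition because \<^const>\<open>emeasure\<close> is 0 on
  non-measurable sets, so that the bound would be void for functions that are not random
  variables.\<close>

definition stoch_dominated ::
  "(nat \<Rightarrow> 'a measure) \<Rightarrow> (nat \<Rightarrow> 'u set) \<Rightarrow>
   (nat \<Rightarrow> 'u \<Rightarrow> 'a \<Rightarrow> complex) \<Rightarrow> (nat \<Rightarrow> 'u \<Rightarrow> 'a \<Rightarrow> real) \<Rightarrow> bool" where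
  "stoch_dominated P U X Y \<longleftrightarrow>
     (\<forall>N\<ge>1. \<forall>u\<in>U N. X N u \<in> borel_measurable (P N) \<and> Y N u \<in> borel_measurable (P N) \<and>
        (\<forall>\<omega> \<in> space (P N). 0 \<le> Y N u \<omega>)) \<and>
     (\<forall>\<epsilon>>0. \<forall>D>0. \<exists>C\<ge>0. \<forall>N\<ge>1.
        (SUP u\<in>U N. emeasure (P N) {\<omega> \<in> space (P N). cmod (X N u \<omega>) > real N powr \<epsilon> * Y N u \<omega>})
          \<le> ennreal (C * real N powr (- D)))"

definition stieltjes_transform :: "real measure \<Rightarrow> complex \<Rightarrow> complex" where
  "stieltjes_transform \<nu> z = (\<integral>x. 1 / (complex_of_real x - z) \<partial>\<nu>)"

definition semicircle :: "real measure" where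
  "semicircle = density lborel (\<lambda>x. ennreal (1 / (2 * pi) * sqrt (max 0 (4 - x\<^sup>2))))"

definition mat_trace :: "'b::comm_monoid_add mat \<Rightarrow> 'b" where
  "mat_trace A = (\<Sum>i<dim_row A. A $$ (i, i))"

text \<open>For real symmetric \<open>A\<close> and \<open>Im z > 0\<close> the matrix \<open>A - z\<close> is invertible, so \<^const>\<open>the\<close> below
  never meets \<^const>\<open>None\<close>.\<close>

definition resolvent :: "real mat \<Rightarrow> complex \<Rightarrow> complex mat" where
  "resolvent A z =
     the (mat_inverse (map_mat complex_of_real A - z \<cdot>\<^sub>m 1\<^sub>m (dim_row A)))"

definition empirical_stieltjes :: "real mat \<Rightarrow> complex \<Rightarrow> complex" where
  "empirical_stieltjes A z = 1 / of_nat (dim_row A) * mat_trace (resolvent A z)"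

definition spectral_domain :: "real \<Rightarrow> real \<Rightarrow> real \<Rightarrow> nat \<Rightarrow> complex set" where
  "spectral_domain a b \<tau> N =
     {z. a \<le> Re z \<and> Re z \<le> b \<and> 1 / real N powr (1 - \<tau>) \<le> Im z \<and> Im z \<le> 1 / \<tau>}"

end

theory Submission
  imports Defs "Jordan_Normal_Form.Determinant" "HOL-Real_Asymp.Real_Asymp"
begin

text \<open>
  The proof compares the normalized resolvent trace \<open>s\<close> with the root \<open>m\<close> of
  \<open>m\<^sup>2 + z m + 1 = 0\<close> in the upper half plane. Two mechanisms carry it: a reduction of the dependent
  spins to independent ones, and the stability of the quadratic equation.

  Reduction to independence. Writing \<open>exp (\<beta> S\<^sup>2 / (2 M))\<close> as a Gaussian integral of \<open>exp (x S)\<close>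
  exhibits the Curie-Weiss law as a mixture, over \<open>x\<close>, of product laws of spins with mean \<open>tanh x\<close>
  (\<open>cw_prob_mixture\<close>). The mixing density is proportional to \<open>exp (- M F(x))\<close> with
  \<open>F(x) = x\<^sup>2 / (2 \<beta>) - ln (cosh x)\<close>. For \<open>\<beta> > 1\<close> the minima of \<open>F\<close> are \<open>\<plusminus> \<beta> c\<close> and they are
  non-degenerate, so with \<open>M = N\<^sup>2\<close> the mean of the spins is \<open>\<plusminus> c\<close> up to
  \<open>1 / sqrt N\<close>, outside an event of exponentially small probability (\<open>cw_prob_concentration\<close>).
  Given the mean \<open>t\<close>, the rescaled matrix is a Wigner matrix with entry variance
  \<open>(1 - t\<^sup>2) / ((1 - c\<^sup>2) N)\<close>, which is close to \<open>1 / N\<close>, plus a multiple of the all-ones matrix.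
  That summand has rank one and moves \<open>s\<close> by at most \<open>1 / (N \<eta>)\<close> (\<open>res_trace_rank_one\<close>).

  Independent entries. By the Schur complement formula, a diagonal resolvent entry satisfies
  \<open>1 / G\<^sub>i\<^sub>i = - z - s + Y\<^sub>i\<close>, where the main part of \<open>Y\<^sub>i\<close> is the deviation of a quadratic form in row
  \<open>i\<close> from its mean, the coefficients being the resolvent of the minor without row and column \<open>i\<close>.
  The row is independent of the minor, so a tail bound for quadratic forms (\<open>quadratic_form_tail\<close>)
  together with the Ward identity \<open>\<Sum> \<bar>G\<^sub>j\<^sub>k\<bar>\<^sup>2 = Im (tr G) / \<eta>\<close> bounds \<open>Y\<^sub>i\<close> by \<open>1 / sqrt (N \<eta>)\<close> up to small
  powers of \<open>N\<close>, for as long as \<open>s\<close> is bounded. The tail bound rests on the exponential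
  supermartingale \<open>exp (\<Sum> X\<^sub>k L\<^sub>k - L\<^sub>k\<^sup>2 / 2)\<close> with predictable \<open>L\<^sub>k\<close>, used once for linear forms and once
  more with \<open>L\<^sub>k\<close> itself a linear form.

  Stability. Averaging over \<open>i\<close> yields \<open>\<bar>s\<^sup>2 + z s + 1\<bar> \<le> q\<close> with \<open>q\<close> of order \<open>1 / sqrt (N \<eta>)\<close>
  (\<open>self_consistent_equation\<close>), that is, \<open>\<bar>s - m\<bar> \<bar>s - m'\<bar> \<le> q\<close> for the two roots \<open>m\<close> and \<open>m'\<close>,
  whose distance \<open>sqrt \<bar>z\<^sup>2 - 4\<bar>\<close> is at least \<open>sqrt (\<kappa> + \<eta>)\<close>. Hence \<open>s\<close> is close to one of the roots.
  That it is \<open>m\<close>, and that \<open>s\<close> is bounded in the first place, follows by moving down from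
  large \<open>\<eta>\<close> in steps that are short compared with the gap between the two alternatives
  (\<open>continuity_induction\<close>). The bound in the bulk is the first bound restricted to \<open>\<kappa> \<ge> \<tau>\<close>.
\<close>

section \<open>Resolvents of finite symmetric matrices\<close>

text \<open>Extending by 0 outside \<open>I\<close> makes the resolvent unique and lets sums over the entries of a minor run over all
  indices.\<close>

definition is_resolvent :: "'i set \<Rightarrow> ('i \<Rightarrow> 'i \<Rightarrow> real) \<Rightarrow> complex \<Rightarrow> ('i \<Rightarrow> 'i \<Rightarrow> complex) \<Rightarrow> bool" where
  "is_resolvent I A z G \<longleftrightarrow>
     (\<forall>i\<in>I. \<forall>j\<in>I. (\<Sum>k\<in>I. of_real (A i k) * G k j) - z * G i j = of_bool (i = j)) \<and>
     (\<forall>i j. i \<notin> I \<or> j \<notin> I \<longrightarrow> G i j = 0)"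

definition symmetric_on :: "'i set \<Rightarrow> ('i \<Rightarrow> 'i \<Rightarrow> real) \<Rightarrow> bool" where
  "symmetric_on I A \<longleftrightarrow> (\<forall>i\<in>I. \<forall>j\<in>I. A i j = A j i)"

lemma symmetric_on_subset: "symmetric_on I A \<Longrightarrow> J \<subseteq> I \<Longrightarrow> symmetric_on J A"
  unfolding symmetric_on_def by blast

text \<open>The quadratic form of a real symmetric matrix is real on complex vectors, so only the spectral
  parameter contributes to the imaginary part.\<close>

lemma Im_pairing:
  fixes u :: "'i \<Rightarrow> complex"
  assumes "symmetric_on I A"
  shows "Im (\<Sum>i\<in>I. cnj (u i) * ((\<Sum>k\<in>I. of_real (A i k) * u k) - z * u i)) = - Im z * (\<Sum>i\<in>I. (cmod (u i))\<^sup>2)"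
proof -
  let ?Q = "\<Sum>i\<in>I. \<Sum>k\<in>I. of_real (A i k) * (cnj (u i) * u k)"
  have "cnj ?Q = (\<Sum>i\<in>I. \<Sum>k\<in>I. of_real (A i k) * (cnj (u k) * u i))"
    by (simp add: mult_ac)
  also have "\<dots> = (\<Sum>k\<in>I. \<Sum>i\<in>I. of_real (A i k) * (cnj (u k) * u i))"
    by (rule sum.swap)
  also have "\<dots> = ?Q"
    using assms by (intro sum.cong) (auto simp: symmetric_on_def)
  finally have "cnj ?Q = ?Q" .
  moreover have "cnj q = q \<Longrightarrow> Im q = 0" for q by (simp add: complex_eq_iff)
  ultimately have "Im ?Q = 0" by blast
  have "(\<Sum>i\<in>I. cnj (u i) * ((\<Sum>k\<in>I. of_real (A i k) * u k) - z * u i))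
     = (\<Sum>i\<in>I. (\<Sum>k\<in>I. of_real (A i k) * (cnj (u i) * u k)) - z * of_real ((cmod (u i))\<^sup>2))"
    by (intro sum.cong refl)
      (simp add: right_diff_distrib sum_distrib_left complex_norm_square mult_ac del: of_real_power)
  also have "\<dots> = ?Q - z * of_real (\<Sum>i\<in>I. (cmod (u i))\<^sup>2)"
    by (simp add: sum_subtractf sum_distrib_left)
  finally have "(\<Sum>i\<in>I. cnj (u i) * ((\<Sum>k\<in>I. of_real (A i k) * u k) - z * u i))
     = ?Q - z * of_real (\<Sum>i\<in>I. (cmod (u i))\<^sup>2)" .
  thus ?thesis using \<open>Im ?Q = 0\<close> 
    by (simp only: minus_complex.sel times_complex.sel Im_complex_of_real Re_complex_of_real)
qed

lemma shifted_injective: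
  fixes u :: "'i \<Rightarrow> complex"
  assumes "finite I" "symmetric_on I A" "Im z > 0"
    and "\<And>i. i \<in> I \<Longrightarrow> (\<Sum>k\<in>I. of_real (A i k) * u k) - z * u i = 0" and "i \<in> I"
  shows "u i = 0"
proof -
  have "- Im z * (\<Sum>i\<in>I. (cmod (u i))\<^sup>2) = 0"
    using Im_pairing[OF assms(2), of u z] assms(4) by simp
  hence "(\<Sum>i\<in>I. (cmod (u i))\<^sup>2) = 0" using assms(3) by simp
  hence "(cmod (u i))\<^sup>2 = 0" using sum_nonneg_eq_0_iff[OF assms(1), of "\<lambda>i. (cmod (u i))\<^sup>2"] assms(5) zero_le_power2 by blast
  thus ?thesis by simp
qed

lemma resolvent_apply:
  assumes "finite I" "is_resolvent I A z G" "i \<in> I"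
  shows "(\<Sum>k\<in>I. of_real (A i k) * (\<Sum>j\<in>I. G k j * f j)) - z * (\<Sum>j\<in>I. G i j * f j) = f i"
proof -
  have "(\<Sum>k\<in>I. of_real (A i k) * (\<Sum>j\<in>I. G k j * f j)) = (\<Sum>j\<in>I. (\<Sum>k\<in>I. of_real (A i k) * G k j) * f j)"
    by (simp add: sum_distrib_left sum_distrib_right mult.assoc) (rule sum.swap)
  hence "(\<Sum>k\<in>I. of_real (A i k) * (\<Sum>j\<in>I. G k j * f j)) - z * (\<Sum>j\<in>I. G i j * f j)
     = (\<Sum>j\<in>I. ((\<Sum>k\<in>I. of_real (A i k) * G k j) - z * G i j) * f j)"
    by (simp add: sum_distrib_left sum_subtractf algebra_simps)
  also have "\<dots> = (\<Sum>j\<in>I. of_bool (i = j) * f j)"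
    using assms by (intro sum.cong) (auto simp: is_resolvent_def)
  also have "\<dots> = f i" using assms by (simp add: of_bool_def if_distrib[of "\<lambda>x. x * _"] sum.delta cong: if_cong)
  finally show ?thesis .
qed

lemma resolvent_solution:
  fixes u :: "'i \<Rightarrow> complex"
  assumes "finite I" "symmetric_on I A" "Im z > 0" "is_resolvent I A z G"
    and "\<And>i. i \<in> I \<Longrightarrow> (\<Sum>k\<in>I. of_real (A i k) * u k) - z * u i = f i" and "i \<in> I"
  shows "u i = (\<Sum>j\<in>I. G i j * f j)"
proof -
  have "u i - (\<Sum>j\<in>I. G i j * f j) = 0"
  proof (rule shifted_injective[OF assms(1-3) _ assms(6)])
    fix i assume "i \<in> I"
    show "(\<Sum>k\<in>I. of_real (A i k) * (u k - (\<Sum>j\<in>I. G k j * f j))) - z * (u i - (\<Sum>j\<in>I. G i j * f j)) = 0"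
      using resolvent_apply[OF assms(1,4) \<open>i \<in> I\<close>, of f] assms(5)[OF \<open>i \<in> I\<close>]
      by (simp add: algebra_simps sum_subtractf)
  qed
  thus ?thesis by simp
qed

lemma is_resolvent_unique:
  assumes "finite I" "symmetric_on I A" "Im z > 0" "is_resolvent I A z G" "is_resolvent I A z G'"
  shows "G = G'"
proof (intro ext)
  fix i j
  show "G i j = G' i j"
  proof (cases "i \<in> I \<and> j \<in> I")
    case True
    have "G i j - G' i j = 0"
      by (rule shifted_injective[OF assms(1-3), where u = "\<lambda>i. G i j - G' i j"])
        (use assms(4,5) True in \<open>auto simp: is_resolvent_def algebra_simps sum_subtractf\<close>)
    thus ?thesis by simp
  qed (use assms(4,5) in \<open>auto simp: is_resolvent_def\<close>)
qed

text \<open>With \<open>u = G v\<close> and \<open>v\<close> real this is \<open>Im_pairing\<close> for \<open>u\<close>, because \<open>(A - z) u = v\<close>. The Ward identity is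
  the case of a unit vector; it also bounds all denominators that occur below from below.\<close>

lemma Im_quadratic_form:
  fixes v :: "'i \<Rightarrow> real"
  assumes "finite I" "symmetric_on I A" "is_resolvent I A z G"
  shows "Im (\<Sum>i\<in>I. of_real (v i) * (\<Sum>j\<in>I. G i j * of_real (v j)))
       = Im z * (\<Sum>i\<in>I. (cmod (\<Sum>j\<in>I. G i j * of_real (v j)))\<^sup>2)"
proof -
  define u where "u i = (\<Sum>j\<in>I. G i j * of_real (v j))" for i
  have "Im (\<Sum>i\<in>I. cnj (u i) * of_real (v i)) = - Im z * (\<Sum>i\<in>I. (cmod (u i))\<^sup>2)"
  proof -
    have "(\<Sum>i\<in>I. cnj (u i) * of_real (v i)) = (\<Sum>i\<in>I. cnj (u i) * ((\<Sum>k\<in>I. of_real (A i k) * u k) - z * u i))"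
      using resolvent_apply[OF assms(1,3), of _ "\<lambda>j. of_real (v j)"] by (intro sum.cong) (auto simp: u_def)
    thus ?thesis using Im_pairing[OF assms(2), of u z] by simp
  qed
  thus ?thesis by (simp add: u_def[symmetric] sum_negf mult.commute)
qed

definition schur_vec :: "'i set \<Rightarrow> ('i \<Rightarrow> 'i \<Rightarrow> real) \<Rightarrow> ('i \<Rightarrow> 'i \<Rightarrow> complex) \<Rightarrow> 'i \<Rightarrow> 'i \<Rightarrow> complex" where
  "schur_vec I A G n j = (\<Sum>k\<in>I. G j k * of_real (A k n))"

definition schur_den :: "'i set \<Rightarrow> ('i \<Rightarrow> 'i \<Rightarrow> real) \<Rightarrow> complex \<Rightarrow> ('i \<Rightarrow> 'i \<Rightarrow> complex) \<Rightarrow> 'i \<Rightarrow> complex" where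
  "schur_den I A z G n = of_real (A n n) - z - (\<Sum>j\<in>I. of_real (A n j) * schur_vec I A G n j)"

text \<open>Bordering by a new index \<open>n\<close> is a rank-one update: \<open>G + e e\<^sup>T / d\<close>, where \<open>e\<close> is \<open>-1\<close> at \<open>n\<close> and
  \<open>G\<close> applied to the new column elsewhere, and \<open>d\<close> is the Schur complement. In this form \<open>(A - z) e\<close>
  vanishes except at \<open>n\<close>.\<close>

definition schur_extend where
  "schur_extend I A z G n j k =
     G j k + (if j = n then -1 else schur_vec I A G n j) * (if k = n then -1 else schur_vec I A G n k) / schur_den I A z G n"

lemma Im_schur_den:
  assumes "finite I" "n \<notin> I" "symmetric_on (insert n I) A" "is_resolvent I A z G"
  shows "Im (schur_den I A z G n) = - Im z * (1 + (\<Sum>j\<in>I. (cmod (schur_vec I A G n j))\<^sup>2))"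
proof -
  have "(\<Sum>j\<in>I. of_real (A n j) * schur_vec I A G n j) = (\<Sum>j\<in>I. of_real (A j n) * (\<Sum>k\<in>I. G j k * of_real (A k n)))"
  proof (rule sum.cong[OF refl])
    fix j assume "j \<in> I"
    hence "A n j = A j n" using assms(3) unfolding symmetric_on_def by blast
    thus "of_real (A n j) * schur_vec I A G n j = of_real (A j n) * (\<Sum>k\<in>I. G j k * of_real (A k n))"
      by (simp only: schur_vec_def)
  qed
  hence "Im (\<Sum>j\<in>I. of_real (A n j) * schur_vec I A G n j) = Im z * (\<Sum>j\<in>I. (cmod (schur_vec I A G n j))\<^sup>2)"
    using Im_quadratic_form[OF assms(1) symmetric_on_subset[OF assms(3)] assms(4), of "\<lambda>k. A k n"]
    by (auto simp: schur_vec_def)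
  thus ?thesis by (simp add: schur_den_def algebra_simps)
qed

lemma is_resolvent_extend:
  assumes "finite I" "n \<notin> I" "symmetric_on (insert n I) A" "Im z > 0" "is_resolvent I A z G"
    and G_sym: "\<And>i j. G i j = G j i"
  shows "is_resolvent (insert n I) A z (schur_extend I A z G n)"
    and "schur_extend I A z G n i j = schur_extend I A z G n j i"
proof -
  define w where "w = schur_vec I A G n"
  define d where "d = schur_den I A z G n"
  define e where "e = (\<lambda>j. if j = n then -1 else w j)"
  have G0: "G i j = 0" if "i \<notin> I \<or> j \<notin> I" for i j
    using assms(5) that by (auto simp: is_resolvent_def)
  have w0: "w j = 0" if "j \<notin> I" for j using G0 that by (simp add: w_def schur_vec_def)
  have "Im d < 0" unfolding d_def
    using Im_schur_den[OF assms(1,2,3,5)] assms(4) by (simp add: add_pos_nonneg sum_nonneg mult_pos_pos)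
  hence d: "d \<noteq> 0" by auto
  have ext: "schur_extend I A z G n j k = G j k + e j * e k / d" for j k
    by (simp add: schur_extend_def e_def w_def d_def)
  have eI: "(\<Sum>k\<in>insert n I. of_real (A i k) * e k) - z * e i = (if i = n then - d else 0)" if "i \<in> insert n I" for i
  proof -
    have s: "(\<Sum>k\<in>insert n I. of_real (A i k) * e k) = - of_real (A i n) + (\<Sum>k\<in>I. of_real (A i k) * w k)"
      using assms(1,2) by (simp add: e_def) (rule sum.cong, auto)
    show ?thesis
    proof (cases "i = n")
      case True
      then show ?thesis using s by (simp add: e_def d_def schur_den_def w_def)
    next
      case False
      hence i: "i \<in> I" using that by auto
      have "(\<Sum>k\<in>I. of_real (A i k) * w k) - z * w i = of_real (A i n)"
        using resolvent_apply[OF assms(1,5) i, of "\<lambda>k. of_real (A k n)"] by (simp add: w_def schur_vec_def)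
      then show ?thesis using s False by (simp add: e_def algebra_simps)
    qed
  qed
  have GI: "(\<Sum>k\<in>insert n I. of_real (A i k) * G k j) - z * G i j = (if i = n then (if j = n then 0 else w j) else of_bool (i = j))"
    if "i \<in> insert n I" "j \<in> insert n I" for i j
  proof -
    have "G n j = 0" using G0 assms(2) by blast
    hence s: "(\<Sum>k\<in>insert n I. of_real (A i k) * G k j) = (\<Sum>k\<in>I. of_real (A i k) * G k j)"
      using assms(1,2) by simp
    show ?thesis
    proof (cases "i = n")
      case True
      have "of_real (A n k) * G k j = G j k * of_real (A k n)" if "k \<in> I" for k
      proof -
        have "A n k = A k n" using assms(3) that unfolding symmetric_on_def by blast
        thus ?thesis using G_sym[of k j] by (simp only: mult.commute)
      qed
      hence "(\<Sum>k\<in>I. of_real (A n k) * G k j) = w j"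
        unfolding w_def schur_vec_def by (rule sum.cong[OF refl])
      moreover have "G n j = 0" "w n = 0" using G0 w0 assms(2) by blast+
      ultimately show ?thesis unfolding s by (simp add: True)
    next
      case False
      hence i: "i \<in> I" using that by auto
      show ?thesis
      proof (cases "j = n")
        case True
        have "G k n = 0" for k using G0 assms(2) by blast
        then show ?thesis unfolding s True using False by simp
      next
        case False
        hence "j \<in> I" using that by auto
        then show ?thesis unfolding s using i assms(5) \<open>i \<noteq> n\<close> by (simp add: is_resolvent_def)
      qed
    qed
  qed
  show "is_resolvent (insert n I) A z (schur_extend I A z G n)"
    unfolding is_resolvent_def
  proof (intro conjI ballI allI impI)
    fix i j assume ij: "i \<in> insert n I" "j \<in> insert n I"
    have "(\<Sum>k\<in>insert n I. of_real (A i k) * schur_extend I A z G n k j) - z * schur_extend I A z G n i j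
       = ((\<Sum>k\<in>insert n I. of_real (A i k) * G k j) - z * G i j) + ((\<Sum>k\<in>insert n I. of_real (A i k) * e k) - z * e i) * e j / d"
    proof -
      have "(\<Sum>k\<in>insert n I. of_real (A i k) * schur_extend I A z G n k j)
        = (\<Sum>k\<in>insert n I. of_real (A i k) * G k j) + (\<Sum>k\<in>insert n I. of_real (A i k) * e k) * e j / d"
        unfolding ext by (simp only: distrib_left sum.distrib sum_distrib_right sum_divide_distrib mult.assoc times_divide_eq_right)
      thus ?thesis unfolding ext by (simp add: algebra_simps diff_divide_distrib)
    qed
    also have "\<dots> = of_bool (i = j)"
      unfolding GI[OF ij] eI[OF ij(1)] using d by (auto simp: e_def)
    finally show "(\<Sum>k\<in>insert n I. of_real (A i k) * schur_extend I A z G n k j) - z * schur_extend I A z G n i j = of_bool (i = j)" .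
  next
    fix i j assume "i \<notin> insert n I \<or> j \<notin> insert n I"
    thus "schur_extend I A z G n i j = 0" unfolding ext using G0 w0 by (auto simp: e_def)
  qed
  show "schur_extend I A z G n i j = schur_extend I A z G n j i"
    unfolding ext using G_sym[of i j] by simp
qed

text \<open>Induction on the index set along \<open>is_resolvent_extend\<close>: the Schur complement never vanishes in the
  upper half plane. Symmetry of the resolvent is an invariant of the same induction.\<close>

lemma resolvent_exists:
  assumes "finite I" "symmetric_on I A" "Im z > 0"
  shows "\<exists>G. is_resolvent I A z G \<and> (\<forall>i j. G i j = G j i)"
  using assms(1,2)
proof (induction I)
  case empty
  show ?case by (rule exI[of _ "\<lambda>_ _. 0"]) (simp add: is_resolvent_def)
next
  case (insert n I)
  then obtain G where "is_resolvent I A z G" "\<And>i j. G i j = G j i"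
    using symmetric_on_subset[OF insert.prems, of I] by auto
  from is_resolvent_extend[OF insert.hyps insert.prems assms(3) this] show ?case by blast
qed

definition res :: "'i set \<Rightarrow> ('i \<Rightarrow> 'i \<Rightarrow> real) \<Rightarrow> complex \<Rightarrow> 'i \<Rightarrow> 'i \<Rightarrow> complex" where
  "res I A z = (THE G. is_resolvent I A z G)"

lemma res_eqI:
  assumes "finite I" "symmetric_on I A" "Im z > 0" "is_resolvent I A z G"
  shows "res I A z = G"
  unfolding res_def using assms is_resolvent_unique by blast

lemma is_resolvent_res:
  assumes "finite I" "symmetric_on I A" "Im z > 0"
  shows "is_resolvent I A z (res I A z)"
  using resolvent_exists[OF assms] res_eqI[OF assms] by auto

lemma res_sym:
  assumes "finite I" "symmetric_on I A" "Im z > 0"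
  shows "res I A z i j = res I A z j i"
  using resolvent_exists[OF assms] res_eqI[OF assms] by auto

lemma res_outside:
  assumes "finite I" "symmetric_on I A" "Im z > 0" "i \<notin> I \<or> j \<notin> I"
  shows "res I A z i j = 0"
  using is_resolvent_res[OF assms(1-3)] assms(4) by (auto simp: is_resolvent_def)

lemma res_insert:
  assumes "finite I" "n \<notin> I" "symmetric_on (insert n I) A" "Im z > 0"
  shows "res (insert n I) A z = schur_extend I A z (res I A z) n"
proof (rule res_eqI)
  have s: "symmetric_on I A" using symmetric_on_subset[OF assms(3)] by auto
  show "is_resolvent (insert n I) A z (schur_extend I A z (res I A z) n)"
    by (rule is_resolvent_extend(1)[OF assms is_resolvent_res[OF assms(1) s assms(4)] res_sym[OF assms(1) s assms(4)]])
qed (use assms in auto)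

lemma res_cong:
  assumes "\<And>i j. i \<in> I \<Longrightarrow> j \<in> I \<Longrightarrow> A i j = B i j"
  shows "res I A z = res I B z"
proof -
  have "is_resolvent I A z G = is_resolvent I B z G" for G
    unfolding is_resolvent_def using assms by simp
  thus ?thesis by (simp add: res_def)
qed

definition res_trace where "res_trace I A z = (\<Sum>i\<in>I. res I A z i i)"

lemma res_insert_diag:
  assumes "finite I" "n \<notin> I" "symmetric_on (insert n I) A" "Im z > 0"
  shows "res (insert n I) A z n n = 1 / schur_den I A z (res I A z) n"
  unfolding res_insert[OF assms] schur_extend_def
  using res_outside[OF assms(1) symmetric_on_subset[OF assms(3)] assms(4)] assms(2) by auto

text \<open>The difference is \<open>(1 + \<Sum> w\<^sub>j\<^sup>2) / d\<close>, and \<open>\<bar>d\<bar> \<ge> \<bar>Im d\<bar> = \<eta> (1 + \<Sum> \<bar>w\<^sub>j\<bar>\<^sup>2)\<close>.\<close>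

lemma res_trace_insert:
  assumes "finite I" "n \<notin> I" "symmetric_on (insert n I) A" "Im z > 0"
  shows "cmod (res_trace (insert n I) A z - res_trace I A z) \<le> 1 / Im z"
proof -
  have s: "symmetric_on I A" using symmetric_on_subset[OF assms(3)] by auto
  note r = is_resolvent_res[OF assms(1) s assms(4)]
  define w where "w = schur_vec I A (res I A z) n"
  define d where "d = schur_den I A z (res I A z) n"
  define S where "S = 1 + (\<Sum>j\<in>I. (cmod (w j))\<^sup>2)"
  have S: "S \<ge> 1" by (simp add: S_def sum_nonneg)
  have "\<bar>Im d\<bar> = Im z * S"
    using Im_schur_den[OF assms(1-3) r] assms(4) S by (simp add: d_def w_def S_def abs_mult)
  hence d: "cmod d \<ge> Im z * S" using abs_Im_le_cmod[of d] by simp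
  have dpos: "Im z * S > 0" using S assms(4) by simp
  have "res_trace (insert n I) A z = 1 / d + (\<Sum>j\<in>I. res I A z j j + w j * w j / d)"
    using assms(1,2) res_outside[OF assms(1) s assms(4)]
    by (simp add: res_trace_def res_insert[OF assms] schur_extend_def w_def d_def) (rule sum.cong, auto)
  hence "res_trace (insert n I) A z - res_trace I A z = (1 + (\<Sum>j\<in>I. w j * w j)) / d"
    by (simp add: res_trace_def sum.distrib add_divide_distrib sum_divide_distrib)
  moreover have "cmod (1 + (\<Sum>j\<in>I. w j * w j)) \<le> S"
    unfolding S_def by (rule order_trans[OF norm_triangle_ineq])
      (auto intro!: order_trans[OF norm_sum] sum_mono simp: norm_mult power2_eq_square)
  moreover from this have "cmod (1 + (\<Sum>j\<in>I. w j * w j)) / cmod d \<le> S / (Im z * S)"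
    using S d dpos by (intro frac_le) linarith+
  ultimately have "cmod (res_trace (insert n I) A z - res_trace I A z) \<le> S / (Im z * S)"
    by (simp only: norm_divide)
  thus ?thesis using S by simp
qed

lemma res_ward:
  assumes "finite I" "symmetric_on I A" "Im z > 0" "i \<in> I"
  shows "Im (res I A z i i) = Im z * (\<Sum>j\<in>I. (cmod (res I A z j i))\<^sup>2)"
proof -
  have d: "(\<Sum>j\<in>I. f j * complex_of_real (of_bool (j = i))) = f i" for f
    using assms(1,4) by (simp add: of_bool_def if_distrib[of "\<lambda>x. _ * x"] if_distrib[of complex_of_real] sum.delta cong: if_cong)
  have d': "(\<Sum>j\<in>I. complex_of_real (of_bool (j = i)) * f j) = f i" for f
    using d[of f] by (simp add: mult.commute)
  show ?thesis
    using Im_quadratic_form[OF assms(1,2) is_resolvent_res[OF assms(1-3)], of "\<lambda>j. of_bool (j = i)"]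
    unfolding d d' .
qed

lemma res_trace_ward:
  assumes "finite I" "symmetric_on I A" "Im z > 0"
  shows "Im (res_trace I A z) = Im z * (\<Sum>i\<in>I. \<Sum>j\<in>I. (cmod (res I A z i j))\<^sup>2)"
proof -
  have "Im (res_trace I A z) = (\<Sum>i\<in>I. Im z * (\<Sum>j\<in>I. (cmod (res I A z j i))\<^sup>2))"
    unfolding res_trace_def Im_sum using res_ward[OF assms] by (intro sum.cong) auto
  also have "\<dots> = Im z * (\<Sum>i\<in>I. \<Sum>j\<in>I. (cmod (res I A z j i))\<^sup>2)"
    by (simp add: sum_distrib_left)
  finally show ?thesis by (subst sum.swap) 
qed

lemma res_diag_bound:
  assumes "finite I" "symmetric_on I A" "Im z > 0"
  shows "cmod (res I A z i i) \<le> 1 / Im z"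
proof (cases "i \<in> I")
  case True
  let ?g = "cmod (res I A z i i)"
  have "Im z * ?g\<^sup>2 \<le> Im z * (\<Sum>j\<in>I. (cmod (res I A z j i))\<^sup>2)"
    using assms True by (intro mult_left_mono member_le_sum) auto
  also have "\<dots> \<le> ?g" using res_ward[OF assms True] abs_Im_le_cmod[of "res I A z i i"] by simp
  finally have "(Im z * ?g) * ?g \<le> 1 * ?g" by (simp add: power2_eq_square)
  hence "Im z * ?g \<le> 1 \<or> ?g = 0"
    by (metis mult_le_cancel_right norm_ge_zero order_le_less)
  thus ?thesis using assms(3) by (auto simp: field_simps)
qed (use assms res_outside[OF assms] in auto)

lemma res_trace_bound:
  assumes "finite I" "symmetric_on I A" "Im z > 0"
  shows "cmod (res_trace I A z) \<le> card I / Im z"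
  unfolding res_trace_def
  using sum_norm_bound[of I "\<lambda>i. res I A z i i" "1 / Im z"] res_diag_bound[OF assms] by simp

text \<open>By the resolvent identity \<open>G(z) - G(z') = (z - z') G(z) G(z')\<close>; each diagonal entry of the product is
  controlled by Cauchy-Schwarz, since the columns of \<open>G(z)\<close> have norm at most \<open>1 / Im z\<close> by the Ward identity.\<close>

lemma res_trace_Lipschitz:
  assumes "finite I" "symmetric_on I A" "Im z > 0" "Im z' > 0"
  shows "cmod (res_trace I A z - res_trace I A z') \<le> card I * (cmod (z - z') / (Im z * Im z'))"
proof -
  define G where "G = res I A z"
  define G' where "G' = res I A z'"
  note r = is_resolvent_res[OF assms(1,2,3), folded G_def] is_resolvent_res[OF assms(1,2,4), folded G'_def]
  have colnorm: "(\<Sum>j\<in>I. (cmod (res I A z j i))\<^sup>2) \<le> (1 / Im z)\<^sup>2" if "Im z > 0" "i \<in> I" for z i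
  proof -
    have "Im z * (\<Sum>j\<in>I. (cmod (res I A z j i))\<^sup>2) \<le> 1 / Im z"
      using res_ward[OF assms(1,2) that] res_diag_bound[OF assms(1,2) that(1), of i]
        abs_Im_le_cmod[of "res I A z i i"] by linarith
    thus ?thesis using that(1) by (simp add: field_simps power2_eq_square)
  qed
  have "cmod (G i i - G' i i) \<le> cmod (z - z') / (Im z * Im z')" if i: "i \<in> I" for i
  proof -
    have "G i i - G' i i = (\<Sum>j\<in>I. G i j * ((z - z') * G' j i))"
    proof (rule resolvent_solution[OF assms(1-3) r(1) _ i, where u = "\<lambda>k. G k i - G' k i"])
      fix k assume k: "k \<in> I"
      have "(\<Sum>l\<in>I. of_real (A k l) * G l i) - z * G k i = of_bool (k = i)"
        "(\<Sum>l\<in>I. of_real (A k l) * G' l i) - z' * G' k i = of_bool (k = i)"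
        using r i k by (auto simp: is_resolvent_def)
      thus "(\<Sum>l\<in>I. of_real (A k l) * (G l i - G' l i)) - z * (G k i - G' k i) = (z - z') * G' k i"
        by (simp add: algebra_simps sum_subtractf)
    qed
    also have "\<dots> = (z - z') * (\<Sum>j\<in>I. G i j * G' j i)" by (simp add: sum_distrib_left mult_ac)
    finally have "cmod (G i i - G' i i) = cmod (z - z') * cmod (\<Sum>j\<in>I. G i j * G' j i)"
      by (simp add: norm_mult)
    also have "cmod (\<Sum>j\<in>I. G i j * G' j i) \<le> (\<Sum>j\<in>I. \<bar>cmod (G j i)\<bar> * \<bar>cmod (G' j i)\<bar>)"
      using res_sym[OF assms(1-3), of i] by (intro order_trans[OF norm_sum] sum_mono) (auto simp: norm_mult G_def)
    also have "\<dots> \<le> L2_set (\<lambda>j. cmod (G j i)) I * L2_set (\<lambda>j. cmod (G' j i)) I"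
      by (rule L2_set_mult_ineq)
    also have "\<dots> \<le> (1 / Im z) * (1 / Im z')"
      unfolding L2_set_def G_def G'_def using colnorm[OF assms(3) i] colnorm[OF assms(4) i] assms(3,4)
      by (intro mult_mono real_le_lsqrt) (auto intro: sum_nonneg)
    finally show ?thesis by (simp add: mult_left_mono)
  qed
  hence "cmod (\<Sum>i\<in>I. (G i i - G' i i)) \<le> card I * (cmod (z - z') / (Im z * Im z'))"
    by (rule sum_norm_bound)
  thus ?thesis by (simp add: res_trace_def G_def G'_def sum_subtractf)
qed

text \<open>By the Sherman-Morrison formula the trace changes by \<open>\<mu> \<Sum> u\<^sub>i\<^sup>2 / (1 + \<mu> v\<^sup>T u)\<close> with \<open>u = G v\<close>, and the
  imaginary part of the denominator is \<open>\<mu> \<eta> \<Sum> \<bar>u\<^sub>i\<bar>\<^sup>2\<close>. The bound is thus uniform in the size of the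
  perturbation.\<close>

lemma res_trace_rank_one:
  assumes "finite I" "symmetric_on I A" "Im z > 0"
  shows "cmod (res_trace I (\<lambda>i j. A i j + \<mu> * v i * v j) z - res_trace I A z) \<le> 1 / Im z"
proof -
  define G where "G = res I A z"
  note r = is_resolvent_res[OF assms, folded G_def]
  have Gsym: "G i j = G j i" for i j using res_sym[OF assms] by (simp add: G_def)
  have G0: "G i j = 0" if "i \<notin> I \<or> j \<notin> I" for i j using r that by (auto simp: is_resolvent_def)
  define u where "u i = (\<Sum>j\<in>I. G i j * of_real (v j))" for i
  define D where "D = 1 + of_real \<mu> * (\<Sum>i\<in>I. of_real (v i) * u i)"
  define S where "S = (\<Sum>i\<in>I. (cmod (u i))\<^sup>2)"
  have S: "S \<ge> 0" by (simp add: S_def sum_nonneg)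
  have Im: "Im (\<Sum>i\<in>I. of_real (v i) * u i) = Im z * S"
    using Im_quadratic_form[OF assms(1,2) r, of v] by (simp add: u_def S_def)
  have ImD: "\<bar>Im D\<bar> = \<bar>\<mu>\<bar> * Im z * S" using Im S assms(3) by (simp add: D_def abs_mult)
  have u0: "u i = 0" if "S = 0" "i \<in> I" for i
    using that assms(1) by (simp add: S_def sum_nonneg_eq_0_iff)
  have D0: "D \<noteq> 0"
  proof (cases "\<mu> = 0 \<or> S = 0")
    case True then show ?thesis using u0 by (auto simp: D_def)
  next
    case False
    hence "\<bar>Im D\<bar> \<noteq> 0" using ImD assms(3) by simp
    then show ?thesis by auto
  qed
  define G' where "G' i j = G i j - of_real \<mu> * u i * u j / D" for i j
  have "is_resolvent I (\<lambda>i j. A i j + \<mu> * v i * v j) z G'"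
    unfolding is_resolvent_def
  proof (intro conjI ballI allI impI)
    fix i j assume ij: "i \<in> I" "j \<in> I"
    have a: "(\<Sum>k\<in>I. of_real (A i k) * u k) - z * u i = of_real (v i)"
      unfolding u_def by (rule resolvent_apply[OF assms(1) r ij(1)])
    have b: "(\<Sum>k\<in>I. of_real (A i k) * G k j) - z * G i j = of_bool (i = j)"
      using r ij by (simp add: is_resolvent_def)
    have c: "(\<Sum>k\<in>I. of_real (v k) * G k j) = u j"
      unfolding u_def by (intro sum.cong) (auto simp: Gsym[of j] mult.commute)
    let ?c = "of_real \<mu> * u j / D" and ?vu = "\<Sum>k\<in>I. of_real (v k) * u k"
    let ?Au = "\<Sum>k\<in>I. of_real (A i k) * u k" and ?AG = "\<Sum>k\<in>I. of_real (A i k) * G k j" and ?vG = "\<Sum>k\<in>I. of_real (v k) * G k j"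
    have "(\<Sum>k\<in>I. of_real (A i k + \<mu> * v i * v k) * G' k j) - z * G' i j
      = (?AG - z * G i j) - (?Au - z * u i) * ?c
        + of_real \<mu> * of_real (v i) * (?vG - ?vu * ?c)"
    proof -
      have "(\<Sum>k\<in>I. of_real (A i k + \<mu> * v i * v k) * (G k j - of_real \<mu> * u k * u j / D))
        = (\<Sum>k\<in>I. of_real (A i k) * G k j - of_real (A i k) * u k * ?c
          + (of_real \<mu> * of_real (v i) * (of_real (v k) * G k j) - of_real \<mu> * of_real (v i) * (of_real (v k) * u k * ?c)))"
        by (intro sum.cong refl) (simp add: algebra_simps)
      also have "\<dots> = ?AG - ?Au * ?c
          + (of_real \<mu> * of_real (v i) * ?vG - of_real \<mu> * of_real (v i) * (?vu * ?c))"
        by (simp only: sum.distrib sum_subtractf sum_distrib_right sum_distrib_left)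
      finally have eq: "(\<Sum>k\<in>I. of_real (A i k + \<mu> * v i * v k) * (G k j - of_real \<mu> * u k * u j / D)) = \<dots>" .
      show ?thesis unfolding G'_def eq by (simp add: algebra_simps)
    qed
    also have "\<dots> = of_bool (i = j) - of_real (v i) * ?c
        + of_real \<mu> * of_real (v i) * (u j - ?vu * ?c)"
      unfolding a b c ..
    also have "\<dots> = of_bool (i = j) + of_real \<mu> * of_real (v i) * u j * (1 - (1 + of_real \<mu> * ?vu) / D)"
      by (simp add: algebra_simps add_divide_distrib)
    also have "\<dots> = of_bool (i = j)" using D0 unfolding D_def[symmetric] by simp
    finally show "(\<Sum>k\<in>I. of_real (A i k + \<mu> * v i * v k) * G' k j) - z * G' i j = of_bool (i = j)" .
  next
    fix i j assume "i \<notin> I \<or> j \<notin> I"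
    moreover from this have "u i = 0 \<or> u j = 0" using G0 by (auto simp: u_def)
    ultimately show "G' i j = 0" using G0 by (auto simp: G'_def)
  qed
  moreover have "symmetric_on I (\<lambda>i j. A i j + \<mu> * v i * v j)"
    using assms(2) by (auto simp: symmetric_on_def)
  ultimately have "res I (\<lambda>i j. A i j + \<mu> * v i * v j) z = G'" using res_eqI assms by blast
  hence "res_trace I (\<lambda>i j. A i j + \<mu> * v i * v j) z - res_trace I A z = - (of_real \<mu> * (\<Sum>i\<in>I. u i * u i) / D)"
    by (simp add: res_trace_def G'_def G_def[symmetric] sum_subtractf sum_distrib_left sum_divide_distrib mult_ac)
  hence "cmod (res_trace I (\<lambda>i j. A i j + \<mu> * v i * v j) z - res_trace I A z) = \<bar>\<mu>\<bar> * cmod (\<Sum>i\<in>I. u i * u i) / cmod D"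
    by (simp add: norm_mult norm_divide)
  also have "cmod (\<Sum>i\<in>I. u i * u i) \<le> S"
    unfolding S_def by (intro order_trans[OF norm_sum] sum_mono) (simp add: norm_mult power2_eq_square)
  hence "\<bar>\<mu>\<bar> * cmod (\<Sum>i\<in>I. u i * u i) / cmod D \<le> \<bar>\<mu>\<bar> * S / cmod D"
    by (intro divide_right_mono mult_left_mono) auto
  also have "\<dots> \<le> 1 / Im z"
  proof -
    have "\<bar>\<mu>\<bar> * S * Im z \<le> cmod D" using ImD abs_Im_le_cmod[of D] by (simp add: mult_ac)
    thus ?thesis using D0 assms(3) by (simp add: field_simps)
  qed
  finally show ?thesis .
qed

text \<open>Resolvent entries are obtained from the matrix entries by iterating the bordering formula, hence by
  finitely many arithmetic operations.\<close>

lemma borel_measurable_res: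
  fixes A :: "'a \<Rightarrow> 'i \<Rightarrow> 'i \<Rightarrow> real"
  assumes "finite I" "\<And>\<omega>. symmetric_on I (A \<omega>)" "Im z > 0"
    and "\<And>i j. i \<in> I \<Longrightarrow> j \<in> I \<Longrightarrow> (\<lambda>\<omega>. A \<omega> i j) \<in> borel_measurable M"
  shows "(\<lambda>\<omega>. res I (A \<omega>) z i j) \<in> borel_measurable M"
  using assms(1,2,4)
proof (induction I arbitrary: i j)
  case empty
  then show ?case by (simp add: res_outside assms(3))
next
  case (insert n I)
  have [measurable]: "(\<lambda>\<omega>. res I (A \<omega>) z i j) \<in> borel_measurable M" for i j
    using insert.prems symmetric_on_subset[of "insert n I" _ I] by (intro insert.IH) auto
  have [measurable]: "(\<lambda>\<omega>. A \<omega> i n) \<in> borel_measurable M" "(\<lambda>\<omega>. A \<omega> n i) \<in> borel_measurable M"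
    if "i \<in> insert n I" for i using insert.prems that by auto
  have w[measurable]: "(\<lambda>\<omega>. schur_vec I (A \<omega>) (res I (A \<omega>) z) n j) \<in> borel_measurable M" for j
    unfolding schur_vec_def by (intro borel_measurable_sum borel_measurable_times borel_measurable_of_real) auto
  have [measurable]: "(\<lambda>\<omega>. schur_den I (A \<omega>) z (res I (A \<omega>) z) n) \<in> borel_measurable M"
    unfolding schur_den_def
    by (intro borel_measurable_sum borel_measurable_diff borel_measurable_times borel_measurable_of_real) auto
  show ?case
    unfolding res_insert[OF insert.hyps insert.prems(1) assms(3)] schur_extend_def
    by (cases "i = n"; cases "j = n") simp_all
qed

lemma empirical_stieltjes_eq_res_trace:
  assumes "symmetric_on {..<N} A" "Im z > 0"
  shows "empirical_stieltjes (Matrix.mat N N (\<lambda>(i, j). A i j)) z = res_trace {..<N} A z / of_nat N"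
proof -
  define G where "G = res {..<N} A z"
  note r = is_resolvent_res[OF finite_lessThan assms, folded G_def]
  define T where "T = map_mat complex_of_real (Matrix.mat N N (\<lambda>(i, j). A i j)) - z \<cdot>\<^sub>m 1\<^sub>m N"
  define B where "B = Matrix.mat N N (\<lambda>(i, j). G i j)"
  have car: "T \<in> carrier_mat N N" "B \<in> carrier_mat N N" by (auto simp: T_def B_def)
  have TB: "T * B = 1\<^sub>m N"
  proof (rule eq_matI)
    fix i j assume ij: "i < dim_row (1\<^sub>m N :: complex mat)" "j < dim_col (1\<^sub>m N :: complex mat)"
    have "(T * B) $$ (i, j) = (\<Sum>k = 0..<N. (of_real (A i k) - z * of_bool (i = k)) * G k j)"
      using ij unfolding T_def B_def by (auto simp: scalar_prod_def intro!: sum.cong)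
    also have "\<dots> = (\<Sum>k<N. of_real (A i k) * G k j) - (\<Sum>k<N. if k = i then z * G k j else 0)"
      unfolding lessThan_atLeast0 sum_subtractf[symmetric] by (intro sum.cong) (auto simp: left_diff_distrib)
    also have "\<dots> = of_bool (i = j)" using r ij by (simp add: is_resolvent_def)
    finally show "(T * B) $$ (i, j) = 1\<^sub>m N $$ (i, j)" using ij by auto
  qed (auto simp: T_def B_def)
  have BT: "B * T = 1\<^sub>m N" by (rule mat_mult_left_right_inverse[OF car TB])
  have "T \<in> Units (ring_mat TYPE(complex) N ())"
    using car TB BT by (auto simp: Units_def ring_mat_def)
  then obtain B' where B': "mat_inverse T = Some B'"
    using mat_inverse(1)[OF car(1), where b = "()"] by (cases "mat_inverse T") auto
  hence "B' * T = 1\<^sub>m N" "B' \<in> carrier_mat N N" using mat_inverse(2)[OF car(1)] by auto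
  hence "B' * (T * B) = B" using assoc_mult_mat[of B' N N T N B N] car by simp
  hence "B' = B" using \<open>B' \<in> carrier_mat N N\<close> by (simp add: TB)
  hence "resolvent (Matrix.mat N N (\<lambda>(i, j). A i j)) z = B"
    using B' by (simp add: resolvent_def T_def)
  thus ?thesis by (simp add: empirical_stieltjes_def mat_trace_def B_def res_trace_def G_def)
qed

section \<open>The Stieltjes transform of the semicircle law\<close>

text \<open>Truncation of the generating function of the Chebyshev polynomials of the second kind. The exact remainder
  allows termwise integration without a theorem on interchanging limits.\<close>

lemma chebyshev_partial_sum:
  fixes w :: complex and x :: real
  shows "(1 - 2 * w * of_real (cos x) + w\<^sup>2) * (\<Sum>n<k. w ^ n * of_real (sin (real (Suc n) * x)))
    = of_real (sin x) - w ^ k * of_real (sin (real (Suc k) * x)) + w ^ Suc k * of_real (sin (real k * x))"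
proof (induction k)
  case 0
  then show ?case by simp
next
  case (Suc k)
  have "2 * cos x * sin (real (Suc k) * x) = sin (real (Suc (Suc k)) * x) + sin (real k * x)"
  proof -
    have "real (Suc (Suc k)) * x = real (Suc k) * x + x" "real k * x = real (Suc k) * x - x"
      by (simp_all add: algebra_simps)
    thus ?thesis by (simp only: sin_add sin_diff) simp
  qed
  hence trig: "2 * of_real (cos x) * of_real (sin (real (Suc k) * x))
      = (of_real (sin (real (Suc (Suc k)) * x)) + of_real (sin (real k * x)) :: complex)"
    by (metis of_real_add of_real_mult of_real_numeral)
  let ?s = "of_real (sin (real (Suc k) * x)) :: complex"
  have "(1 - 2 * w * of_real (cos x) + w\<^sup>2) * (\<Sum>n<Suc k. w ^ n * of_real (sin (real (Suc n) * x)))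
    = of_real (sin x) - w ^ k * ?s + w ^ Suc k * of_real (sin (real k * x))
      + (w ^ k * ?s - w ^ Suc k * (2 * of_real (cos x) * ?s) + w ^ Suc (Suc k) * ?s)"
    by (simp only: sum.lessThan_Suc distrib_left Suc) (simp add: algebra_simps power2_eq_square)
  also have "\<dots> = of_real (sin x) - w ^ Suc k * of_real (sin (real (Suc (Suc k)) * x)) + w ^ Suc (Suc k) * ?s"
    unfolding trig by (simp add: algebra_simps)
  finally show ?case .
qed

lemma sin_products_orthogonal:
  "((\<lambda>x. sin x * sin (real (Suc n) * x)) has_integral (if n = 0 then pi / 2 else 0)) {0..pi}"
proof -
  define F where "F x = (if n = 0 then x else sin (real n * x) / real n) / 2 - sin (real (n + 2) * x) / (2 * real (n + 2))" for x
  have "((\<lambda>x. sin x * sin (real (Suc n) * x)) has_integral (F pi - F 0)) {0..pi}"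
  proof (rule fundamental_theorem_of_calculus)
    fix x :: real
    have eq: "sin x * sin (real (Suc n) * x) = cos (real n * x) / 2 - cos (real (n + 2) * x) / 2"
    proof -
      have "real n * x = real (Suc n) * x - x" "real (n + 2) * x = real (Suc n) * x + x"
        by (simp_all add: algebra_simps)
      thus ?thesis by (simp only: cos_add cos_diff) (simp add: field_simps)
    qed
    have D: "((\<lambda>x. sin (a * x) / a) has_real_derivative cos (a * x)) (at x)" if "a \<noteq> 0" for a :: real
      using that by (auto intro!: derivative_eq_intros)
    have F: "F = (\<lambda>x. (if n = 0 then x else sin (real n * x) / real n) / 2 - sin (real (n + 2) * x) / real (n + 2) / 2)"
      by (simp add: F_def fun_eq_iff)
    have "(F has_real_derivative (cos (real n * x) / 2 - cos (real (n + 2) * x) / 2)) (at x)"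
    proof (cases "n = 0")
      case True
      thus ?thesis unfolding F using D[of "real (n + 2)"]
        by (auto intro!: derivative_eq_intros)
    next
      case False
      thus ?thesis unfolding F using D[of "real n"] D[of "real (n + 2)"]
        by (simp only: if_False) (intro DERIV_diff DERIV_cdivide; simp)
    qed
    thus "(F has_vector_derivative sin x * sin (real (Suc n) * x)) (at x within {0..pi})"
      unfolding eq by (simp add: has_real_derivative_iff_has_vector_derivative has_vector_derivative_at_within)
  qed simp
  moreover have "F pi - F 0 = (if n = 0 then pi / 2 else 0)"
    unfolding F_def sin_npi by simp
  ultimately show ?thesis by simp
qed

lemma poisson_kernel_nonzero:
  fixes w :: complex
  assumes "cmod w < 1"
  shows "1 - 2 * w * of_real (cos x) + w\<^sup>2 \<noteq> 0"
proof -
  have 1: "1 - 2 * w * of_real (cos x) + w\<^sup>2 = (1 - w * cis x) * (1 - w * cis (- x))"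
  proof -
    have "cis x * cis (- x) = 1" "cis x + cis (- x) = 2 * of_real (cos x)"
      by (simp_all add: cis_mult complex_eq_iff)
    thus ?thesis
      by (simp add: algebra_simps power2_eq_square) (metis (no_types, lifting) distrib_left mult.assoc mult.commute)
  qed
  have "w * cis y \<noteq> 1" for y
  proof
    assume "w * cis y = 1"
    hence "cmod (w * cis y) = 1" by simp
    thus False using assms by (simp add: norm_mult)
  qed
  thus ?thesis unfolding 1 by (metis eq_iff_diff_eq_0 mult_eq_0_iff)
qed

text \<open>Expanding the kernel into sines leaves only the first term by orthogonality; the remainder after \<open>k\<close>
  terms is of order \<open>\<bar>w\<bar>\<^sup>k\<close>.\<close>

lemma poisson_kernel_integral:
  fixes w :: complex
  assumes "cmod w < 1"
  shows "((\<lambda>x. of_real ((sin x)\<^sup>2) / (1 - 2 * w * of_real (cos x) + w\<^sup>2)) has_integral of_real (pi / 2)) {0..pi}"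
proof -
  let ?q = "\<lambda>x. 1 - 2 * w * of_real (cos x) + w\<^sup>2"
  let ?f = "\<lambda>x. of_real ((sin x)\<^sup>2) / ?q x"
  have cont: "continuous_on {0..pi} ?f"
    using poisson_kernel_nonzero[OF assms] by (intro continuous_intros) auto
  define I where "I = integral {0..pi} ?f"
  have I: "(?f has_integral I) {0..pi}"
    unfolding I_def by (rule integrable_integral[OF integrable_continuous_real[OF cont]])
  have "continuous_on {0..pi} (\<lambda>x. inverse (?q x))"
    using poisson_kernel_nonzero[OF assms] by (intro continuous_intros) auto
  hence "bounded ((\<lambda>x. inverse (?q x)) ` {0..pi})"
    by (intro compact_imp_bounded compact_continuous_image) auto
  then obtain C where C: "C > 0" "\<And>x. x \<in> {0..pi} \<Longrightarrow> cmod (inverse (?q x)) \<le> C"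
    by (auto simp: bounded_pos)
  have bound: "cmod (I - of_real (pi / 2)) \<le> (2 * C * pi) * cmod w ^ k" if k: "k > 0" for k
  proof -
    let ?g = "\<lambda>x. of_real (sin x) * (\<Sum>n<k. w ^ n * of_real (sin (real (Suc n) * x)))"
    have "((\<lambda>x. \<Sum>n<k. w ^ n * of_real (sin x * sin (real (Suc n) * x))) has_integral
        (\<Sum>n<k. w ^ n * of_real (if n = 0 then pi / 2 else 0))) {0..pi}"
      by (intro has_integral_sum has_integral_mult_right has_integral_of_real sin_products_orthogonal) auto
    moreover have "(\<Sum>n<k. w ^ n * of_real (if n = 0 then pi / 2 else 0)) = of_real (pi / 2)"
    proof -
      have "(\<Sum>n<k. w ^ n * of_real (if n = 0 then pi / 2 else 0)) = (\<Sum>n<k. if n = 0 then of_real (pi / 2) else (0::complex))"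
        by (rule sum.cong[OF refl]) simp
      thus ?thesis using k by simp
    qed
    moreover have "?g = (\<lambda>x. \<Sum>n<k. w ^ n * of_real (sin x * sin (real (Suc n) * x)))"
    proof
      fix x
      have "of_real (sin x) * (w ^ n * of_real (sin (real (Suc n) * x))) = w ^ n * of_real (sin x * sin (real (Suc n) * x))" for n
        by (simp only: of_real_mult mult_ac)
      thus "?g x = (\<Sum>n<k. w ^ n * of_real (sin x * sin (real (Suc n) * x)))"
        by (simp only: sum_distrib_left)
    qed
    ultimately have g: "(?g has_integral of_real (pi / 2)) {0..pi}"
      by (simp only:)
    have "((\<lambda>x. ?f x - ?g x) has_integral (I - of_real (pi / 2))) (cbox 0 pi)"
      using has_integral_diff[OF I g] by simp
    hence "cmod (I - of_real (pi / 2)) \<le> (2 * C * cmod w ^ k) * measure lborel (cbox 0 pi)"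
    proof (rule has_integral_bound[rotated])
      fix x :: real assume "x \<in> cbox 0 pi"
      hence x: "x \<in> {0..pi}" by simp
      let ?r = "w ^ k * of_real (sin (real (Suc k) * x)) - w ^ Suc k * of_real (sin (real k * x))"
      let ?P = "\<Sum>n<k. w ^ n * of_real (sin (real (Suc n) * x))"
      have "?q x * ?P = of_real (sin x) - ?r"
        using chebyshev_partial_sum[of w x k] by simp
      hence P: "?P = (of_real (sin x) - ?r) / ?q x"
        using nonzero_mult_div_cancel_left[OF poisson_kernel_nonzero[OF assms, of x], of ?P] by (simp only:)
      have "?f x - ?g x = of_real ((sin x)\<^sup>2) / ?q x - of_real (sin x) * ((of_real (sin x) - ?r) / ?q x)"
        unfolding P ..
      also have "\<dots> = of_real (sin x) * ?r * inverse (?q x)"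
        by (simp add: divide_inverse algebra_simps power2_eq_square)
      finally have "?f x - ?g x = of_real (sin x) * ?r * inverse (?q x)" .
      hence "cmod (?f x - ?g x) = \<bar>sin x\<bar> * cmod ?r * cmod (inverse (?q x))"
        by (simp add: norm_mult)
      also have "\<dots> \<le> 1 * (2 * cmod w ^ k) * C"
      proof (intro mult_mono C x)
        have 1: "cmod (w ^ k * of_real (sin (real (Suc k) * x))) \<le> cmod w ^ k * 1"
          unfolding norm_mult norm_power by (intro mult_left_mono) auto
        have 2: "cmod (w ^ Suc k * of_real (sin (real k * x))) \<le> cmod w ^ Suc k * 1"
          unfolding norm_mult norm_power by (intro mult_left_mono) auto
        have 3: "cmod w ^ Suc k \<le> cmod w ^ k" using assms by (intro power_decreasing) auto
        show "cmod ?r \<le> 2 * cmod w ^ k"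
          using norm_triangle_ineq4[of "w ^ k * of_real (sin (real (Suc k) * x))" "w ^ Suc k * of_real (sin (real k * x))"] 1 2 3
          by linarith
      qed (use C(1) in auto)
      finally show "cmod (?f x - ?g x) \<le> 2 * C * cmod w ^ k" by (simp add: mult_ac)
    qed (use C(1) in auto)
    thus ?thesis by (simp add: mult_ac)
  qed
  have "(\<lambda>k. (2 * C * pi) * cmod w ^ k) \<longlonglongrightarrow> (2 * C * pi) * 0"
    using assms by (intro tendsto_mult tendsto_const LIMSEQ_power_zero) simp
  moreover have "eventually (\<lambda>k. cmod (I - of_real (pi / 2)) \<le> (2 * C * pi) * cmod w ^ k) sequentially"
    by (rule eventually_mono[OF eventually_gt_at_top[of 0] bound])
  ultimately have "cmod (I - of_real (pi / 2)) \<le> 0"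
    by (intro tendsto_lowerbound) auto
  hence "I = of_real (pi / 2)" by (simp only: norm_le_zero_iff right_minus_eq)
  thus ?thesis using I by (simp only:)
qed

abbreviation (input) m_sc :: "complex \<Rightarrow> complex" where
  "m_sc \<equiv> stieltjes_transform semicircle"

text \<open>Substituting \<open>x = - 2 cos \<theta>\<close> and \<open>z = - (w + 1 / w)\<close> turns the integral into the one of
  \<open>poisson_kernel_integral\<close>.\<close>

lemma semicircle_stieltjes_param:
  fixes w :: complex
  assumes w: "cmod w < 1" "w \<noteq> 0" and z: "w\<^sup>2 + z * w + 1 = 0" and "Im z \<noteq> 0"
  shows "m_sc z = w"
proof -
  let ?sc = "\<lambda>x::real. 1 / (2 * pi) * sqrt (max 0 (4 - x\<^sup>2))"
  let ?h = "\<lambda>x::real. complex_of_real (?sc x) * (1 / (of_real x - z))"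
  have xz: "of_real x - z \<noteq> 0" for x :: real using \<open>Im z \<noteq> 0\<close> by (auto simp: complex_eq_iff)
  have cont: "continuous_on A ?h" for A using xz by (intro continuous_intros) auto
  have meas: "(\<lambda>x. 1 / (of_real x - z)) \<in> borel_measurable borel"
    using xz by (intro borel_measurable_continuous_onI continuous_intros) auto
  have "m_sc z = (\<integral>x. ?sc x *\<^sub>R (1 / (of_real x - z)) \<partial>lborel)"
    unfolding stieltjes_transform_def semicircle_def
    by (rule integral_density) (use meas in auto)
  also have "\<dots> = (\<integral>x. indicator {-2..2} x *\<^sub>R ?h x \<partial>lborel)"
  proof (rule Bochner_Integration.integral_cong[OF refl])
    fix x :: real
    have "?sc x = 0" if "x \<notin> {-2..2}"
    proof -
      have "\<bar>x\<bar> > 2" using that by auto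
      hence "x\<^sup>2 \<ge> 4" using power_mono[of 2 "\<bar>x\<bar>" 2] by simp
      thus ?thesis by simp
    qed
    thus "?sc x *\<^sub>R (1 / (of_real x - z)) = indicator {-2..2} x *\<^sub>R ?h x"
      by (cases "x \<in> {-2..2}") (auto simp: scaleR_conv_of_real)
  qed
  also have "\<dots> = integral {-2..2} ?h"
    using set_borel_integral_eq_integral(2)[of "{-2..2}" ?h]
      borel_integrable_atLeastAtMost'[OF cont] by (simp add: set_lebesgue_integral_def)
  also have "\<dots> = w"
  proof -
    have "((\<lambda>\<theta>. (2 * sin \<theta>) *\<^sub>R ?h (- 2 * cos \<theta>)) has_integral (integral {- 2 * cos 0..- 2 * cos pi} ?h)) {0..pi}"
    proof (rule has_integral_substitution)
      show "(\<lambda>\<theta>. - 2 * cos \<theta>) ` {0..pi} \<subseteq> {-2..2}"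
        using cos_ge_minus_one by (force simp: minus_le_iff)
      show "continuous_on {-2..2} ?h" by (rule cont)
    qed (auto intro!: derivative_eq_intros)
    moreover have "((\<lambda>\<theta>. (2 * sin \<theta>) *\<^sub>R ?h (- 2 * cos \<theta>)) has_integral (2 * w / of_real pi * of_real (pi / 2))) {0..pi}"
    proof (rule has_integral_eq[OF _ has_integral_mult_right[OF poisson_kernel_integral[OF w(1)]]])
      fix \<theta> assume \<theta>: "\<theta> \<in> {0..pi}"
      have "4 - (- 2 * cos \<theta>)\<^sup>2 = (2 * sin \<theta>)\<^sup>2"
        by (simp add: power_mult_distrib sin_squared_eq)
      moreover have "sin \<theta> \<ge> 0" using \<theta> by (simp add: sin_ge_zero)
      ultimately have "sqrt (max 0 (4 - (- 2 * cos \<theta>)\<^sup>2)) = 2 * sin \<theta>"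
        by (intro real_sqrt_unique) (simp_all add: max_def)
      hence sc: "?sc (- 2 * cos \<theta>) = sin \<theta> / pi" by simp
      have "z = - (w\<^sup>2 + 1) / w" using z w(2) by (simp add: field_simps eq_neg_iff_add_eq_0)
      hence den: "of_real (- 2 * cos \<theta>) - z = (1 - 2 * w * of_real (cos \<theta>) + w\<^sup>2) / w"
        using w(2) by (simp add: field_simps)
      show "2 * w / of_real pi * (of_real ((sin \<theta>)\<^sup>2) / (1 - 2 * w * of_real (cos \<theta>) + w\<^sup>2)) = (2 * sin \<theta>) *\<^sub>R ?h (- 2 * cos \<theta>)"
        unfolding sc den using w(2) by (simp add: scaleR_conv_of_real power2_eq_square)
    qed
    ultimately have "integral {- 2 * cos 0..- 2 * cos pi} ?h = 2 * w / of_real pi * of_real (pi / 2)"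
      by (rule has_integral_unique)
    thus ?thesis by simp
  qed
  finally show ?thesis .
qed

text \<open>The two roots have product 1 and neither lies on the unit circle, where \<open>z = - 2 Re w\<close> would be real.
  The root inside the disc is therefore available as \<open>w\<close> in \<open>semicircle_stieltjes_param\<close>.\<close>

lemma semicircle_stieltjes:
  assumes "Im z > 0"
  defines "m \<equiv> m_sc z"
  shows "m\<^sup>2 + z * m + 1 = 0" "Im m > 0" "cmod m < 1"
proof -
  define d where "d = csqrt (z\<^sup>2 - 4)"
  have d2: "d\<^sup>2 = z\<^sup>2 - 4" by (simp add: d_def)
  define a where "a = (- z + d) / 2"
  define b where "b = (- z - d) / 2"
  have "a * b = (z\<^sup>2 - d\<^sup>2) / 4" by (simp add: a_def b_def field_simps power2_eq_square)
  hence ab: "a * b = 1" by (simp add: d2)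
  have "a\<^sup>2 + z * a + 1 = (d\<^sup>2 - z\<^sup>2 + 4) / 4" "b\<^sup>2 + z * b + 1 = (d\<^sup>2 - z\<^sup>2 + 4) / 4"
    by (simp_all add: a_def b_def field_simps power2_eq_square)
  hence a: "a\<^sup>2 + z * a + 1 = 0" and b: "b\<^sup>2 + z * b + 1 = 0"
    by (simp_all add: d2)
  have not1: "cmod w \<noteq> 1" if "w\<^sup>2 + z * w + 1 = 0" for w
  proof
    assume 1: "cmod w = 1"
    hence w: "w \<noteq> 0" "w * cnj w = 1" by (auto simp: complex_norm_square[symmetric])
    have "cnj w * (w\<^sup>2 + z * w + 1) = (w * cnj w) * w + z * (w * cnj w) + cnj w"
      by (simp add: algebra_simps power2_eq_square)
    hence "w + z + cnj w = 0" using that w(2) by simp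
    hence "Im (w + z + cnj w) = 0" by simp
    thus False using assms(1) by simp
  qed
  have "cmod a * cmod b = 1" using ab by (metis norm_mult norm_one)
  have "cmod a < 1 \<or> cmod b < 1"
  proof (rule ccontr)
    assume "\<not> (cmod a < 1 \<or> cmod b < 1)"
    hence "1 < cmod a" "1 < cmod b" using not1[OF a] not1[OF b] by auto
    thus False using less_1_mult[of "cmod a" "cmod b"] \<open>cmod a * cmod b = 1\<close> by simp
  qed
  then obtain w where w: "cmod w < 1" "w\<^sup>2 + z * w + 1 = 0" using a b by blast
  hence w0: "w \<noteq> 0" by auto
  have m: "m = w" unfolding m_def
    by (rule semicircle_stieltjes_param[OF w(1) w0 w(2)]) (use assms(1) in simp)
  have "Im w > 0"
  proof -
    have "cnj w * (w\<^sup>2 + z * w + 1) = (w * cnj w) * (w + z) + cnj w"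
      by (simp add: algebra_simps power2_eq_square)
    moreover define r where "r = (cmod w)\<^sup>2"
    ultimately have "of_real r * (w + z) + cnj w = 0"
      using w(2) by (simp only: complex_norm_square r_def mult_zero_right)
    hence "Im (of_real r * (w + z) + cnj w) = 0" by (simp only: zero_complex.sel)
    hence "Im w * (1 - r) = r * Im z" by (simp add: algebra_simps)
    moreover have "r * Im z > 0" using w0 assms(1) by (simp add: r_def)
    moreover have "1 - r > 0" using w(1) by (simp add: r_def power_less_one_iff abs_square_less_1)
    ultimately show ?thesis by (metis mult.commute zero_less_mult_pos)
  qed
  thus "m\<^sup>2 + z * m + 1 = 0" "Im m > 0" "cmod m < 1" using m w by auto
qed

section \<open>The self-consistent equation and its stability\<close>

text \<open>With \<open>v\<close> the variance of the entries of row \<open>i\<close>, this is the centred quadratic form in the Schur complement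
  of index \<open>i\<close>.\<close>

definition fluctuation :: "'i set \<Rightarrow> ('i \<Rightarrow> 'i \<Rightarrow> real) \<Rightarrow> real \<Rightarrow> complex \<Rightarrow> 'i \<Rightarrow> complex" where
  "fluctuation I A v z i =
     (\<Sum>j\<in>I - {i}. \<Sum>k\<in>I - {i}. of_real (A i j) * res (I - {i}) A z j k * of_real (A k i))
       - of_real v * res_trace (I - {i}) A z"

definition frobenius :: "'i set \<Rightarrow> ('i \<Rightarrow> 'i \<Rightarrow> real) \<Rightarrow> complex \<Rightarrow> real" where
  "frobenius I A z = sqrt (\<Sum>j\<in>I. \<Sum>k\<in>I. (cmod (res I A z j k))\<^sup>2)"

lemma res_diag_schur:
  assumes "finite I" "symmetric_on I A" "Im z > 0" "i \<in> I"
  shows "res I A z i i * (of_real (A i i) - z - of_real v * res_trace (I - {i}) A z - fluctuation I A v z i) = 1"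
proof -
  define I' where "I' = I - {i}"
  have I: "insert i I' = I" "i \<notin> I'" "finite I'" using assms by (auto simp: I'_def)
  have s: "symmetric_on (insert i I') A" "symmetric_on I' A"
    using assms(2) I symmetric_on_subset[of I A I'] by (auto simp: I'_def)
  note r = is_resolvent_res[OF I(3) s(2) assms(3)]
  have d: "schur_den I' A z (res I' A z) i = of_real (A i i) - z - of_real v * res_trace I' A z - fluctuation I A v z i"
    by (simp add: schur_den_def schur_vec_def fluctuation_def I'_def[symmetric] sum_distrib_left mult.assoc)
  have "Im (schur_den I' A z (res I' A z) i) < 0"
    using Im_schur_den[OF I(3,2) s(1) r] assms(3) by (simp add: add_pos_nonneg sum_nonneg mult_pos_pos)
  hence "schur_den I' A z (res I' A z) i \<noteq> 0" by auto
  thus ?thesis using res_insert_diag[OF I(3,2) s(1) assms(3)] I(1) d by (simp add: I'_def)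
qed

lemma cmod_quadratic_root:
  fixes m z :: complex
  assumes "m\<^sup>2 + z * m + 1 = 0"
  shows "cmod m * cmod (z + m) = 1"
proof -
  have "m * (z + m) = - 1" using assms by (simp add: algebra_simps power2_eq_square add_eq_0_iff)
  thus ?thesis by (metis norm_minus_cancel norm_mult norm_one)
qed

text \<open>Write \<open>1 / G\<^sub>i\<^sub>i = Y\<^sub>i - (z + s)\<close>. Since \<open>\<bar>s - m\<bar> \<le> 1 / 2\<close> and \<open>\<bar>z + m\<bar> = 1 / \<bar>m\<bar> > 1\<close>, the shift
  \<open>z + s\<close> stays away from 0, so that \<open>\<bar>G\<^sub>i\<^sub>i\<bar> \<le> 4\<close> once all \<open>\<bar>Y\<^sub>i\<bar>\<close> are at most \<open>1 / 4\<close>. Averaging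
  \<open>G\<^sub>i\<^sub>i (z + s) + 1 = G\<^sub>i\<^sub>i Y\<^sub>i\<close> gives the claim. The smallness of \<open>Y\<^sub>i\<close> uses the Ward identity for the minor,
  whose trace is at most \<open>3 n\<close> in modulus.\<close>

lemma self_consistent_equation:
  fixes A :: "'i \<Rightarrow> 'i \<Rightarrow> real"
  assumes I: "finite I" "I \<noteq> {}" and sym: "symmetric_on I A" and z: "Im z > 0"
  defines "n \<equiv> real (card I)"
  defines "s \<equiv> res_trace I A z / of_real n" and "\<psi> \<equiv> 1 / sqrt (n * Im z)"
  assumes m: "m\<^sup>2 + z * m + 1 = 0" "cmod m < 1" "cmod (s - m) \<le> 1 / 2"
    and scale: "n * Im z \<ge> 1" and B: "B \<ge> 1"
    and diag: "\<And>i. i \<in> I \<Longrightarrow> \<bar>A i i\<bar> \<le> B * \<psi>"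
    and var: "\<bar>v * n - 1\<bar> \<le> B * \<psi>"
    and fluct: "\<And>i. i \<in> I \<Longrightarrow> cmod (fluctuation I A v z i) \<le> B / n * frobenius (I - {i}) A z"
    and small: "28 * B * \<psi> \<le> 1"
  shows "cmod (s\<^sup>2 + z * s + 1) \<le> 28 * B * \<psi>"
proof -
  define e where "e = 7 * B * \<psi>"
  have n: "n > 0" using I by (simp add: n_def card_gt_0_iff)
  have psi0: "\<psi> > 0" unfolding \<psi>_def using scale by simp
  have psi2: "\<psi>\<^sup>2 = 1 / (n * Im z)" unfolding \<psi>_def using scale by (simp add: power_divide)
  have psi1: "\<psi> \<le> 1" unfolding \<psi>_def using scale by simp
  have psisq: "\<psi>\<^sup>2 \<le> \<psi>" using psi0 psi1 by (simp add: power2_eq_square mult_left_le)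
  have s2: "cmod s \<le> 2"
    using norm_triangle_ineq[of "s - m" m] m(2,3) by simp
  have zs: "cmod (z + s) \<ge> 1 / 2"
  proof -
    have "1 \<le> cmod (z + m)" using cmod_quadratic_root[OF m(1)] m(2) mult_right_mono[of "cmod m" 1 "cmod (z + m)"] by simp
    thus ?thesis using norm_triangle_ineq4[of "z + s" "s - m"] m(3) by (simp add: algebra_simps)
  qed
  define Y where "Y i = of_real (A i i) - (of_real v * res_trace (I - {i}) A z - s) - fluctuation I A v z i" for i
  have GY: "res I A z i i * (Y i - (z + s)) = 1" if "i \<in> I" for i
    using res_diag_schur[OF I(1) sym z that, of v] by (simp add: Y_def algebra_simps)
  have Y: "cmod (Y i) \<le> e" if i: "i \<in> I" for i
  proof -
    define T where "T = res_trace (I - {i}) A z"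
    have ins: "insert i (I - {i}) = I" using i by auto
    have fin: "finite (I - {i})" and sym': "symmetric_on (I - {i}) A"
      using I(1) symmetric_on_subset[OF sym] by auto
    have "cmod (res_trace I A z - T) \<le> 1 / Im z"
      using res_trace_insert[OF fin _ _ z, of i A] sym unfolding ins T_def by auto
    moreover have trI: "res_trace I A z = of_real n * s" using n by (simp add: s_def)
    ultimately have T: "cmod (of_real n * s - T) \<le> n * \<psi>\<^sup>2"
      using n psi2 by (simp add: field_simps)
    have Tn: "cmod T \<le> n * 3"
    proof -
      have "cmod T \<le> cmod (of_real n * s) + cmod (of_real n * s - T)"
        by (metis norm_minus_commute norm_triangle_sub)
      also have "\<dots> \<le> n * 2 + n * 1"
      proof (rule add_mono)
        show "cmod (of_real n * s) \<le> n * 2" using s2 n by (simp add: norm_mult)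
        show "cmod (of_real n * s - T) \<le> n * 1"
          using T mult_left_mono[of "\<psi>\<^sup>2" 1 n] psisq psi1 n by linarith
      qed
      finally show ?thesis by simp
    qed
    have 1: "cmod (of_real v * T - s) \<le> 3 * (B * \<psi>) + \<psi>"
    proof -
      have "of_real v * T - s = of_real (v * n - 1) * (T / of_real n) - (of_real n * s - T) / of_real n"
        using n by (simp add: field_simps)
      hence "cmod (of_real v * T - s) \<le> cmod (of_real (v * n - 1) * (T / of_real n)) + cmod ((of_real n * s - T) / of_real n)"
        by (metis norm_triangle_ineq4)
      also have "cmod (of_real (v * n - 1) * (T / of_real n)) = \<bar>v * n - 1\<bar> * (cmod T / n)"
        using n by (simp only: norm_mult norm_divide norm_of_real abs_of_pos)
      also have "\<dots> \<le> (B * \<psi>) * 3"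
        using var Tn n psi0 B by (intro mult_mono) (auto simp: field_simps)
      also have "cmod ((of_real n * s - T) / of_real n) \<le> \<psi>\<^sup>2"
        using T n by (simp add: norm_divide field_simps)
      finally show ?thesis using psisq by linarith
    qed
    have 2: "cmod (fluctuation I A v z i) \<le> 2 * (B * \<psi>)"
    proof -
      let ?S = "\<Sum>j\<in>I - {i}. \<Sum>k\<in>I - {i}. (cmod (res (I - {i}) A z j k))\<^sup>2"
      have "Im z * ?S = Im T" using res_trace_ward[OF fin sym' z] by (simp add: T_def)
      also have "\<dots> \<le> n * 3" using Tn abs_Im_le_cmod[of T] by linarith
      finally have "?S \<le> n * 3 / Im z" using z by (simp add: field_simps)
      also have "n * 3 / Im z = 3 * (n * \<psi>)\<^sup>2"
      proof -
        have "3 * (n * \<psi>)\<^sup>2 = 3 * (n\<^sup>2 * \<psi>\<^sup>2)" by (simp add: power_mult_distrib)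
        also have "\<dots> = n * 3 / Im z"
          unfolding psi2 using n z by (simp add: field_simps power2_eq_square)
        finally show ?thesis by simp
      qed
      also have "\<dots> \<le> (2 * (n * \<psi>))\<^sup>2" by (simp add: power_mult_distrib)
      finally have "frobenius (I - {i}) A z \<le> 2 * (n * \<psi>)"
        unfolding frobenius_def using n psi0 by (intro real_le_lsqrt) (auto intro!: sum_nonneg)
      hence "B / n * frobenius (I - {i}) A z \<le> B / n * (2 * (n * \<psi>))"
        using B n by (intro mult_left_mono) auto
      thus ?thesis using fluct[OF i] n by simp
    qed
    have 3: "\<psi> \<le> B * \<psi>" using B psi0 by simp
    have "cmod (Y i) \<le> \<bar>A i i\<bar> + cmod (of_real v * T - s) + cmod (fluctuation I A v z i)"
      unfolding Y_def T_def[symmetric]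
      using norm_triangle_ineq4[of "of_real (A i i) - (of_real v * T - s)" "fluctuation I A v z i"]
        norm_triangle_ineq4[of "of_real (A i i) :: complex" "of_real v * T - s"] by simp
    thus ?thesis using 1 2 3 diag[OF i] by (simp add: e_def)
  qed
  have e: "e \<le> 1 / 4" using small by (simp add: e_def)
  have G4: "cmod (res I A z i i) \<le> 4" if i: "i \<in> I" for i
  proof -
    have "cmod (Y i - (z + s)) \<ge> 1 / 4"
      using norm_triangle_ineq3[of "z + s" "Y i"] Y[OF i] e zs by (simp add: norm_minus_commute)
    moreover have "cmod (res I A z i i) * cmod (Y i - (z + s)) = 1"
      using GY[OF i] by (metis norm_mult norm_one)
    ultimately have "cmod (res I A z i i) * (1 / 4) \<le> 1"
      by (metis mult_left_mono norm_ge_zero)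
    thus ?thesis by simp
  qed
  have "of_real n * (s\<^sup>2 + z * s + 1) = (\<Sum>i\<in>I. res I A z i i * Y i)"
  proof -
    have "(\<Sum>i\<in>I. res I A z i i * Y i) = (\<Sum>i\<in>I. res I A z i i * (z + s) + 1)"
      using GY by (intro sum.cong refl) (simp add: algebra_simps)
    also have "\<dots> = res_trace I A z * (z + s) + of_real n"
      by (simp add: sum.distrib res_trace_def sum_distrib_right n_def)
    also have "\<dots> = of_real n * (s\<^sup>2 + z * s + 1)"
      using n by (simp add: s_def field_simps power2_eq_square)
    finally show ?thesis by simp
  qed
  hence "n * cmod (s\<^sup>2 + z * s + 1) = cmod (\<Sum>i\<in>I. res I A z i i * Y i)"
    using n by (simp only: norm_mult norm_of_real abs_of_pos flip: \<open>of_real n * (s\<^sup>2 + z * s + 1) = _\<close>)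
  also have "\<dots> \<le> of_nat (card I) * (4 * e)"
  proof (rule sum_norm_bound)
    fix i assume i: "i \<in> I"
    show "cmod (res I A z i i * Y i) \<le> 4 * e"
      unfolding norm_mult using G4[OF i] Y[OF i] by (intro mult_mono) auto
  qed
  finally show ?thesis using n by (simp add: n_def[symmetric] e_def)
qed

text \<open>The left-hand side factors as \<open>(s - m) (s - m')\<close> with \<open>m' = - z - m\<close>, and \<open>\<alpha> = \<bar>m - m'\<bar>\<close>. If the roots are
  closer than the square root of the error, they need not be told apart; otherwise knowing that \<open>s\<close> is nearer to \<open>m\<close>
  improves the estimate to \<open>2 q / \<alpha>\<close>.\<close>

lemma quadratic_stability:
  fixes s m z :: complex and q :: real
  assumes m: "m\<^sup>2 + z * m + 1 = 0" and q: "cmod (s\<^sup>2 + z * s + 1) \<le> q" "q > 0"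
  defines "\<alpha> \<equiv> cmod (z + 2 * m)"
  shows "\<alpha>\<^sup>2 \<le> 16 * q \<Longrightarrow> cmod (s - m) \<le> 8 * sqrt q"
    and "cmod (s - m) \<le> \<alpha> / 2 \<Longrightarrow> \<alpha> > 0 \<Longrightarrow> cmod (s - m) \<le> 2 * q / \<alpha>"
proof -
  let ?L = "cmod (s - m)"
  have "s\<^sup>2 + z * s + 1 = (s - m) * ((s - m) + (z + 2 * m)) + (m\<^sup>2 + z * m + 1)"
    by (simp add: algebra_simps power2_eq_square)
  hence prod: "?L * cmod ((s - m) + (z + 2 * m)) \<le> q" using m q(1) by (simp add: norm_mult)
  {
    assume a: "\<alpha>\<^sup>2 \<le> 16 * q"
    show "?L \<le> 8 * sqrt q"
    proof (rule ccontr)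
      assume "\<not> ?L \<le> 8 * sqrt q"
      hence L: "?L > 8 * sqrt q" by simp
      have "\<alpha> \<le> sqrt (16 * q)" using a by (rule real_le_rsqrt)
      hence "\<alpha> \<le> 4 * sqrt q" by (simp add: real_sqrt_mult)
      hence "cmod ((s - m) + (z + 2 * m)) \<ge> 4 * sqrt q"
        using norm_diff_ineq[of "s - m" "z + 2 * m"] L unfolding \<alpha>_def by linarith
      hence "?L * cmod ((s - m) + (z + 2 * m)) \<ge> (8 * sqrt q) * (4 * sqrt q)"
        using L q(2) by (intro mult_mono) auto
      moreover have "(8 * sqrt q) * (4 * sqrt q) = 32 * q" using q(2) by simp
      ultimately show False using prod q(2) by linarith
    qed
  }
  {
    assume a: "?L \<le> \<alpha> / 2" "\<alpha> > 0"
    have "cmod ((s - m) + (z + 2 * m)) \<ge> \<alpha> / 2"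
      using norm_diff_ineq[of "z + 2 * m" "s - m"] a by (simp add: \<alpha>_def add.commute)
    hence "?L * (\<alpha> / 2) \<le> ?L * cmod ((s - m) + (z + 2 * m))" by (intro mult_left_mono) auto
    hence "?L * (\<alpha> / 2) \<le> q" using prod by linarith
    thus "?L \<le> 2 * q / \<alpha>" using a(2) by (simp add: field_simps)
  }
qed

text \<open>The index \<open>j\<close> runs over spectral parameters with increasing imaginary part, and the induction goes down from
  \<open>L\<close>. The conclusion at \<open>j + 1\<close> gives \<open>\<bar>s - m\<bar> \<le> 1 / 4\<close> there, hence at most \<open>1 / 2\<close> at \<open>j\<close>, which makes the
  self-consistent equation available. If the roots are well separated at \<open>j\<close>, they are so at \<open>j + 1\<close>; then
  \<open>\<bar>s - m\<bar> \<le> \<alpha> / 8\<close> at \<open>j + 1\<close>, and a step of length at most \<open>sqrt q < \<alpha> / 4\<close> cannot reach the other root.\<close>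

lemma continuity_induction:
  fixes s m z :: "nat \<Rightarrow> complex" and q :: "nat \<Rightarrow> real"
  defines "\<alpha> \<equiv> \<lambda>j. cmod (z j + 2 * m j)"
  assumes m: "\<And>j. j \<le> L \<Longrightarrow> (m j)\<^sup>2 + z j * m j + 1 = 0"
    and sce: "\<And>j. j \<le> L \<Longrightarrow> cmod (s j - m j) \<le> 1 / 2 \<Longrightarrow> cmod ((s j)\<^sup>2 + z j * s j + 1) \<le> q j"
    and q: "\<And>j. j \<le> L \<Longrightarrow> q j > 0" "\<And>j. j \<le> L \<Longrightarrow> 8 * sqrt (q j) \<le> 1 / 4"
    and mono: "\<And>j. j < L \<Longrightarrow> q (Suc j) \<le> q j" "\<And>j. j < L \<Longrightarrow> \<alpha> j \<le> \<alpha> (Suc j)"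
    and step: "\<And>j. j < L \<Longrightarrow> cmod (s j - m j) \<le> cmod (s (Suc j) - m (Suc j)) + d"
    and d: "d \<le> 1 / 4" "\<And>j. j \<le> L \<Longrightarrow> d \<le> sqrt (q j)"
    and top: "cmod (s L - m L) \<le> 1 / 2" "cmod (s L - m L) \<le> \<alpha> L / 2"
    and j: "j \<le> L"
  shows "if (\<alpha> j)\<^sup>2 \<le> 16 * q j then cmod (s j - m j) \<le> 8 * sqrt (q j) else cmod (s j - m j) \<le> 2 * q j / \<alpha> j"
proof -
  have nn: "\<alpha> j \<ge> 0" for j by (simp add: \<alpha>_def)
  have large: "\<alpha> j > 4 * sqrt (q j)" "\<alpha> j > 0" if "j \<le> L" "\<not> (\<alpha> j)\<^sup>2 \<le> 16 * q j" for j
  proof -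
    have "sqrt (16 * q j) < \<alpha> j" using that nn[of j] by (intro real_less_lsqrt) auto
    thus "\<alpha> j > 4 * sqrt (q j)" by (simp add: real_sqrt_mult)
    moreover have "sqrt (q j) > 0" using q(1)[OF that(1)] by simp
    ultimately show "\<alpha> j > 0" by linarith
  qed
  have ratio: "2 * q j / \<alpha> j \<le> sqrt (q j) / 2" "2 * q j / \<alpha> j \<le> \<alpha> j / 8"
    if "j \<le> L" "\<not> (\<alpha> j)\<^sup>2 \<le> 16 * q j" for j
  proof -
    have "q j = sqrt (q j) * sqrt (q j)" using q(1)[OF that(1)] by simp
    also have "\<dots> \<le> sqrt (q j) * (\<alpha> j / 4)"
      using large[OF that] q(1)[OF that(1)] by (intro mult_left_mono) auto
    finally show "2 * q j / \<alpha> j \<le> sqrt (q j) / 2" using large(2)[OF that] by (simp add: field_simps)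
    show "2 * q j / \<alpha> j \<le> \<alpha> j / 8" using that(2) large(2)[OF that] by (simp add: field_simps power2_eq_square)
  qed
  have concl: "if (\<alpha> j)\<^sup>2 \<le> 16 * q j then cmod (s j - m j) \<le> 8 * sqrt (q j) else cmod (s j - m j) \<le> 2 * q j / \<alpha> j"
    if "j \<le> L" "cmod (s j - m j) \<le> 1 / 2" "\<not> (\<alpha> j)\<^sup>2 \<le> 16 * q j \<Longrightarrow> cmod (s j - m j) \<le> \<alpha> j / 2" for j
  proof -
    have a: "cmod (z j + 2 * m j) = \<alpha> j" by (simp add: \<alpha>_def)
    note quadratic_stability[OF m[OF that(1)] sce[OF that(1,2)] q(1)[OF that(1)], unfolded a]
    thus ?thesis using that(3) large(2)[OF that(1)] by auto
  qed
  show ?thesis using j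
  proof (induction j rule: inc_induct)
    case base
    show ?case using top by (intro concl) auto
  next
    case (step j)
    have L: "j \<le> L" "Suc j \<le> L" using step.hyps by auto
    have IH: "cmod (s (Suc j) - m (Suc j)) \<le> 1 / 4"
    proof (cases "(\<alpha> (Suc j))\<^sup>2 \<le> 16 * q (Suc j)")
      case True thus ?thesis using step.IH q(2)[OF L(2)] by simp
    next
      case False
      hence "cmod (s (Suc j) - m (Suc j)) \<le> sqrt (q (Suc j)) / 2" using step.IH ratio(1)[OF L(2) False] by simp
      moreover have "sqrt (q (Suc j)) \<ge> 0" using q(1)[OF L(2)] by simp
      ultimately show ?thesis using q(2)[OF L(2)] by linarith
    qed
    note st = assms(8)[OF step.hyps(2)]
    show ?case
    proof (rule concl[OF L(1)])
      show "cmod (s j - m j) \<le> 1 / 2" using st IH d(1) by linarith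
      assume big: "\<not> (\<alpha> j)\<^sup>2 \<le> 16 * q j"
      have "(\<alpha> j)\<^sup>2 \<le> (\<alpha> (Suc j))\<^sup>2" using mono(2)[OF step.hyps(2)] nn[of j] by (intro power_mono)
      hence big': "\<not> (\<alpha> (Suc j))\<^sup>2 \<le> 16 * q (Suc j)" using big mono(1)[OF step.hyps(2)] by linarith
      hence "cmod (s (Suc j) - m (Suc j)) \<le> 2 * q (Suc j) / \<alpha> (Suc j)" using step.IH by simp
      also have "\<dots> \<le> 2 * q j / \<alpha> j"
        using mono[OF step.hyps(2)] q(1)[OF L(2)] large(2)[OF L(1) big] by (intro frac_le) auto
      also have "\<dots> \<le> \<alpha> j / 8" by (rule ratio(2)[OF L(1) big])
      finally have "cmod (s (Suc j) - m (Suc j)) \<le> \<alpha> j / 8" .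
      thus "cmod (s j - m j) \<le> \<alpha> j / 2" using st d(2)[OF L(1)] large[OF L(1) big] by linarith
    qed
  qed
qed

lemma discriminant_semicircle:
  assumes "Im z > 0"
  defines "m \<equiv> m_sc z"
  shows "(cmod (z + 2 * m))\<^sup>2 = cmod (z - 2) * cmod (z + 2)"
proof -
  have "(z + 2 * m)\<^sup>2 = (z - 2) * (z + 2) + 4 * (m\<^sup>2 + z * m + 1)"
    by (simp add: algebra_simps power2_eq_square)
  hence "(z + 2 * m)\<^sup>2 = (z - 2) * (z + 2)" using semicircle_stieltjes(1)[OF assms(1)] by (simp add: m_def)
  thus ?thesis by (metis norm_mult norm_power)
qed

text \<open>One of the factors is at least 2, the other at least half of the left-hand side.\<close>

lemma edge_distance_le:
  assumes "Im z > 0"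
  shows "\<bar>\<bar>Re z\<bar> - 2\<bar> + Im z \<le> cmod (z - 2) * cmod (z + 2)"
proof -
  have a: "\<bar>Re z - 2\<bar> \<le> cmod (z - 2)" "\<bar>Re z + 2\<bar> \<le> cmod (z + 2)" "Im z \<le> cmod (z - 2)" "Im z \<le> cmod (z + 2)"
    using abs_Re_le_cmod[of "z - 2"] abs_Re_le_cmod[of "z + 2"] abs_Im_le_cmod[of "z - 2"] abs_Im_le_cmod[of "z + 2"] assms by auto
  show ?thesis
  proof (cases "Re z \<ge> 0")
    case True
    have "cmod (z - 2) * 2 \<le> cmod (z - 2) * cmod (z + 2)" using a True by (intro mult_left_mono) auto
    thus ?thesis using a True by auto
  next
    case False
    have "2 * cmod (z + 2) \<le> cmod (z - 2) * cmod (z + 2)" using a False by (intro mult_right_mono) auto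
    thus ?thesis using a False by auto
  qed
qed

text \<open>Subtracting the two quadratic equations gives \<open>(m - m') (m + m' + z) = - (z - z') m'\<close>, and the imaginary
  part of the second factor is at least \<open>Im z\<close>.\<close>

lemma semicircle_stieltjes_Lipschitz:
  assumes "Im z > 0" "Im z' > 0"
  shows "cmod (m_sc z - m_sc z') \<le> cmod (z - z') / Im z"
proof -
  let ?m = "m_sc z" and ?m' = "m_sc z'"
  note m = semicircle_stieltjes[OF assms(1)] and m' = semicircle_stieltjes[OF assms(2)]
  have "(?m - ?m') * (?m + ?m' + z) = (?m\<^sup>2 + z * ?m + 1) - (?m'\<^sup>2 + z' * ?m' + 1) - (z - z') * ?m'"
    by (simp add: algebra_simps power2_eq_square)
  hence "(?m - ?m') * (?m + ?m' + z) = - ((z - z') * ?m')" using m(1) m'(1) by simp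
  hence "cmod (?m - ?m') * cmod (?m + ?m' + z) = cmod (z - z') * cmod ?m'"
    by (metis norm_minus_cancel norm_mult)
  also have "\<dots> \<le> cmod (z - z') * 1" using m'(3) by (intro mult_left_mono) auto
  finally have 1: "cmod (?m - ?m') * cmod (?m + ?m' + z) \<le> cmod (z - z')" by simp
  have "Im z \<le> cmod (?m + ?m' + z)"
    using abs_Im_le_cmod[of "?m + ?m' + z"] m(2) m'(2) by simp
  hence "cmod (?m - ?m') * Im z \<le> cmod (?m - ?m') * cmod (?m + ?m' + z)" by (intro mult_left_mono) auto
  thus ?thesis using 1 assms(1) by (simp add: field_simps)
qed

lemma semicircle_stieltjes_bound:
  assumes "Im z > 0"
  shows "cmod (m_sc z) \<le> 1 / Im z"
proof -
  let ?m = "m_sc z"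
  note m = semicircle_stieltjes[OF assms]
  note 1 = cmod_quadratic_root[OF m(1)]
  have "Im z \<le> cmod (z + ?m)" using abs_Im_le_cmod[of "z + ?m"] m(2) by simp
  hence "cmod ?m * Im z \<le> 1" using 1 mult_left_mono[of "Im z" "cmod (z + ?m)" "cmod ?m"] by simp
  thus ?thesis using assms by (simp add: field_simps)
qed

text \<open>All randomness is confined to the hypothesis on the fluctuations, which is required on the finite grid
  \<open>z + \<i> j / N\<^sup>4\<close>. Both transforms are Lipschitz with constant at most \<open>N\<^sup>2\<close> on this grid, so a step changes each
  of them by at most \<open>N\<^sup>-\<^sup>2\<close>. The grid has height 4, where \<open>\<bar>s\<bar>\<close> and \<open>\<bar>m\<bar>\<close> are at most \<open>1 / 4\<close> and the roots are at
  distance at least 4, so the induction can start. The final bound combines both alternatives of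
  \<open>continuity_induction\<close>, using \<open>\<alpha>\<^sup>2 \<ge> \<kappa> + \<eta>\<close>, and restores the rank-one part \<open>\<mu>\<close>.\<close>

lemma deterministic_local_law:
  fixes A :: "nat \<Rightarrow> nat \<Rightarrow> real" and z :: complex
  assumes sym: "symmetric_on {..<N} A" and N: "N \<ge> 3" and B: "B \<ge> 1"
    and scale: "real N * Im z \<ge> 1" and H: "Im z + 4 \<le> H" "H \<le> real N ^ 7"
    and diag: "\<And>i. i < N \<Longrightarrow> \<bar>A i i\<bar> \<le> B / sqrt (real N * H)"
    and var: "\<bar>v * real N - 1\<bar> \<le> B / sqrt (real N * H)"
    and fluct: "\<And>i j. i < N \<Longrightarrow> j \<le> 4 * N ^ 4 \<Longrightarrow>
      cmod (fluctuation {..<N} A v (z + of_real (real j / real N ^ 4) * \<i>) i)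
        \<le> B / real N * frobenius ({..<N} - {i}) A (z + of_real (real j / real N ^ 4) * \<i>)"
    and small: "28 * B * (1 / sqrt (real N * Im z)) \<le> 1 / 1024"
  defines "\<kappa> \<equiv> \<bar>\<bar>Re z\<bar> - 2\<bar>" and "\<psi> \<equiv> 1 / sqrt (real N * Im z)"
  assumes range: "sqrt (\<kappa> + Im z + 1) \<le> B"
  shows "cmod (res_trace {..<N} (\<lambda>i j. A i j + \<mu>) z / of_nat N - m_sc z)
     \<le> 2000 * B * (\<psi> / sqrt (\<kappa> + Im z + \<psi>))"
proof -
  let ?T = "res_trace {..<N} (\<lambda>i j. A i j + \<mu>) z"
  define L where "L = 4 * N ^ 4"
  define zz where "zz j = z + of_real (real j / real N ^ 4) * \<i>" for j
  define s where "s j = res_trace {..<N} A (zz j) / of_nat N" for j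
  define m where "m j = m_sc (zz j)" for j
  (* The error level of self_consistent_equation; it increases as the imaginary part decreases. *)
  define q where "q j = 28 * B * (1 / sqrt (real N * Im (zz j)))" for j
  define d where "d = 2 / real N ^ 2"
  let ?\<alpha> = "\<lambda>j. cmod (zz j + 2 * m j)"
  have N0: "real N > 0" "real N \<ge> 3" using N by auto
  have Imz: "Im z > 0" using zero_less_mult_pos[of "real N" "Im z"] scale N0 by linarith
  have Re: "Re (zz j) = Re z" for j by (simp add: zz_def)
  have Im: "Im (zz j) = Im z + real j / real N ^ 4" for j by (simp add: zz_def)
  have Im_ge: "Im (zz j) \<ge> Im z" "Im (zz j) > 0" for j using Imz N0 by (auto simp: Im add_pos_nonneg)
  have Im_le: "Im (zz j) \<le> H" if "j \<le> L" for j
  proof -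
    have "real j \<le> real (4 * N ^ 4)" using that unfolding L_def by (simp only: of_nat_le_iff)
    hence "real j \<le> 4 * real N ^ 4" by simp
    hence "real j / real N ^ 4 \<le> 4" using N0 by (simp add: divide_le_eq)
    thus ?thesis using H(1) Im by simp
  qed
  have Im_Suc: "Im (zz (Suc j)) = Im (zz j) + 1 / real N ^ 4" for j by (simp add: Im add_divide_distrib)
  have Im_inv: "1 / Im (zz j) \<le> real N" for j
  proof -
    have "real N * Im z \<le> real N * Im (zz j)" using Im_ge(1)[of j] N0 by (intro mult_left_mono) auto
    thus ?thesis using scale Im_ge(2)[of j] by (simp add: divide_le_eq)
  qed
  have scale': "real N * Im (zz j) \<ge> 1" for j
    using Im_inv[of j] Im_ge(2)[of j] by (simp add: divide_le_eq)
  have q_pos: "q j > 0" for j using B scale'[of j] by (simp add: q_def)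
  have q_anti: "q i \<le> q j" if "j \<le> i" for i j
  proof -
    have "Im (zz j) \<le> Im (zz i)" using that N0 by (simp add: Im divide_right_mono)
    hence "sqrt (real N * Im (zz j)) \<le> sqrt (real N * Im (zz i))" using N0 by simp
    thus ?thesis unfolding q_def using B scale'[of j] by (intro mult_left_mono frac_le) auto
  qed
  have z0: "zz 0 = z" by (simp add: zz_def)
  (* 8 sqrt q must stay below 1/4, which is the entrance condition of continuity_induction. *)
  have q0: "q 0 \<le> 1 / 1024" using small by (simp add: q_def z0)
  have q_small: "q j \<le> 1 / 1024" for j using q_anti[of 0 j] q0 by simp
  have psi_ge: "1 / sqrt (real N * H) \<le> 1 / sqrt (real N * Im (zz j))" if "j \<le> L" for j
  proof -
    have "real N * Im (zz j) \<le> real N * H" using Im_le[OF that] N0 by (intro mult_left_mono) auto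
    thus ?thesis using scale'[of j] by (intro frac_le) auto
  qed
  have result: "if (?\<alpha> 0)\<^sup>2 \<le> 16 * q 0 then cmod (s 0 - m 0) \<le> 8 * sqrt (q 0) else cmod (s 0 - m 0) \<le> 2 * q 0 / ?\<alpha> 0"
  proof (rule continuity_induction[where L = L and d = d])
    fix j assume j: "j \<le> L"
    note sc = semicircle_stieltjes[OF Im_ge(2)[of j], folded m_def]
    show "(m j)\<^sup>2 + zz j * m j + 1 = 0" by (rule sc(1))
    show "q j > 0" by (rule q_pos)
    show "8 * sqrt (q j) \<le> 1 / 4"
    proof -
      have "sqrt (q j) \<le> 1 / 32" using q_small[of j] by (intro real_le_lsqrt) (auto simp: power2_eq_square)
      thus ?thesis by simp
    qed
    (* Because of H \<le> N^7 the error q is at least 28 / N^4, the square of more than twice the step 2 / N^2. *)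
    show "d \<le> sqrt (q j)"
    proof (rule real_le_rsqrt)
      have "sqrt (real N * Im (zz j)) \<le> sqrt (real N * real N ^ 7)"
        using Im_le[OF j] H(2) N0 by simp
      also have "real N * real N ^ 7 = (real N ^ 4)\<^sup>2" by (simp add: power_mult[symmetric] power_Suc[symmetric] del: power_Suc)
      also have "sqrt ((real N ^ 4)\<^sup>2) = real N ^ 4" by (subst real_sqrt_abs) simp
      finally have "1 / real N ^ 4 \<le> 1 / sqrt (real N * Im (zz j))"
        using scale'[of j] N0 by (intro divide_left_mono) auto
      hence "28 * 1 * (1 / real N ^ 4) \<le> q j" unfolding q_def using B by (intro mult_mono) auto
      moreover have "d\<^sup>2 = 4 / real N ^ 4" by (simp add: d_def power_divide power_mult[symmetric])
      moreover have "4 / real N ^ 4 \<le> 28 * 1 * (1 / real N ^ 4)" by (simp add: divide_right_mono)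
      ultimately show "d\<^sup>2 \<le> q j" by linarith
    qed
    assume close: "cmod (s j - m j) \<le> 1 / 2"
    have "cmod ((s j)\<^sup>2 + zz j * s j + 1) \<le> 28 * B * (1 / sqrt (real N * Im (zz j)))"
    proof (rule self_consistent_equation[where I = "{..<N}" and A = A and m = "m j" and v = v and z = "zz j",
          unfolded card_lessThan of_real_of_nat_eq, folded s_def])
      show "cmod (s j - m j) \<le> 1 / 2" by (rule close)
      show "{..<N} \<noteq> {}" using N by (metis lessThan_iff empty_iff less_le_trans zero_less_numeral)
      show "\<bar>A i i\<bar> \<le> B * (1 / sqrt (real N * Im (zz j)))" if "i \<in> {..<N}" for i
        using diag[of i] that mult_left_mono[OF psi_ge[OF j], of B] B by simp
      show "\<bar>v * real N - 1\<bar> \<le> B * (1 / sqrt (real N * Im (zz j)))"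
        using var mult_left_mono[OF psi_ge[OF j], of B] B by simp
      show "cmod (fluctuation {..<N} A v (zz j) i) \<le> B / real N * frobenius ({..<N} - {i}) A (zz j)"
        if "i \<in> {..<N}" for i using fluct[of i j] that j by (simp add: zz_def L_def)
      show "28 * B * (1 / sqrt (real N * Im (zz j))) \<le> 1" using q_small[of j] by (simp add: q_def)
    qed (use sym sc Im_ge scale'[of j] B in auto)
    thus "cmod ((s j)\<^sup>2 + zz j * s j + 1) \<le> q j" by (simp add: q_def)
  next
    fix j assume j: "j < L"
    show "q (Suc j) \<le> q j" by (rule q_anti) simp
    have cm: "cmod (zz j + of_real c) \<le> cmod (zz (Suc j) + of_real c)" for c
      unfolding cmod_def using Im_ge(2)[of j] N0
      by (intro real_sqrt_le_mono add_left_mono) (simp add: Re Im_Suc power_mono)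
    have "(?\<alpha> j)\<^sup>2 \<le> (?\<alpha> (Suc j))\<^sup>2"
      unfolding m_def discriminant_semicircle[OF Im_ge(2)]
      using cm[of "-2"] cm[of 2] by (intro mult_mono) auto
    thus "?\<alpha> j \<le> ?\<alpha> (Suc j)" by (rule power2_le_imp_le) simp
    note Im2 = Im_ge(2)[of j] Im_ge(2)[of "Suc j"]
    have diff: "cmod (zz j - zz (Suc j)) = 1 / real N ^ 4"
    proof -
      have "zz j - zz (Suc j) = - (of_real (1 / real N ^ 4) * \<i>)"
        by (simp add: zz_def algebra_simps add_divide_distrib)
      thus ?thesis by (simp only: norm_minus_cancel norm_mult norm_of_real norm_ii) simp
    qed
    have inv2: "1 / (Im (zz j) * Im (zz (Suc j))) \<le> real N * real N"
      using mult_mono[OF Im_inv[of j] Im_inv[of "Suc j"]] Im_ge(2)[of "Suc j"] N0 by simp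
    have "cmod (res_trace {..<N} A (zz j) - res_trace {..<N} A (zz (Suc j)))
        \<le> real N * (1 / real N ^ 4 * (1 / (Im (zz j) * Im (zz (Suc j)))))"
      using res_trace_Lipschitz[OF finite_lessThan sym Im2] by (simp add: diff)
    also have "\<dots> \<le> real N * (1 / real N ^ 4 * (real N * real N))"
      using inv2 N0 by (intro mult_left_mono) auto
    also have "\<dots> = real N * (1 / real N ^ 2)" using N0 by (simp add: power_numeral_reduce)
    finally have S: "cmod (s j - s (Suc j)) \<le> 1 / real N ^ 2"
      using N0 by (simp add: s_def diff_divide_distrib[symmetric] norm_divide divide_le_eq)
    have "cmod (m j - m (Suc j)) \<le> 1 / real N ^ 4 * (1 / Im (zz j))"
      using semicircle_stieltjes_Lipschitz[OF Im2] by (simp add: m_def diff)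
    also have "\<dots> \<le> 1 / real N ^ 4 * (real N * real N)"
    proof (intro mult_left_mono)
      have "real N * 1 \<le> real N * real N" using N0 by (intro mult_left_mono) auto
      thus "1 / Im (zz j) \<le> real N * real N" using Im_inv[of j] by linarith
    qed auto
    also have "\<dots> = 1 / real N ^ 2" using N0 by (simp add: power_numeral_reduce)
    finally have M: "cmod (m j - m (Suc j)) \<le> 1 / real N ^ 2" .
    have "cmod (s j - m j) = cmod ((s (Suc j) - m (Suc j)) + (s j - s (Suc j)) - (m j - m (Suc j)))" by simp
    hence "cmod (s j - m j) \<le> cmod (s (Suc j) - m (Suc j)) + cmod (s j - s (Suc j)) + cmod (m j - m (Suc j))"
      using norm_triangle_ineq[of "s (Suc j) - m (Suc j)" "s j - s (Suc j)"]
        norm_triangle_ineq4[of "(s (Suc j) - m (Suc j)) + (s j - s (Suc j))" "m j - m (Suc j)"] by linarith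
    thus "cmod (s j - m j) \<le> cmod (s (Suc j) - m (Suc j)) + d"
      using S M by (simp add: d_def)
  next
    have "(3::real)\<^sup>2 \<le> real N ^ 2" using N0 by (intro power_mono) auto
    thus "d \<le> 1 / 4" using N0 by (simp add: d_def divide_le_eq)
  next
    have ImL: "Im (zz L) \<ge> 4" using Imz N0 by (simp add: Im L_def)
    have "cmod (s L) \<le> 1 / Im (zz L)"
      using res_trace_bound[OF finite_lessThan sym Im_ge(2)[of L]] N0 Im_ge(2)[of L]
      by (simp add: s_def norm_divide field_simps)
    moreover have "cmod (m L) \<le> 1 / Im (zz L)"
      unfolding m_def by (rule semicircle_stieltjes_bound[OF Im_ge(2)])
    moreover have "1 / Im (zz L) \<le> 1 / 4" using ImL by (intro divide_left_mono) auto
    ultimately show half: "cmod (s L - m L) \<le> 1 / 2"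
      using norm_triangle_ineq4[of "s L" "m L"] by linarith
    have "4 \<le> cmod (zz L - 2)" "4 \<le> cmod (zz L + 2)"
      using abs_Im_le_cmod[of "zz L - 2"] abs_Im_le_cmod[of "zz L + 2"] ImL by auto
    hence "4 * 4 \<le> (?\<alpha> L)\<^sup>2" unfolding m_def discriminant_semicircle[OF Im_ge(2)] by (intro mult_mono) auto
    hence "4\<^sup>2 \<le> (?\<alpha> L)\<^sup>2" by simp
    hence "4 \<le> ?\<alpha> L" by (rule power2_le_imp_le) simp
    thus "cmod (s L - m L) \<le> ?\<alpha> L / 2" using half by linarith
  qed simp
  define Q where "Q = 28 * B * \<psi>"
  have Q: "q 0 = Q" by (simp add: q_def Q_def \<psi>_def z0)
  define X where "X = \<kappa> + Im z + \<psi>"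
  have psi0: "\<psi> > 0" using scale by (simp add: \<psi>_def)
  have psi1: "\<psi> \<le> 1" using scale by (simp add: \<psi>_def)
  have kap: "\<kappa> \<ge> 0" by (simp add: \<kappa>_def)
  have X0: "X > 0" using psi0 kap Imz by (simp add: X_def)
  have Qpos: "Q > 0" using B psi0 by (simp add: Q_def)
  have psiQ: "\<psi> \<le> Q" using B psi0 by (simp add: Q_def)
  have \<alpha>2: "\<kappa> + Im z \<le> (?\<alpha> 0)\<^sup>2"
    unfolding m_def discriminant_semicircle[OF Im_ge(2)] unfolding z0 \<kappa>_def by (rule edge_distance_le[OF Imz])
  have main: "cmod (s 0 - m 0) \<le> 1120 * B * (\<psi> / sqrt X)"
  proof (cases "(?\<alpha> 0)\<^sup>2 \<le> 16 * q 0")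
    case True
    have "X \<le> 17 * Q" using True \<alpha>2 psiQ by (simp add: X_def Q)
    also have "\<dots> \<le> 25 * Q" using Qpos by simp
    finally have "sqrt X \<le> sqrt (25 * Q)" by simp
    hence "sqrt X \<le> 5 * sqrt Q" by (simp add: real_sqrt_mult)
    hence "sqrt Q * sqrt X \<le> sqrt Q * (5 * sqrt Q)" using Qpos by (intro mult_left_mono) auto
    also have "\<dots> = 5 * Q" using Qpos by simp
    finally have "sqrt Q \<le> 5 * Q / sqrt X" using X0 by (simp add: field_simps)
    hence "8 * sqrt Q \<le> 40 * Q / sqrt X" by simp
    thus ?thesis using result True by (simp add: Q Q_def)
  next
    case False
    have "X \<le> (?\<alpha> 0)\<^sup>2 + Q" using \<alpha>2 psiQ by (simp add: X_def)
    also have "\<dots> \<le> 4 * (?\<alpha> 0)\<^sup>2" using False Qpos by (simp add: Q)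
    finally have "X \<le> (2 * ?\<alpha> 0)\<^sup>2" by (simp only: power_mult_distrib) simp
    hence a: "sqrt X \<le> 2 * ?\<alpha> 0" by (intro real_le_lsqrt) auto
    have "?\<alpha> 0 > 0" using a X0 real_sqrt_gt_zero[OF X0] by linarith
    have "cmod (s 0 - m 0) \<le> 2 * Q / ?\<alpha> 0" using result False by (simp add: Q)
    also have "\<dots> \<le> 2 * Q / (sqrt X / 2)"
      using a X0 Qpos \<open>?\<alpha> 0 > 0\<close> by (intro divide_left_mono mult_pos_pos) auto
    also have "\<dots> = 112 * (B * (\<psi> / sqrt X))" by (simp add: Q_def)
    also have "\<dots> \<le> 1120 * (B * (\<psi> / sqrt X))" using B psi0 X0 by (intro mult_right_mono) auto
    finally show ?thesis by (simp add: mult.assoc)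
  qed
  have rank: "cmod (?T / of_nat N - s 0) \<le> B * (\<psi> / sqrt X)"
  proof -
    have "cmod (?T - res_trace {..<N} A z) \<le> 1 / Im z"
      using res_trace_rank_one[OF finite_lessThan sym Imz, of \<mu> "\<lambda>_. 1"] by simp
    hence "cmod (?T - res_trace {..<N} A z) / real N \<le> (1 / Im z) / real N"
      by (intro divide_right_mono) auto
    moreover have "(1 / Im z) / real N = \<psi>\<^sup>2"
      using scale by (simp add: \<psi>_def power_divide mult.commute)
    moreover have "cmod (?T / of_nat N - s 0)
       = cmod (?T - res_trace {..<N} A z) / real N"
      by (simp add: s_def z0 diff_divide_distrib[symmetric] norm_divide)
    ultimately have "cmod (?T / of_nat N - s 0) \<le> \<psi>\<^sup>2" by simp
    also have "\<dots> \<le> \<psi>" using psi0 psi1 by (simp add: power2_eq_square mult_left_le)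
    also have "\<dots> \<le> B * (\<psi> / sqrt X)"
    proof -
      have "sqrt X \<le> sqrt (\<kappa> + Im z + 1)" using psi1 by (simp add: X_def)
      hence "sqrt X \<le> B" using range by linarith
      hence "\<psi> * sqrt X \<le> \<psi> * B" using psi0 by (intro mult_left_mono) auto
      thus ?thesis using X0 by (simp add: field_simps)
    qed
    finally show ?thesis .
  qed
  have "cmod (?T / of_nat N - m 0)
     \<le> cmod (?T / of_nat N - s 0) + cmod (s 0 - m 0)"
    using norm_triangle_ineq[of "?T / of_nat N - s 0" "s 0 - m 0"] by simp
  also have "\<dots> \<le> B * (\<psi> / sqrt X) + 1120 * B * (\<psi> / sqrt X)"
    by (rule add_mono[OF rank main])
  also have "\<dots> = 1121 * (B * (\<psi> / sqrt X))" by simp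
  also have "\<dots> \<le> 2000 * (B * (\<psi> / sqrt X))" using B psi0 X0 by (intro mult_right_mono) auto
  finally show ?thesis by (simp add: m_def z0 X_def mult.assoc)
qed

section \<open>Self-normalized tail bounds for biased spins\<close>

abbreviation spins :: "'j set \<Rightarrow> ('j \<Rightarrow> real) set" where
  "spins J \<equiv> J \<rightarrow>\<^sub>E {-1, 1}"

text \<open>The weight of a configuration under the product law of spins in \<open>{-1, 1}\<close> with mean \<open>t\<close>; \<open>bexp\<close> and \<open>bprob\<close>
  are the corresponding expectation and probability.\<close>

definition bias_weight :: "real \<Rightarrow> 'j set \<Rightarrow> ('j \<Rightarrow> real) \<Rightarrow> real" where
  "bias_weight t J y = (\<Prod>j\<in>J. (1 + t * y j) / 2)"

definition bexp :: "real \<Rightarrow> 'j set \<Rightarrow> (('j \<Rightarrow> real) \<Rightarrow> real) \<Rightarrow> real" where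
  "bexp t J f = (\<Sum>y \<in> J \<rightarrow>\<^sub>E {-1, 1}. bias_weight t J y * f y)"

definition bprob :: "real \<Rightarrow> 'j set \<Rightarrow> (('j \<Rightarrow> real) \<Rightarrow> bool) \<Rightarrow> real" where
  "bprob t J Q = bexp t J (\<lambda>y. of_bool (Q y))"

lemma sum_spins_insert:
  fixes f :: "('j \<Rightarrow> real) \<Rightarrow> 'b::comm_monoid_add"
  assumes "j \<notin> J"
  shows "(\<Sum>y \<in> insert j J \<rightarrow>\<^sub>E {-1, 1}. f y) = (\<Sum>y \<in> J \<rightarrow>\<^sub>E {-1, 1}. f (y(j := -1)) + f (y(j := 1)))"
proof -
  have inj: "inj_on (\<lambda>(x, g). g(j := x)) ({-1, 1::real} \<times> (J \<rightarrow>\<^sub>E {-1, 1}))"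
    by (rule inj_combinator[OF assms])
  have "(\<Sum>y \<in> insert j J \<rightarrow>\<^sub>E {-1, 1}. f y) = (\<Sum>(x, g) \<in> {-1, 1::real} \<times> (J \<rightarrow>\<^sub>E {-1, 1}). f (g(j := x)))"
    unfolding PiE_insert_eq by (subst sum.reindex[OF inj]) (simp add: case_prod_beta comp_def)
  also have "\<dots> = (\<Sum>x\<in>{-1, 1::real}. \<Sum>g \<in> J \<rightarrow>\<^sub>E {-1, 1}. f (g(j := x)))"
    by (rule sum.cartesian_product[symmetric])
  also have "\<dots> = (\<Sum>g \<in> J \<rightarrow>\<^sub>E {-1, 1}. f (g(j := -1)) + f (g(j := 1)))"
    by (simp add: sum.distrib)
  finally show ?thesis .
qed

lemma bias_weight_nonneg:
  assumes "\<bar>t\<bar> \<le> 1" "y \<in> J \<rightarrow>\<^sub>E {-1, 1}"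
  shows "bias_weight t J y \<ge> 0"
  unfolding bias_weight_def
proof (rule prod_nonneg)
  fix j assume "j \<in> J"
  hence "y j = -1 \<or> y j = 1" using assms(2) by (auto simp: PiE_iff)
  thus "0 \<le> (1 + t * y j) / 2" using assms(1) by auto
qed

lemma bias_weight_insert:
  assumes "finite J" "j \<notin> J"
  shows "bias_weight t (insert j J) (y(j := b)) = (1 + t * b) / 2 * bias_weight t J y"
proof -
  have "(\<Prod>i\<in>J. (1 + t * (y(j := b)) i) / 2) = (\<Prod>i\<in>J. (1 + t * y i) / 2)"
    using assms by (intro prod.cong) auto
  thus ?thesis using assms by (simp add: bias_weight_def)
qed

text \<open>Resampling one spin leaves the expectation unchanged. This is the only form of independence that is used
  below.\<close>

lemma bexp_average:
  assumes "finite J" "j \<in> J"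
  shows "bexp t J f = bexp t J (\<lambda>y. (1 - t) / 2 * f (y(j := -1)) + (1 + t) / 2 * f (y(j := 1)))"
proof -
  define J' where "J' = J - {j}"
  have J: "J = insert j J'" "j \<notin> J'" "finite J'" using assms by (auto simp: J'_def)
  show ?thesis
    unfolding bexp_def J(1) sum_spins_insert[OF J(2)] bias_weight_insert[OF J(3,2)]
    by (intro sum.cong refl) (simp add: field_simps)
qed

lemma bexp_const: "finite J \<Longrightarrow> bexp t J (\<lambda>_. c) = c"
proof (induction J rule: finite_induct)
  case empty
  then show ?case by (simp add: bexp_def bias_weight_def)
next
  case (insert j J)
  have "bexp t (insert j J) (\<lambda>_. c) = bexp t J (\<lambda>_. c)"
    unfolding bexp_def sum_spins_insert[OF insert.hyps(2)] bias_weight_insert[OF insert.hyps]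
    by (intro sum.cong refl) (simp add: field_simps)
  then show ?case using insert.IH by simp
qed

lemma bexp_mono:
  assumes "\<bar>t\<bar> \<le> 1" "\<And>y. y \<in> J \<rightarrow>\<^sub>E {-1, 1} \<Longrightarrow> f y \<le> g y"
  shows "bexp t J f \<le> bexp t J g"
  unfolding bexp_def using assms bias_weight_nonneg[OF assms(1)]
  by (intro sum_mono mult_left_mono) auto

lemma bexp_sum: "bexp t J (\<lambda>y. \<Sum>k\<in>K. f k y) = (\<Sum>k\<in>K. bexp t J (f k))"
  unfolding bexp_def sum_distrib_left by (rule sum.swap)

lemma bexp_cmult: "bexp t J (\<lambda>y. c * f y) = c * bexp t J f"
  unfolding bexp_def by (simp add: sum_distrib_left mult_ac)

lemma bexp_add: "bexp t J (\<lambda>y. f y + g y) = bexp t J f + bexp t J g"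
  unfolding bexp_def by (simp add: sum.distrib distrib_left)

lemma bprob_mono:
  assumes "\<bar>t\<bar> \<le> 1" "\<And>y. y \<in> J \<rightarrow>\<^sub>E {-1, 1} \<Longrightarrow> Q y \<Longrightarrow> R y"
  shows "bprob t J Q \<le> bprob t J R"
  unfolding bprob_def using assms by (intro bexp_mono) auto

lemma bprob_le_1: "finite J \<Longrightarrow> \<bar>t\<bar> \<le> 1 \<Longrightarrow> bprob t J Q \<le> 1"
  using bexp_mono[of t J "\<lambda>y. of_bool (Q y)" "\<lambda>_. 1"] bexp_const[of J t 1] by (simp add: bprob_def)

lemma bprob_disj:
  assumes "\<bar>t\<bar> \<le> 1"
  shows "bprob t J (\<lambda>y. Q y \<or> R y) \<le> bprob t J Q + bprob t J R"
  unfolding bprob_def bexp_add[symmetric] by (intro bexp_mono assms) auto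

lemma bprob_UN:
  assumes "\<bar>t\<bar> \<le> 1" "finite K" "\<And>k. k \<in> K \<Longrightarrow> bprob t J (Q k) \<le> p"
  shows "bprob t J (\<lambda>y. \<exists>k\<in>K. Q k y) \<le> real (card K) * p"
proof -
  have "bprob t J (\<lambda>y. \<exists>k\<in>K. Q k y) \<le> bexp t J (\<lambda>y. \<Sum>k\<in>K. of_bool (Q k y))"
    unfolding bprob_def
  proof (rule bexp_mono[OF assms(1)])
    fix y
    show "of_bool (\<exists>k\<in>K. Q k y) \<le> (\<Sum>k\<in>K. of_bool (Q k y) :: real)"
    proof (cases "\<exists>k\<in>K. Q k y")
      case True
      then obtain k where k: "k \<in> K" "Q k y" by blast
      have "(of_bool (Q k y) :: real) \<le> (\<Sum>k\<in>K. of_bool (Q k y))"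
        using k(1) assms(2) by (intro member_le_sum) auto
      then show ?thesis using k by auto
    qed (auto intro: sum_nonneg)
  qed
  also have "\<dots> = (\<Sum>k\<in>K. bprob t J (Q k))" by (simp add: bexp_sum bprob_def)
  also have "\<dots> \<le> card K * p" using sum_bounded_above[of K "\<lambda>k. bprob t J (Q k)" p] assms(3) by simp
  finally show ?thesis .
qed

text \<open>Hoeffding's lemma for a spin with mean \<open>t\<close>.\<close>

lemma Hoeffding_two_point:
  fixes t l :: real
  assumes "\<bar>t\<bar> \<le> 1"
  shows "(1 - t) / 2 * exp (l * (-1 - t)) + (1 + t) / 2 * exp (l * (1 - t)) \<le> exp (l\<^sup>2 / 2)"
proof -
  have pos: "(1 - t) / 2 * exp (l * (-1 - t)) + (1 + t) / 2 * exp (l * (1 - t)) \<le> exp (l\<^sup>2 / 2)"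
    if l: "l \<ge> 0" and t: "\<bar>t\<bar> \<le> 1" for l t :: real
  proof -
    define p where "p = (1 + t) / 2"
    have p: "0 \<le> p" "p \<le> 1" "t = 2 * p - 1" using t by (auto simp: p_def field_simps)
    have "p * (exp (2 * l) - 1) \<ge> 0" using l p by simp
    hence a: "1 + p * (exp (2 * l) - 1) > 0" by linarith
    have "- (2 * l) * p + ln (1 + p * (exp (2 * l) - 1)) \<le> (2 * l)\<^sup>2 / 8"
      by (rule Hoeffdings_lemma_aux) (use l p in auto)
    hence "exp (- (2 * l) * p + ln (1 + p * (exp (2 * l) - 1))) \<le> exp (l\<^sup>2 / 2)"
      by (simp add: power2_eq_square)
    also have "exp (- (2 * l) * p + ln (1 + p * (exp (2 * l) - 1)))
        = exp (- (2 * l) * p) * (1 + p * (exp (2 * l) - 1))"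
      using a by (simp only: exp_add exp_ln)
    also have "\<dots> = (1 - p) * exp (- (2 * l) * p) + p * (exp (- (2 * l) * p) * exp (2 * l))"
      by (simp add: algebra_simps)
    also have "\<dots> = (1 - t) / 2 * exp (l * (-1 - t)) + (1 + t) / 2 * exp (l * (1 - t))"
      unfolding exp_add[symmetric] p(3) by (simp add: field_simps)
    finally show ?thesis .
  qed
  show ?thesis
  proof (cases "l \<ge> 0")
    case True then show ?thesis using pos assms by blast
  next
    case False
    have "(1 - (- t)) / 2 * exp ((- l) * (-1 - (- t))) + (1 + (- t)) / 2 * exp ((- l) * (1 - (- t))) \<le> exp ((- l)\<^sup>2 / 2)"
      by (rule pos) (use False assms in auto)
    then show ?thesis by (simp add: algebra_simps)
  qed
qed

text \<open>Independence of the spins in \<open>R\<close>, expressed pointwise.\<close>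

definition ignores :: "'j set \<Rightarrow> (('j \<Rightarrow> real) \<Rightarrow> 'b) \<Rightarrow> bool" where
  "ignores R f \<longleftrightarrow> (\<forall>y j b. j \<in> R \<longrightarrow> f (y(j := b)) = f y)"

lemma ignoresD: "ignores R f \<Longrightarrow> j \<in> R \<Longrightarrow> f (y(j := b)) = f y"
  by (simp add: ignores_def)

lemma ignores_subset: "ignores R f \<Longrightarrow> R' \<subseteq> R \<Longrightarrow> ignores R' f"
  by (auto simp: ignores_def)

text \<open>The coefficient \<open>L k\<close> may depend on the earlier spins \<open>r 0, \<dots>, r (k - 1)\<close> and on all spins outside the
  family, but not on later ones. Averaging over the last spin removes the last summand by Hoeffding's lemma.\<close>

lemma exponential_supermartingale:
  fixes L :: "nat \<Rightarrow> ('j \<Rightarrow> real) \<Rightarrow> real"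
  assumes "finite J" "\<bar>t\<bar> \<le> 1" "inj_on r {..<n}" "r ` {..<n} \<subseteq> J"
    and "\<And>k. k < n \<Longrightarrow> ignores (r ` {k..<n}) (L k)"
  shows "bexp t J (\<lambda>y. exp (\<Sum>k<n. (y (r k) - t) * L k y - (L k y)\<^sup>2 / 2)) \<le> 1"
  using assms(3-5)
proof (induction n)
  case 0
  then show ?case using bexp_const[OF assms(1), of t 1] by simp
next
  case (Suc n)
  let ?S = "\<lambda>m y. \<Sum>k<m. (y (r k) - t) * L k y - (L k y)\<^sup>2 / 2"
  let ?A = "\<lambda>y. (1 - t) / 2 * exp (?S (Suc n) (y(r n := -1))) + (1 + t) / 2 * exp (?S (Suc n) (y(r n := 1)))"
  have rn: "r n \<in> J" using Suc.prems by auto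
  have Ln: "L k (y(r n := b)) = L k y" if "k \<le> n" for k y b
    using Suc.prems(3)[of k] that by (intro ignoresD) auto
  have S: "?S n (y(r n := b)) = ?S n y" for y b
  proof (rule sum.cong[OF refl])
    fix k assume k: "k \<in> {..<n}"
    hence "r k \<noteq> r n" using Suc.prems(1) by (auto simp: inj_on_def)
    thus "((y(r n := b)) (r k) - t) * L k (y(r n := b)) - (L k (y(r n := b)))\<^sup>2 / 2
      = (y (r k) - t) * L k y - (L k y)\<^sup>2 / 2" using k Ln[of k] by simp
  qed
  have "bexp t J (\<lambda>y. exp (?S (Suc n) y))
    = bexp t J ?A"
    by (rule bexp_average[OF assms(1) rn])
  also have "\<dots> \<le> bexp t J (\<lambda>y. exp (?S n y))"
  proof (rule bexp_mono[OF assms(2)])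
    fix y
    have e: "exp (?S (Suc n) (y(r n := b))) = exp (?S n y) * exp (- ((L n y)\<^sup>2 / 2)) * exp (L n y * (b - t))" for b
      using Ln[of n y b] by (simp only: sum.lessThan_Suc S exp_add[symmetric]) (simp add: algebra_simps)
    have "?A y
      = exp (?S n y) * exp (- ((L n y)\<^sup>2 / 2)) * ((1 - t) / 2 * exp (L n y * (-1 - t)) + (1 + t) / 2 * exp (L n y * (1 - t)))"
      unfolding e by (simp only: distrib_left mult_ac)
    also have "\<dots> \<le> exp (?S n y) * exp (- ((L n y)\<^sup>2 / 2)) * exp ((L n y)\<^sup>2 / 2)"
      by (intro mult_left_mono Hoeffding_two_point assms(2)) auto
    also have "\<dots> = exp (?S n y)" by (simp add: exp_minus)
    finally show "?A y \<le> exp (?S n y)" .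
  qed
  also have "\<dots> \<le> 1"
  proof (rule Suc.IH)
    show "inj_on r {..<n}" using Suc.prems(1) by (rule inj_on_subset) auto
    show "r ` {..<n} \<subseteq> J" using Suc.prems(2) by auto
    show "ignores (r ` {k..<n}) (L k)" if "k < n" for k
      using Suc.prems(3)[of k] that by (auto intro: ignores_subset)
  qed
  finally show ?case .
qed

text \<open>Markov's inequality for the supermartingale with coefficients \<open>K L / V\<close>. Keeping the variance bound inside
  the event replaces a truncation of \<open>L\<close>.\<close>

lemma self_normalized_tail:
  fixes L :: "nat \<Rightarrow> ('j \<Rightarrow> real) \<Rightarrow> real"
  assumes "finite J" "\<bar>t\<bar> \<le> 1" "inj_on r {..<n}" "r ` {..<n} \<subseteq> J"
    and "\<And>k. k < n \<Longrightarrow> ignores (r ` {k..<n}) (L k)"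
    and V: "ignores (r ` {..<n}) V" "\<And>y. V y \<ge> 0" and K: "K \<ge> 0"
  shows "bprob t J (\<lambda>y. (\<Sum>k<n. (y (r k) - t) * L k y) > K * V y \<and> (\<Sum>k<n. (L k y)\<^sup>2) \<le> (V y)\<^sup>2)
       \<le> exp (- (K\<^sup>2 / 2))"
proof -
  let ?E = "\<lambda>y. (\<Sum>k<n. (y (r k) - t) * L k y) > K * V y \<and> (\<Sum>k<n. (L k y)\<^sup>2) \<le> (V y)\<^sup>2"
  let ?R = "\<lambda>y. \<Sum>k<n. (y (r k) - t) * (K * L k y / V y) - (K * L k y / V y)\<^sup>2 / 2"
  let ?M = "\<lambda>k y. K * L k y / V y"
  have "bprob t J ?E
    \<le> bexp t J (\<lambda>y. exp (- (K\<^sup>2 / 2)) * exp (?R y))"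
    unfolding bprob_def
  proof (rule bexp_mono[OF assms(2)])
    fix y
    show "of_bool (?E y)
       \<le> exp (- (K\<^sup>2 / 2)) * exp (?R y)"
    proof (cases "?E y")
      case True
      let ?X = "\<Sum>k<n. (y (r k) - t) * L k y" and ?Q = "\<Sum>k<n. (L k y)\<^sup>2"
      have "V y \<noteq> 0"
      proof
        assume "V y = 0"
        hence "?Q = 0" using True sum_nonneg[of "{..<n}" "\<lambda>k. (L k y)\<^sup>2"] by simp
        hence "L k y = 0" if "k < n" for k using that by (simp add: sum_nonneg_eq_0_iff)
        hence "?X = 0" by simp
        thus False using True \<open>V y = 0\<close> by simp
      qed
      hence Vy: "V y > 0" using V(2)[of y] by simp
      have "(?R y) = K / V y * ?X - (K / V y)\<^sup>2 / 2 * ?Q"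
        by (simp add: sum_subtractf sum_distrib_left sum_divide_distrib power_divide power_mult_distrib mult_ac)
      also have "\<dots> \<ge> K / V y * (K * V y) - (K / V y)\<^sup>2 / 2 * (V y)\<^sup>2"
        using True Vy K by (intro diff_mono mult_left_mono) auto
      also have "K / V y * (K * V y) - (K / V y)\<^sup>2 / 2 * (V y)\<^sup>2 = K\<^sup>2 / 2"
        using Vy by (simp add: power2_eq_square)
      finally have "exp (- (K\<^sup>2 / 2)) * exp (K\<^sup>2 / 2)
        \<le> exp (- (K\<^sup>2 / 2)) * exp (?R y)"
        by (intro mult_left_mono) auto
      then show ?thesis using True by (simp add: exp_minus)
    qed auto
  qed
  also have "\<dots> \<le> exp (- (K\<^sup>2 / 2)) * 1"
    unfolding bexp_cmult
  proof (intro mult_left_mono exponential_supermartingale[OF assms(1-4)])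
    fix k assume "k < n"
    hence "ignores (r ` {k..<n}) (L k)" "ignores (r ` {k..<n}) V"
      using assms(5) V(1) by (auto intro: ignores_subset)
    thus "ignores (r ` {k..<n}) (?M k)" by (simp add: ignores_def)
  qed simp
  finally show ?thesis by simp
qed

lemma self_normalized_tail_abs:
  fixes L :: "nat \<Rightarrow> ('j \<Rightarrow> real) \<Rightarrow> real"
  assumes "finite J" "\<bar>t\<bar> \<le> 1" "inj_on r {..<n}" "r ` {..<n} \<subseteq> J"
    and "\<And>k. k < n \<Longrightarrow> ignores (r ` {k..<n}) (L k)"
    and V: "ignores (r ` {..<n}) V" "\<And>y. V y \<ge> 0" and K: "K \<ge> 0"
  shows "bprob t J (\<lambda>y. \<bar>\<Sum>k<n. (y (r k) - t) * L k y\<bar> > K * V y \<and> (\<Sum>k<n. (L k y)\<^sup>2) \<le> (V y)\<^sup>2)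
       \<le> 2 * exp (- (K\<^sup>2 / 2))"
proof -
  have neg: "ignores (r ` {k..<n}) (\<lambda>y. - L k y)" if "k < n" for k
    using assms(5)[OF that] by (simp add: ignores_def)
  let ?A = "\<lambda>y. (\<Sum>k<n. (y (r k) - t) * L k y) > K * V y \<and> (\<Sum>k<n. (L k y)\<^sup>2) \<le> (V y)\<^sup>2"
  let ?B = "\<lambda>y. (\<Sum>k<n. (y (r k) - t) * - L k y) > K * V y \<and> (\<Sum>k<n. (- L k y)\<^sup>2) \<le> (V y)\<^sup>2"
  have "bprob t J (\<lambda>y. \<bar>\<Sum>k<n. (y (r k) - t) * L k y\<bar> > K * V y \<and> (\<Sum>k<n. (L k y)\<^sup>2) \<le> (V y)\<^sup>2)
     \<le> bprob t J (\<lambda>y. ?A y \<or> ?B y)"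
    by (intro bprob_mono assms(2)) (auto simp: abs_if sum_negf split: if_splits)
  also have "\<dots> \<le> bprob t J ?A + bprob t J ?B" by (rule bprob_disj[OF assms(2)])
  also have "\<dots> \<le> exp (- (K\<^sup>2 / 2)) + exp (- (K\<^sup>2 / 2))"
    by (intro add_mono self_normalized_tail assms neg)
  finally show ?thesis by simp
qed

text \<open>A quadratic form is linear in each spin with the inner sums as predictable coefficients. Outside the events that
  some inner sum exceeds \<open>K\<close> times its standard deviation, the squares of the coefficients add up to at most
  \<open>(K V)\<^sup>2\<close>, so the tail bound applies a second time.\<close>

lemma quadratic_form_tail:
  fixes b :: "nat \<Rightarrow> nat \<Rightarrow> ('j \<Rightarrow> real) \<Rightarrow> real"
  assumes "finite J" "\<bar>t\<bar> \<le> 1" "inj_on r {..<n}" "r ` {..<n} \<subseteq> J"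
    and b: "\<And>j k. ignores (r ` {..<n}) (b j k)"
    and V: "ignores (r ` {..<n}) V" "\<And>y. V y \<ge> 0" "\<And>y. (\<Sum>k<n. \<Sum>j<k. (b j k y)\<^sup>2) \<le> (V y)\<^sup>2"
    and K: "K \<ge> 0"
  shows "bprob t J (\<lambda>y. \<bar>\<Sum>k<n. (y (r k) - t) * (\<Sum>j<k. b j k y * (y (r j) - t))\<bar> > K\<^sup>2 * V y)
       \<le> 2 * (real n + 1) * exp (- (K\<^sup>2 / 2))"
proof -
  let ?Q = "\<lambda>y. \<bar>\<Sum>k<n. (y (r k) - t) * (\<Sum>j<k. b j k y * (y (r j) - t))\<bar> > K\<^sup>2 * V y"
  define L where "L k y = (\<Sum>j<k. (y (r j) - t) * b j k y)" for k and y :: "'j \<Rightarrow> real"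
  define W where "W k y = sqrt (\<Sum>j<k. (b j k y)\<^sup>2)" for k y
  let ?p = "2 * exp (- (K\<^sup>2 / 2))"
  have W2: "(W k y)\<^sup>2 = (\<Sum>j<k. (b j k y)\<^sup>2)" for k y by (simp add: W_def sum_nonneg)
  have Wsum: "(\<Sum>k<n. (W k y)\<^sup>2) \<le> (V y)\<^sup>2" for y using V(3) by (simp add: W2)
  let ?A = "\<lambda>k y. \<bar>L k y\<bar> > K * W k y"
  let ?B = "\<lambda>y. \<bar>\<Sum>k<n. (y (r k) - t) * L k y\<bar> > K * (K * V y) \<and> (\<Sum>k<n. (L k y)\<^sup>2) \<le> (K * V y)\<^sup>2"
  have A: "bprob t J (?A k) \<le> ?p" if k: "k < n" for k
  proof -
    have inj: "inj_on r {..<k}" using assms(3) by (rule inj_on_subset) (use k in auto)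
    have sub: "r ` {..<k} \<subseteq> J" using assms(4) k by force
    have ig: "ignores (r ` {..<k}) (b j k)" "ignores (r ` {i..<k}) (b j k)" for i j
      using k by (auto intro!: ignores_subset[OF b])
    have Wig: "ignores (r ` {..<k}) (W k)" using ig(1) by (simp add: ignores_def W_def)
    have Wnn: "W k y \<ge> 0" for y by (simp add: W_def sum_nonneg)
    have "bprob t J (\<lambda>y. \<bar>\<Sum>j<k. (y (r j) - t) * b j k y\<bar> > K * W k y \<and> (\<Sum>j<k. (b j k y)\<^sup>2) \<le> (W k y)\<^sup>2) \<le> ?p"
      by (rule self_normalized_tail_abs[OF assms(1,2) inj sub ig(2) Wig Wnn K])
    thus ?thesis by (simp add: W2 L_def)
  qed
  have B: "bprob t J ?B \<le> ?p"
  proof (rule self_normalized_tail_abs[OF assms(1-4)])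
    show "ignores (r ` {k..<n}) (L k)" if "k < n" for k
      unfolding ignores_def
    proof (intro allI impI)
      fix y i c assume "i \<in> r ` {k..<n}"
      then obtain m where m: "i = r m" "k \<le> m" "m < n" by auto
      have "r j \<noteq> r m" if "j < k" for j
        using m that assms(3) by (auto dest!: inj_onD)
      moreover have "b j k (y(r m := c)) = b j k y" for j
        using ignoresD[OF b] m by auto
      ultimately show "L k (y(i := c)) = L k y" by (simp add: L_def m)
    qed
    show "ignores (r ` {..<n}) (\<lambda>y. K * V y)" using V(1) by (simp add: ignores_def)
  qed (use V(2) K in auto)
  have "bprob t J ?Q
     \<le> bprob t J (\<lambda>y. (\<exists>k\<in>{..<n}. ?A k y) \<or> ?B y)"
  proof (intro bprob_mono assms(2))
    fix y assume large: "?Q y"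
    show "(\<exists>k\<in>{..<n}. ?A k y) \<or> ?B y"
    proof (cases "\<exists>k\<in>{..<n}. ?A k y")
      case False
      hence "(L k y)\<^sup>2 \<le> K\<^sup>2 * (W k y)\<^sup>2" if "k < n" for k
        using that power_mono[of "\<bar>L k y\<bar>" "K * W k y" 2] by (auto simp: not_less power_mult_distrib)
      hence "(\<Sum>k<n. (L k y)\<^sup>2) \<le> (\<Sum>k<n. K\<^sup>2 * (W k y)\<^sup>2)" by (intro sum_mono) auto
      also have "\<dots> \<le> (K * V y)\<^sup>2"
        using Wsum[of y] by (simp add: sum_distrib_left[symmetric] power_mult_distrib mult_left_mono)
      finally have "(\<Sum>k<n. (L k y)\<^sup>2) \<le> (K * V y)\<^sup>2" .
      moreover have "\<bar>\<Sum>k<n. (y (r k) - t) * L k y\<bar> > K * (K * V y)"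
        using large by (simp add: L_def power2_eq_square mult_ac)
      ultimately show ?thesis by blast
    qed auto
  qed
  also have "\<dots> \<le> bprob t J (\<lambda>y. \<exists>k\<in>{..<n}. ?A k y) + bprob t J ?B"
    by (rule bprob_disj[OF assms(2)])
  also have "\<dots> \<le> real (card {..<n}) * ?p + ?p"
  proof (rule add_mono[OF _ B])
    show "bprob t J (\<lambda>y. \<exists>k\<in>{..<n}. ?A k y) \<le> real (card {..<n}) * ?p"
      using bprob_UN[OF assms(2), where K = "{..<n}" and Q = ?A and p = ?p] A by blast
  qed
  finally show ?thesis by (simp add: algebra_simps)
qed

section \<open>The Curie-Weiss law as a mixture of biased product laws\<close>

text \<open>Up to the factor \<open>- M\<close>, the logarithm of the mixing density of the Curie-Weiss law.\<close>

definition cw_potential :: "real \<Rightarrow> real \<Rightarrow> real" where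
  "cw_potential \<beta> x = x\<^sup>2 / (2 * \<beta>) - ln (cosh x)"

definition cw_force :: "real \<Rightarrow> real \<Rightarrow> real" where
  "cw_force \<beta> x = x / \<beta> - tanh x"

lemma cw_potential_deriv:
  "(cw_potential \<beta> has_real_derivative cw_force \<beta> x) (at x)"
proof -
  have "((\<lambda>x. x\<^sup>2) has_real_derivative 2 * x) (at x)"
    "((\<lambda>x. ln (cosh x)) has_real_derivative tanh x) (at x)"
    by (auto intro!: derivative_eq_intros simp: tanh_def)
  from DERIV_diff[OF DERIV_cdivide[OF this(1), of "2 * \<beta>"] this(2)]
  show ?thesis unfolding cw_potential_def[abs_def] cw_force_def by simp
qed

lemma cw_force_convex: "convex_on {0..} (cw_force \<beta>)"
proof (rule convex_on_realI)
  fix x :: real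
  show "(cw_force \<beta> has_real_derivative (1 / \<beta> - (1 - (tanh x)\<^sup>2))) (at x)"
    unfolding cw_force_def[abs_def]
    by (intro DERIV_diff DERIV_cdivide DERIV_ident) (auto intro!: derivative_eq_intros)
next
  fix x y :: real assume xy: "x \<in> {0..}" "y \<in> {0..}" "x \<le> y"
  hence "0 \<le> tanh x" "tanh x \<le> tanh y" by auto
  hence "(tanh x)\<^sup>2 \<le> (tanh y)\<^sup>2" by (intro power_mono)
  thus "1 / \<beta> - (1 - (tanh x)\<^sup>2) \<le> 1 / \<beta> - (1 - (tanh y)\<^sup>2)" by simp
qed (auto intro: convex_connected)

lemma cw_force_half_neg:
  assumes "x > 0" "cw_force \<beta> x = 0"
  shows "cw_force \<beta> (x / 2) < 0"
proof -
  define a where "a = x / 2"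
  have "tanh a > 0" using assms(1) by (simp add: a_def)
  have "tanh (a + a) = (tanh a + tanh a) / (1 + tanh a * tanh a)"
    by (rule tanh_add) auto
  also have "\<dots> < 2 * tanh a"
    using \<open>tanh a > 0\<close> by (simp add: field_simps add_pos_pos)
  finally have "tanh x < 2 * tanh (x / 2)" by (simp add: a_def)
  thus ?thesis using assms(2) by (simp add: cw_force_def field_simps)
qed

text \<open>The derivative of the potential is convex on the half line and vanishes at 0 and at \<open>x0\<close>. Its graph
  therefore lies below the chord over \<open>[x0 / 2, x0]\<close> and above the extension of that chord beyond \<open>x0\<close>; the slope is
  positive by \<open>cw_force_half_neg\<close>.\<close>

lemma cw_force_slope:
  assumes "x0 > 0" "cw_force \<beta> x0 = 0"
  defines "k \<equiv> - cw_force \<beta> (x0 / 2) / (x0 / 2)"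
  shows "k > 0"
    and "x0 / 2 \<le> x \<Longrightarrow> x \<le> x0 \<Longrightarrow> cw_force \<beta> x \<le> - k * (x0 - x)"
    and "x0 \<le> x \<Longrightarrow> cw_force \<beta> x \<ge> k * (x - x0)"
    and "0 \<le> x \<Longrightarrow> x \<le> x0 \<Longrightarrow> cw_force \<beta> x \<le> 0"
proof -
  have f0: "cw_force \<beta> 0 = 0" by (simp add: cw_force_def)
  show k: "k > 0" unfolding k_def using cw_force_half_neg[OF assms(1,2)] assms(1) by (simp add: divide_neg_pos)
  have cvx: "cw_force \<beta> ((1 - u) * a + u * b) \<le> (1 - u) * cw_force \<beta> a + u * cw_force \<beta> b"
    if "0 \<le> u" "u \<le> 1" "0 \<le> a" "0 \<le> b" for u a b
    using convex_onD[OF cw_force_convex[of \<beta>], of u a b] that by simp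
  {
    assume x: "x0 / 2 \<le> x" "x \<le> x0"
    define u where "u = (x - x0 / 2) / (x0 / 2)"
    have u: "0 \<le> u" "u \<le> 1" using x assms(1) by (auto simp: u_def field_simps)
    have "(1 - u) * (x0 / 2) + u * x0 = x0 / 2 + u * (x0 / 2)" by (simp add: field_simps)
    also have "\<dots> = x" using assms(1) by (simp add: u_def field_simps)
    finally have "(1 - u) * (x0 / 2) + u * x0 = x" .
    hence "cw_force \<beta> x \<le> (1 - u) * cw_force \<beta> (x0 / 2) + u * cw_force \<beta> x0"
      using cvx[OF u, of "x0 / 2" x0] assms(1) by simp
    also have "\<dots> = - k * (x0 - x)" using assms(1,2) by (simp add: u_def k_def field_simps)
    finally show "cw_force \<beta> x \<le> - k * (x0 - x)" .
  }
  {
    assume x: "x0 \<le> x"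
    define u where "u = (x0 / 2) / (x - x0 / 2)"
    have pos: "x - x0 / 2 > 0" using x assms(1) by linarith
    have u: "0 < u" "u \<le> 1" using x assms(1) pos by (auto simp: u_def)
    have "(1 - u) * (x0 / 2) + u * x = x0 / 2 + u * (x - x0 / 2)" by (simp add: field_simps)
    also have ux: "u * (x - x0 / 2) = x0 / 2"
      using pos nonzero_eq_divide_eq[of "x - x0 / 2" u "x0 / 2"] u_def by linarith
    also have "x0 / 2 + x0 / 2 = x0" by simp
    finally have "cw_force \<beta> x0 \<le> (1 - u) * cw_force \<beta> (x0 / 2) + u * cw_force \<beta> x"
      using cvx[of u "x0 / 2" x] u x assms(1) by simp
    hence "u * cw_force \<beta> x \<ge> (1 - u) * (k * (x0 / 2))"
      using assms(1,2) by (simp add: k_def)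
    also have "(1 - u) * (k * (x0 / 2)) = u * (k * (x - x0))"
    proof -
      have "(1 - u) * (x0 / 2) = x0 / 2 - u * (x0 / 2)" by (simp add: left_diff_distrib)
      also have "\<dots> = u * (x - x0)" using ux by (simp add: right_diff_distrib)
      finally show ?thesis by (metis mult.left_commute)
    qed
    finally show "cw_force \<beta> x \<ge> k * (x - x0)" using u(1) by simp
  }
  {
    assume x: "0 \<le> x" "x \<le> x0"
    have "cw_force \<beta> ((1 - x / x0) * 0 + x / x0 * x0) \<le> (1 - x / x0) * cw_force \<beta> 0 + x / x0 * cw_force \<beta> x0"
      by (rule cvx) (use x assms(1) in \<open>auto simp: field_simps\<close>)
    thus "cw_force \<beta> x \<le> 0" using assms(1,2) f0 by simp
  }
qed

lemma cw_force_zero_exists: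
  assumes "\<beta> > 1"
  shows "\<exists>x>0. cw_force \<beta> x = 0"
proof -
  have "((\<lambda>x. - cw_force \<beta> x) has_real_derivative (1 - 1 / \<beta>)) (at 0)"
    unfolding cw_force_def using assms by (auto intro!: derivative_eq_intros)
  moreover have "1 - 1 / \<beta> > 0" using assms by simp
  (* The force vanishes at 0 with derivative 1 / \<beta> - 1 < 0, so it is negative just to the right of 0. *)
  ultimately obtain d where d: "d > 0" "\<And>h. 0 < h \<Longrightarrow> h < d \<Longrightarrow> - cw_force \<beta> 0 < - cw_force \<beta> (0 + h)"
    using DERIV_pos_inc_right by blast
  define a where "a = min (d / 2) \<beta>"
  have a: "a > 0" "a \<le> \<beta>" "a < d" using d(1) assms by (auto simp: a_def)
  have "cw_force \<beta> a \<le> 0" using d(2)[OF a(1,3)] by (simp add: cw_force_def)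
  moreover have "0 \<le> cw_force \<beta> \<beta>" using assms tanh_real_lt_1[of \<beta>] by (simp add: cw_force_def)
  moreover have "continuous_on {a..\<beta>} (cw_force \<beta>)"
    unfolding cw_force_def[abs_def] using assms by (intro continuous_intros) auto
  ultimately obtain x where "a \<le> x" "x \<le> \<beta>" "cw_force \<beta> x = 0"
    using IVT'[of "cw_force \<beta>" a 0 \<beta>] a by blast
  thus ?thesis using a(1) by (intro exI[of _ x]) auto
qed

lemma cw_force_zero_unique:
  assumes "a > 0" "b > 0" "cw_force \<beta> a = 0" "cw_force \<beta> b = 0"
  shows "a = b"
proof -
  (* Beyond its first positive zero the force is bounded below by a line of positive slope. *)
  have False if ab: "0 < a" "a < b" "cw_force \<beta> a = 0" "cw_force \<beta> b = 0" for a b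
    using cw_force_slope(1)[of a \<beta>] cw_force_slope(3)[of a \<beta> b] ab
      mult_pos_pos[of "- cw_force \<beta> (a / 2) / (a / 2)" "b - a"] by force
  thus ?thesis using assms by (metis linorder_neqE_linordered_idom)
qed

lemma cw_magnetization:
  assumes "\<beta> > 1"
  defines "c \<equiv> cw_magnetization \<beta>"
  shows "0 < c" "c < 1" "tanh (\<beta> * c) = c"
proof -
  have iff: "tanh (\<beta> * c) = c \<longleftrightarrow> cw_force \<beta> (\<beta> * c) = 0" for c
    using assms(1) by (auto simp: cw_force_def)
  have "\<exists>!c. 0 < c \<and> c < 1 \<and> tanh (\<beta> * c) = c"
  proof (rule ex_ex1I)
    obtain x where x: "x > 0" "cw_force \<beta> x = 0" using cw_force_zero_exists[OF assms(1)] by blast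
    have "tanh x = x / \<beta>" using x(2) by (simp add: cw_force_def)
    hence "x / \<beta> < 1" using tanh_real_lt_1[of x] by linarith
    thus "\<exists>c. 0 < c \<and> c < 1 \<and> tanh (\<beta> * c) = c"
      using x(1) \<open>tanh x = x / \<beta>\<close> assms(1) by (intro exI[of _ "x / \<beta>"]) auto
  next
    fix c c' assume "0 < c \<and> c < 1 \<and> tanh (\<beta> * c) = c" "0 < c' \<and> c' < 1 \<and> tanh (\<beta> * c') = c'"
    hence "\<beta> * c > 0" "\<beta> * c' > 0" "cw_force \<beta> (\<beta> * c) = 0" "cw_force \<beta> (\<beta> * c') = 0"
      using assms(1) iff[of c] iff[of c'] by simp_all
    hence "\<beta> * c = \<beta> * c'" by (rule cw_force_zero_unique)
    thus "c = c'" using assms(1) by simp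
  qed
  from theI'[OF this] show "0 < c" "c < 1" "tanh (\<beta> * c) = c"
    unfolding c_def cw_magnetization_def by blast+
qed

lemma cw_potential_upper:
  assumes "\<beta> > 0" "cw_force \<beta> x0 = 0"
  shows "cw_potential \<beta> x - cw_potential \<beta> x0 \<le> (x - x0)\<^sup>2 / (2 * \<beta>)"
proof -
  have D: "((\<lambda>x. ln (cosh x)) has_real_derivative tanh y) (at y)" for y :: real
    by (auto intro!: derivative_eq_intros simp: tanh_def)
  have "convex_on UNIV (\<lambda>x::real. ln (cosh x))"
    by (rule convex_on_realI[where f' = tanh]) (use D in auto)
  hence "ln (cosh x) - ln (cosh x0) \<ge> tanh x0 * (x - x0)"
    by (rule convex_on_imp_above_tangent) (use D in \<open>auto intro: has_field_derivative_at_within\<close>)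
  moreover have "tanh x0 = x0 / \<beta>" using assms(2) by (simp add: cw_force_def)
  moreover have "x\<^sup>2 / (2 * \<beta>) - x0\<^sup>2 / (2 * \<beta>) = (x - x0)\<^sup>2 / (2 * \<beta>) + x0 / \<beta> * (x - x0)"
    using assms(1) by (simp add: field_simps power2_eq_square)
  ultimately show ?thesis unfolding cw_potential_def by simp
qed

text \<open>Quadratic growth away from both minima. On \<open>[0, x0 / 2]\<close> monotonicity suffices, at the price of
  a smaller constant.\<close>

lemma cw_potential_lower:
  assumes "x0 > 0" "cw_force \<beta> x0 = 0"
  shows "\<exists>k>0. \<forall>x. cw_potential \<beta> x - cw_potential \<beta> x0 \<ge> k * (\<bar>x\<bar> - x0)\<^sup>2"
proof -
  define k where "k = - cw_force \<beta> (x0 / 2) / (x0 / 2)"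
  note slope = cw_force_slope[OF assms, folded k_def]
  let ?F = "cw_potential \<beta>"
  have DG: "((\<lambda>x. ?F x - k / 2 * (x - x0)\<^sup>2) has_real_derivative (cw_force \<beta> x - k * (x - x0))) (at x)" for x
    by (auto intro!: derivative_eq_intros cw_potential_deriv)
  have right: "?F x - ?F x0 \<ge> k / 2 * (x - x0)\<^sup>2" if "x \<ge> x0" for x
  proof -
    have "?F x0 - k / 2 * (x0 - x0)\<^sup>2 \<le> ?F x - k / 2 * (x - x0)\<^sup>2"
      by (rule DERIV_nonneg_imp_nondecreasing[OF that]) (use DG slope(3) in force)
    thus ?thesis by simp
  qed
  have mid: "?F x - ?F x0 \<ge> k / 2 * (x - x0)\<^sup>2" if "x0 / 2 \<le> x" "x \<le> x0" for x
  proof -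
    have "?F x - k / 2 * (x - x0)\<^sup>2 \<ge> ?F x0 - k / 2 * (x0 - x0)\<^sup>2"
    proof (rule DERIV_nonpos_imp_nonincreasing[OF that(2)])
      fix y assume y: "x \<le> y" "y \<le> x0"
      have "cw_force \<beta> y - k * (y - x0) \<le> 0" using slope(2)[of y] y that by (simp add: algebra_simps)
      thus "\<exists>d. ((\<lambda>x. ?F x - k / 2 * (x - x0)\<^sup>2) has_real_derivative d) (at y) \<and> d \<le> 0"
        using DG by blast
    qed
    thus ?thesis by simp
  qed
  have left: "?F x - ?F x0 \<ge> k / 8 * (x - x0)\<^sup>2" if "0 \<le> x" "x \<le> x0 / 2" for x
  proof -
    have "?F x \<ge> ?F (x0 / 2)"
    proof (rule DERIV_nonpos_imp_nonincreasing[OF that(2)])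
      fix y assume "x \<le> y" "y \<le> x0 / 2"
      hence "cw_force \<beta> y \<le> 0" using slope(4)[of y] that assms(1) by auto
      thus "\<exists>d. (?F has_real_derivative d) (at y) \<and> d \<le> 0" using cw_potential_deriv by blast
    qed
    moreover have "?F (x0 / 2) - ?F x0 \<ge> k / 2 * (x0 / 2 - x0)\<^sup>2" using assms(1) by (intro mid) auto
    moreover have "k / 2 * (x0 / 2 - x0)\<^sup>2 = k / 8 * x0\<^sup>2" by (simp add: power2_eq_square field_simps)
    moreover have "(x - x0)\<^sup>2 \<le> x0\<^sup>2" using that assms(1) by (subst abs_le_square_iff[symmetric]) auto
    hence "k / 8 * (x - x0)\<^sup>2 \<le> k / 8 * x0\<^sup>2" using slope(1) by (intro mult_left_mono) auto
    ultimately show ?thesis by linarith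
  qed
  have pos: "?F x - ?F x0 \<ge> k / 8 * (x - x0)\<^sup>2" if "x \<ge> 0" for x
  proof -
    have "k / 8 * (x - x0)\<^sup>2 \<le> k / 2 * (x - x0)\<^sup>2" using slope(1) by (intro mult_right_mono) auto
    thus ?thesis using left[of x] mid[of x] right[of x] that by linarith
  qed
  have even: "?F x = ?F \<bar>x\<bar>" for x by (cases "x \<ge> 0") (auto simp: cw_potential_def)
  show ?thesis using pos slope(1) even by (intro exI[of _ "k / 8"]) (metis abs_ge_zero divide_pos_pos zero_less_numeral)
qed

text \<open>The Hubbard-Stratonovich identity.\<close>

lemma gauss_linear_integral:
  fixes M \<beta> S :: real
  assumes "M > 0" "\<beta> > 0"
  shows "has_bochner_integral lborel (\<lambda>x. exp (- (M * x\<^sup>2 / (2 * \<beta>)) + x * S))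
     (sqrt (2 * pi * (\<beta> / M)) * exp (\<beta> / (2 * M) * S\<^sup>2))"
proof -
  define \<sigma> where "\<sigma> = sqrt (\<beta> / M)"
  have \<sigma>: "\<sigma> > 0" "\<sigma>\<^sup>2 = \<beta> / M" using assms by (auto simp: \<sigma>_def)
  define \<mu> where "\<mu> = S * (\<beta> / M)"
  have "has_bochner_integral lborel (normal_density \<mu> \<sigma>) 1"
    using integral_normal_density[of \<sigma> \<mu>] integrable_normal_density[of \<sigma> \<mu>] \<sigma>(1)
    by (simp add: has_bochner_integral_iff)
  hence "has_bochner_integral lborel (\<lambda>x. sqrt (2 * pi * (\<beta> / M)) * exp (\<beta> / (2 * M) * S\<^sup>2) * normal_density \<mu> \<sigma> x)
    (sqrt (2 * pi * (\<beta> / M)) * exp (\<beta> / (2 * M) * S\<^sup>2) * 1)"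
    by (rule has_bochner_integral_mult_right)
  moreover have "sqrt (2 * pi * (\<beta> / M)) * exp (\<beta> / (2 * M) * S\<^sup>2) * normal_density \<mu> \<sigma> x
     = exp (- (M * x\<^sup>2 / (2 * \<beta>)) + x * S)" for x
  proof -
    have "sqrt (2 * pi * (\<beta> / M)) > 0" using assms by simp
    moreover have "\<beta> / (2 * M) * S\<^sup>2 + - (x - \<mu>)\<^sup>2 / (2 * (\<beta> / M)) = - (M * x\<^sup>2 / (2 * \<beta>)) + x * S"
      using assms by (simp add: \<mu>_def field_simps power2_eq_square)
    ultimately show ?thesis
      unfolding normal_density_def \<sigma>(2) using assms by (simp add: exp_add[symmetric])
  qed
  ultimately show ?thesis by simp
qed

text \<open>For a spin \<open>y\<close>, \<open>exp (x y) = cosh x (1 + y tanh x)\<close>.\<close>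

lemma exp_linear_bias_weight:
  assumes "finite I" "y \<in> I \<rightarrow>\<^sub>E {-1, 1}"
  shows "exp (x * (\<Sum>i\<in>I. y i)) = (2 * cosh x) ^ card I * bias_weight (tanh x) I y"
proof -
  have "exp (x * (\<Sum>i\<in>I. y i)) = (\<Prod>i\<in>I. exp (x * y i))"
    by (simp add: sum_distrib_left exp_sum assms(1))
  also have "\<dots> = (\<Prod>i\<in>I. 2 * cosh x * ((1 + tanh x * y i) / 2))"
  proof (rule prod.cong[OF refl])
    fix i assume "i \<in> I"
    hence "y i = -1 \<or> y i = 1" using assms(2) by (auto simp: PiE_iff)
    moreover have "2 * cosh x * ((1 + tanh x * s) / 2) = cosh x + s * sinh x" for s
      by (simp add: tanh_def field_simps)
    ultimately show "exp (x * y i) = 2 * cosh x * ((1 + tanh x * y i) / 2)"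
      using cosh_plus_sinh[of x] cosh_minus_sinh[of x] by auto
  qed
  also have "\<dots> = (2 * cosh x) ^ card I * bias_weight (tanh x) I y"
    by (simp only: prod.distrib prod_constant power_mult_distrib bias_weight_def)
  finally show ?thesis .
qed

lemma cw_weight_mixture:
  fixes I :: "'i set"
  assumes "finite I" "I \<noteq> {}" "\<beta> > 0" "y \<in> I \<rightarrow>\<^sub>E {-1, 1}"
  defines "M \<equiv> real (card I)"
  shows "has_bochner_integral lborel (\<lambda>x. exp (- M * cw_potential \<beta> x) * bias_weight (tanh x) I y)
     (sqrt (2 * pi * (\<beta> / M)) / 2 ^ card I * cw_weight \<beta> I y)"
proof -
  have M: "M > 0" using assms by (simp add: M_def card_gt_0_iff)
  have "exp (- M * cw_potential \<beta> x) * bias_weight (tanh x) I y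
    = exp (- (M * x\<^sup>2 / (2 * \<beta>)) + x * (\<Sum>i\<in>I. y i)) * (1 / 2 ^ card I)" for x
  proof -
    have "exp (- M * cw_potential \<beta> x) = exp (- (M * x\<^sup>2 / (2 * \<beta>))) * cosh x ^ card I"
    proof -
      have "cosh x ^ card I = exp (M * ln (cosh x))" by (simp add: M_def exp_of_nat_mult)
      thus ?thesis by (simp add: cw_potential_def algebra_simps exp_add[symmetric])
    qed
    thus ?thesis by (simp only: exp_add exp_linear_bias_weight[OF assms(1,4)]) (simp add: power_mult_distrib)
  qed
  moreover have "has_bochner_integral lborel (\<lambda>x. exp (- (M * x\<^sup>2 / (2 * \<beta>)) + x * (\<Sum>i\<in>I. y i)) * (1 / 2 ^ card I))
      ((sqrt (2 * pi * (\<beta> / M)) * exp (\<beta> / (2 * M) * (\<Sum>i\<in>I. y i)\<^sup>2)) * (1 / 2 ^ card I))"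
    by (intro has_bochner_integral_mult_left gauss_linear_integral M assms(3))
  ultimately show ?thesis by (simp add: cw_weight_def M_def)
qed

definition cw_prob :: "real \<Rightarrow> 'i set \<Rightarrow> (('i \<Rightarrow> real) \<Rightarrow> bool) \<Rightarrow> real" where
  "cw_prob \<beta> I Q = (\<Sum>y \<in> I \<rightarrow>\<^sub>E {-1, 1}. cw_weight \<beta> I y / cw_partition \<beta> I * of_bool (Q y))"

lemma cw_prob_mixture:
  fixes I :: "'i set"
  assumes "finite I" "I \<noteq> {}" "\<beta> > 0"
  defines "M \<equiv> real (card I)"
  shows "integrable lborel (\<lambda>x. exp (- M * cw_potential \<beta> x))"
    and "integrable lborel (\<lambda>x. exp (- M * cw_potential \<beta> x) * bprob (tanh x) I Q)"
    and "cw_prob \<beta> I Q = (\<integral>x. exp (- M * cw_potential \<beta> x) * bprob (tanh x) I Q \<partial>lborel)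
      / (\<integral>x. exp (- M * cw_potential \<beta> x) \<partial>lborel)"
proof -
  let ?\<phi> = "\<lambda>x. exp (- M * cw_potential \<beta> x)"
  define C where "C = sqrt (2 * pi * (\<beta> / M)) / 2 ^ card I"
  have M: "M > 0" using assms by (simp add: M_def card_gt_0_iff)
  have C: "C > 0" using M assms(3) by (simp add: C_def)
  have mix: "has_bochner_integral lborel (\<lambda>x. ?\<phi> x * bprob (tanh x) I Q)
     (C * (\<Sum>y \<in> I \<rightarrow>\<^sub>E {-1, 1}. cw_weight \<beta> I y * of_bool (Q y)))" for Q
  proof -
    have "has_bochner_integral lborel (\<lambda>x. \<Sum>y \<in> I \<rightarrow>\<^sub>E {-1, 1}. ?\<phi> x * bias_weight (tanh x) I y * of_bool (Q y))
       (\<Sum>y \<in> I \<rightarrow>\<^sub>E {-1, 1}. C * cw_weight \<beta> I y * of_bool (Q y))"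
      unfolding C_def M_def
      by (intro has_bochner_integral_sum has_bochner_integral_mult_left cw_weight_mixture assms)
    thus ?thesis by (simp add: bprob_def bexp_def sum_distrib_left mult_ac)
  qed
  show "integrable lborel (\<lambda>x. ?\<phi> x * bprob (tanh x) I Q)"
    using mix[of Q] by (simp add: has_bochner_integral_iff)
  have one: "bprob t I (\<lambda>_. True) = 1" for t
    using bexp_const[OF assms(1), of t 1] by (simp add: bprob_def)
  show "integrable lborel (\<lambda>x. ?\<phi> x)"
    using mix[of "\<lambda>_. True"] by (simp add: has_bochner_integral_iff one)
  have "(\<integral>x. ?\<phi> x \<partial>lborel) = C * cw_partition \<beta> I"
    using mix[of "\<lambda>_. True"] by (simp add: has_bochner_integral_iff one cw_partition_def)
  moreover have "(\<integral>x. ?\<phi> x * bprob (tanh x) I Q \<partial>lborel)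
      = C * (\<Sum>y \<in> I \<rightarrow>\<^sub>E {-1, 1}. cw_weight \<beta> I y * of_bool (Q y))"
    using mix[of Q] by (simp add: has_bochner_integral_iff)
  ultimately show "cw_prob \<beta> I Q = (\<integral>x. ?\<phi> x * bprob (tanh x) I Q \<partial>lborel)
      / (\<integral>x. ?\<phi> x \<partial>lborel)"
    using C by (simp add: cw_prob_def sum_divide_distrib)
qed

text \<open>Laplace's method with explicit constants: the normalization is bounded below through the quadratic upper
  bound at \<open>x0\<close>, the contribution of biases far from \<open>\<plusminus> tanh x0\<close> is bounded above through the quadratic lower bound, half
  of which is spent on the factor \<open>exp (- k M r\<^sup>2 / 2)\<close> and half on integrability.\<close>

lemma cw_prob_concentration:
  fixes I :: "'i set"
  assumes "finite I" "I \<noteq> {}" "\<beta> > 0" "x0 > 0" "cw_force \<beta> x0 = 0"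
    and k: "k > 0" "\<And>x. cw_potential \<beta> x - cw_potential \<beta> x0 \<ge> k * (\<bar>x\<bar> - x0)\<^sup>2"
    and p: "\<And>t. \<bar>t\<bar> < 1 \<Longrightarrow> \<bar>\<bar>t\<bar> - tanh x0\<bar> \<le> r \<Longrightarrow> bprob t I Q \<le> p" and "p \<ge> 0" "r \<ge> 0"
  shows "cw_prob \<beta> I Q \<le> p + 2 * sqrt (1 / (\<beta> * k)) * exp (- (k / 2 * (real (card I) * r\<^sup>2)))"
proof -
  define M where "M = real (card I)"
  have M: "M > 0" using assms(1,2) by (simp add: M_def card_gt_0_iff)
  let ?\<phi> = "\<lambda>x. exp (- M * cw_potential \<beta> x)"
  note mix = cw_prob_mixture[OF assms(1-3), folded M_def]
  define E0 where "E0 = exp (- M * cw_potential \<beta> x0)"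
  define e where "e = exp (- (k / 2 * (M * r\<^sup>2)))"
  define Z where "Z = (\<integral>x. ?\<phi> x \<partial>lborel)"
  have gauss: "has_bochner_integral lborel (\<lambda>x. exp (- (M * (x + a)\<^sup>2 / (2 * b)))) (sqrt (2 * pi * (b / M)))"
    if "b > 0" for a b
    using iffD1[OF lborel_has_bochner_integral_real_affine_iff[of 1 _ _ a] gauss_linear_integral[OF M that, of 0]]
    by (simp add: add.commute)
  have Zlow: "Z \<ge> E0 * sqrt (2 * pi * (\<beta> / M))"
  proof -
    note g = gauss[OF assms(3), of "- x0"]
    have "(\<integral>x. E0 * exp (- (M * (x + - x0)\<^sup>2 / (2 * \<beta>))) \<partial>lborel) \<le> Z"
      unfolding Z_def
    proof (rule integral_mono)
      show "integrable lborel (\<lambda>x. E0 * exp (- (M * (x + - x0)\<^sup>2 / (2 * \<beta>))))"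
        using g by (intro integrable_mult_right) (auto simp: has_bochner_integral_iff)
      fix x
      have "- M * cw_potential \<beta> x0 + - (M * (x + - x0)\<^sup>2 / (2 * \<beta>)) \<le> - M * cw_potential \<beta> x"
        using mult_left_mono[OF cw_potential_upper[OF assms(3,5), of x], of M] M by (simp add: algebra_simps)
      thus "E0 * exp (- (M * (x + - x0)\<^sup>2 / (2 * \<beta>))) \<le> ?\<phi> x"
        unfolding E0_def exp_add[symmetric] by simp
    qed (rule mix(1))
    thus ?thesis using g by (simp add: has_bochner_integral_iff)
  qed
  have Zpos: "Z > 0"
  proof -
    have "E0 * sqrt (2 * pi * (\<beta> / M)) > 0" using M assms(3) by (simp add: E0_def)
    thus ?thesis using Zlow by linarith
  qed
  let ?g = "\<lambda>x. exp (- (M * (x + - x0)\<^sup>2 / (2 * (1 / k)))) + exp (- (M * (x + x0)\<^sup>2 / (2 * (1 / k))))"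
  have g: "has_bochner_integral lborel ?g (2 * sqrt (2 * pi * ((1 / k) / M)))"
    using has_bochner_integral_add[OF gauss[of "1 / k" "- x0"] gauss[of "1 / k" x0]] k(1) by simp
  hence ig: "integrable lborel ?g" and vg: "(\<integral>x. ?g x \<partial>lborel) = 2 * sqrt (2 * pi * ((1 / k) / M))"
    by (simp_all only: has_bochner_integral_iff)
  have "(\<integral>x. ?\<phi> x * bprob (tanh x) I Q \<partial>lborel) \<le> (\<integral>x. p * ?\<phi> x + E0 * e * ?g x \<partial>lborel)"
  proof (rule integral_mono)
    show "integrable lborel (\<lambda>x. p * ?\<phi> x + E0 * e * ?g x)"
      by (rule Bochner_Integration.integrable_add[OF integrable_mult_right[OF mix(1)] integrable_mult_right[OF ig]])
    show "integrable lborel (\<lambda>x. ?\<phi> x * bprob (tanh x) I Q)" by (rule mix(2))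
    fix x :: real
    have t: "\<bar>tanh x\<bar> < 1" using tanh_real_lt_1[of x] tanh_real_gt_neg1[of x] by linarith
    have gpos: "E0 * e * ?g x \<ge> 0" by (simp add: E0_def e_def)
    show "?\<phi> x * bprob (tanh x) I Q \<le> p * ?\<phi> x + E0 * e * ?g x"
    proof (cases "\<bar>\<bar>x\<bar> - x0\<bar> \<le> r")
      case True
      have lip: "\<bar>tanh a - tanh b\<bar> \<le> \<bar>a - b\<bar>" for a b :: real
      proof -
        have "norm (tanh a - tanh b) \<le> 1 * norm (a - b)"
        proof (rule field_differentiable_bound[of UNIV tanh "\<lambda>x. 1 - (tanh x)\<^sup>2"])
          show "norm (1 - (tanh x)\<^sup>2) \<le> 1" for x :: real
            using tanh_real_lt_1[of x] tanh_real_gt_neg1[of x] abs_square_le_1[of "tanh x"] by (simp add: abs_le_iff)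
        qed (auto intro!: derivative_eq_intros)
        thus ?thesis by simp
      qed
      have "\<bar>tanh x\<bar> = tanh \<bar>x\<bar>" by (simp add: tanh_real_abs)
      hence "\<bar>\<bar>tanh x\<bar> - tanh x0\<bar> \<le> r" using lip[of "\<bar>x\<bar>" x0] True by simp
      hence "bprob (tanh x) I Q \<le> p" by (rule p[OF t])
      hence "?\<phi> x * bprob (tanh x) I Q \<le> ?\<phi> x * p" by (intro mult_left_mono) auto
      thus ?thesis using gpos by (simp only: mult.commute[of p])
    next
      case False
      hence "r\<^sup>2 \<le> (\<bar>x\<bar> - x0)\<^sup>2" using \<open>r \<ge> 0\<close> by (subst abs_le_square_iff[symmetric]) auto
      hence "k / 2 * (M * r\<^sup>2) \<le> k / 2 * (M * (\<bar>x\<bar> - x0)\<^sup>2)" using k(1) M by (intro mult_left_mono) auto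
      moreover have "M * (k * (\<bar>x\<bar> - x0)\<^sup>2) \<le> M * (cw_potential \<beta> x - cw_potential \<beta> x0)"
        using k(2)[of x] M by (intro mult_left_mono) auto
      ultimately have "- M * cw_potential \<beta> x \<le> - M * cw_potential \<beta> x0 + - (k / 2 * (M * r\<^sup>2)) + - (k / 2 * (M * (\<bar>x\<bar> - x0)\<^sup>2))"
        by (simp add: algebra_simps)
      hence "?\<phi> x \<le> E0 * e * exp (- (k / 2 * (M * (\<bar>x\<bar> - x0)\<^sup>2)))"
        unfolding E0_def e_def exp_add[symmetric] by simp
      also have "exp (- (k / 2 * (M * (\<bar>x\<bar> - x0)\<^sup>2))) \<le> ?g x"
        using k(1) by (cases "x \<ge> 0") (auto simp: field_simps power2_eq_square)
      hence "E0 * e * exp (- (k / 2 * (M * (\<bar>x\<bar> - x0)\<^sup>2))) \<le> E0 * e * ?g x"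
        by (intro mult_left_mono) (auto simp: E0_def e_def)
      finally have "?\<phi> x \<le> E0 * e * ?g x" .
      moreover have "?\<phi> x * bprob (tanh x) I Q \<le> ?\<phi> x * 1"
        using bprob_le_1[OF assms(1), of "tanh x" Q] t by (intro mult_left_mono) auto
      moreover have "p * ?\<phi> x \<ge> 0" using \<open>p \<ge> 0\<close> by simp
      ultimately show ?thesis by linarith
    qed
  qed
  also have "\<dots> = p * Z + E0 * e * (2 * sqrt (2 * pi * ((1 / k) / M)))"
    unfolding Bochner_Integration.integral_add[OF integrable_mult_right[OF mix(1)] integrable_mult_right[OF ig]]
      integral_mult_right_zero vg Z_def ..
  finally have "cw_prob \<beta> I Q \<le> (p * Z + E0 * e * (2 * sqrt (2 * pi * ((1 / k) / M)))) / Z"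
    unfolding mix(3) Z_def[symmetric] using Zpos by (intro divide_right_mono) auto
  also have "\<dots> = p + E0 * e * (2 * sqrt (2 * pi * ((1 / k) / M))) / Z"
    using Zpos by (simp add: add_divide_distrib)
  also have "E0 * e * (2 * sqrt (2 * pi * ((1 / k) / M))) / Z \<le> E0 * e * (2 * sqrt (2 * pi * ((1 / k) / M))) / (E0 * sqrt (2 * pi * (\<beta> / M)))"
    using Zlow k(1) M assms(3) by (intro divide_left_mono mult_pos_pos) (auto simp: E0_def e_def Zpos)
  also have "\<dots> = e * (2 * (sqrt (2 * pi * ((1 / k) / M)) / sqrt (2 * pi * (\<beta> / M))))"
    by (simp add: E0_def)
  also have "sqrt (2 * pi * ((1 / k) / M)) / sqrt (2 * pi * (\<beta> / M)) = sqrt (1 / (\<beta> * k))"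
    unfolding real_sqrt_divide[symmetric] using k(1) M assms(3) by (simp add: field_simps)
  finally show ?thesis by (simp add: e_def M_def mult_ac)
qed

text \<open>The events \<open>Y = y\<close> for spin configurations \<open>y\<close> are disjoint with total probability 1, so values of \<open>Y\<close>
  outside \<open>{-1, 1}\<close> contribute a null set.\<close>

lemma curie_weiss_emeasure_le:
  fixes Y :: "'i \<Rightarrow> 'a \<Rightarrow> real"
  assumes "curie_weiss P \<beta> I Y" and A: "A \<in> sets P"
    and Q: "\<And>\<omega>. \<omega> \<in> A \<Longrightarrow> (\<lambda>i\<in>I. Y i \<omega>) \<in> I \<rightarrow>\<^sub>E {-1, 1} \<Longrightarrow> Q (\<lambda>i\<in>I. Y i \<omega>)"
  shows "emeasure P A \<le> ennreal (cw_prob \<beta> I Q)"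
proof -
  interpret prob_space P using assms(1) by (simp add: curie_weiss_def)
  have fin: "finite I" and meas[measurable]: "\<And>i. i \<in> I \<Longrightarrow> Y i \<in> borel_measurable P"
    and law: "\<And>y. y \<in> I \<rightarrow>\<^sub>E {-1, 1} \<Longrightarrow> measure P {\<omega> \<in> space P. \<forall>i\<in>I. Y i \<omega> = y i} = cw_weight \<beta> I y / cw_partition \<beta> I"
    using assms(1) by (auto simp: curie_weiss_def)
  define E where "E y = {\<omega> \<in> space P. \<forall>i\<in>I. Y i \<omega> = y i}" for y
  have E[measurable]: "E y \<in> sets P" for y unfolding E_def using fin by measurable
  let ?S = "I \<rightarrow>\<^sub>E {-1, 1 :: real}"
  let ?U = "\<Union>y\<in>?S. E y" and ?V = "\<Union>y\<in>{y\<in>?S. Q y}. E y"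
  have finS: "finite ?S" using fin by (intro finite_PiE) auto
  have disj: "disjoint_family_on E ?S"
    unfolding disjoint_family_on_def E_def
  proof (intro ballI impI)
    fix y y' assume y: "y \<in> ?S" "y' \<in> ?S" "y \<noteq> y'"
    then obtain i where "i \<in> I" "y i \<noteq> y' i" by (metis PiE_ext)
    thus "{\<omega> \<in> space P. \<forall>i\<in>I. Y i \<omega> = y i} \<inter> {\<omega> \<in> space P. \<forall>i\<in>I. Y i \<omega> = y' i} = {}" by fastforce
  qed
  have Zpos: "cw_partition \<beta> I > 0"
    unfolding cw_partition_def
    by (intro sum_pos finS) (auto simp: cw_weight_def PiE_eq_empty_iff)
  have "prob ?U = (\<Sum>y\<in>?S. prob (E y))"
    using disj finS by (intro finite_measure_finite_Union) auto
  also have "\<dots> = (\<Sum>y\<in>?S. cw_weight \<beta> I y / cw_partition \<beta> I)"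
    by (intro sum.cong refl) (simp add: E_def law)
  also have "\<dots> = 1" using Zpos by (simp add: sum_divide_distrib[symmetric] cw_partition_def[symmetric])
  finally have one: "prob ?U = 1" .
  have U: "?U \<in> sets P" using finS by (intro sets.finite_UN) auto
  have "prob (space P - ?U) = 0" using prob_compl[OF U] one by simp
  moreover have "A \<subseteq> ?V \<union> (space P - ?U)"
  proof
    fix \<omega> assume \<omega>: "\<omega> \<in> A"
    hence sp: "\<omega> \<in> space P" using sets.sets_into_space[OF A] by auto
    show "\<omega> \<in> ?V \<union> (space P - ?U)"
    proof (cases "\<omega> \<in> ?U")
      case True
      then obtain y where y: "y \<in> ?S" "\<forall>i\<in>I. Y i \<omega> = y i" by (auto simp: E_def)
      hence "(\<lambda>i\<in>I. Y i \<omega>) = y" by (auto simp: PiE_iff extensional_def restrict_def fun_eq_iff)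
      hence "Q y" using Q[OF \<omega>] y(1) by simp
      thus ?thesis using y sp by (auto simp: E_def)
    qed (use sp in auto)
  qed
  ultimately have "prob A \<le> prob ?V"
  proof -
    have m: "?V \<in> sets P" using finS by (intro sets.finite_UN) auto
    have "prob A \<le> prob (?V \<union> (space P - ?U))"
      using \<open>A \<subseteq> _\<close> m U by (intro finite_measure_mono) auto
    also have "\<dots> \<le> prob ?V + prob (space P - ?U)"
      using m U by (intro measure_Un_le) auto
    finally show ?thesis using \<open>prob (space P - ?U) = 0\<close> by simp
  qed
  also have "\<dots> = (\<Sum>y\<in>{y\<in>?S. Q y}. prob (E y))"
    using finS by (intro finite_measure_finite_Union disjoint_family_on_mono[OF _ disj]) auto
  also have "\<dots> = (\<Sum>y\<in>{y\<in>?S. Q y}. cw_weight \<beta> I y / cw_partition \<beta> I)"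
    by (intro sum.cong refl) (simp add: E_def law)
  also have "\<dots> = cw_prob \<beta> I Q"
    unfolding cw_prob_def using finS by (simp add: sum.inter_filter of_bool_def if_distrib cong: if_cong)
  finally show ?thesis by (simp add: emeasure_eq_measure ennreal_leI)
qed

section \<open>Fluctuations of the Schur complements\<close>

definition spin :: "(nat \<times> nat \<Rightarrow> real) \<Rightarrow> nat \<Rightarrow> nat \<Rightarrow> real" where
  "spin y i j = (if i \<le> j then y (i, j) else y (j, i))"

definition centred :: "real \<Rightarrow> real \<Rightarrow> (nat \<times> nat \<Rightarrow> real) \<Rightarrow> nat \<Rightarrow> nat \<Rightarrow> real" where
  "centred b t y i j = b * (spin y i j - t)"

lemma symmetric_on_centred: "symmetric_on I (centred b t y)"
  by (auto simp: symmetric_on_def centred_def spin_def)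

lemma sum_square_symmetric:
  fixes f :: "nat \<Rightarrow> nat \<Rightarrow> 'b::comm_ring_1"
  assumes "\<And>j k. f j k = f k j"
  shows "(\<Sum>j<n. \<Sum>k<n. f j k) = (\<Sum>k<n. f k k) + 2 * (\<Sum>k<n. \<Sum>j<k. f j k)"
proof (induction n)
  case (Suc n)
  have "(\<Sum>j<Suc n. \<Sum>k<Suc n. f j k) = (\<Sum>j<n. \<Sum>k<n. f j k) + (\<Sum>j<n. f j n) + (\<Sum>k<n. f n k) + f n n"
    by (simp add: sum.distrib add_ac)
  also have "(\<Sum>k<n. f n k) = (\<Sum>j<n. f j n)" using assms by (intro sum.cong) auto
  finally show ?case using Suc by (simp add: algebra_simps)
qed simp

text \<open>On \<open>{-1, 1}\<close> the square of a centred spin is \<open>1 - t\<^sup>2 - 2 t X\<close>, so the diagonal part of the centred quadratic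
  form is linear in the spins. The minor vanishes on row and column \<open>i\<close>, which permits sums over all
  indices.\<close>

lemma fluctuation_expansion:
  fixes y :: "nat \<times> nat \<Rightarrow> real" and b t :: real and z :: complex and i N :: nat
  assumes y: "y \<in> {..<N} \<times> {..<N} \<rightarrow>\<^sub>E {-1, 1}" and z: "Im z > 0" and i: "i < N"
  defines "X \<equiv> \<lambda>j. spin y i j - t" and "G \<equiv> res ({..<N} - {i}) (centred b t y) z"
  shows "fluctuation {..<N} (centred b t y) (b\<^sup>2 * (1 - t\<^sup>2)) z i
    = of_real (b\<^sup>2) * (2 * (\<Sum>k<N. of_real (X k) * (\<Sum>j<k. G j k * of_real (X j)))
        - 2 * of_real t * (\<Sum>k<N. of_real (X k) * G k k))"
proof -
  have fin: "finite ({..<N} - {i})" by simp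
  note sy = symmetric_on_centred[of "{..<N} - {i}" b t y]
  have G0: "G j k = 0" if "j = i \<or> k = i" for j k
    using res_outside[OF fin sy z, of j k] that by (auto simp: G_def)
  have Gsym: "G j k = G k j" for j k using res_sym[OF fin sy z] by (simp add: G_def)
  have A: "centred b t y i j = b * X j" "centred b t y j i = b * X j" for j
    by (auto simp: centred_def X_def spin_def)
  have ext: "(\<Sum>j\<in>{..<N} - {i}. f j) = (\<Sum>j<N. f j)" if "f i = 0" for f :: "nat \<Rightarrow> complex"
    using that i by (subst sum.remove[of "{..<N}" i]) auto
  have "(\<Sum>j\<in>{..<N} - {i}. \<Sum>k\<in>{..<N} - {i}. of_real (centred b t y i j) * G j k * of_real (centred b t y k i))
    = (\<Sum>j<N. \<Sum>k<N. of_real (centred b t y i j) * G j k * of_real (centred b t y k i))"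
    using G0 by (subst ext, simp, subst ext) auto
  also have "\<dots> = of_real (b\<^sup>2) * (\<Sum>j<N. \<Sum>k<N. of_real (X j) * G j k * of_real (X k))"
    unfolding A by (simp add: sum_distrib_left power2_eq_square mult_ac)
  also have "(\<Sum>j<N. \<Sum>k<N. of_real (X j) * G j k * of_real (X k))
     = (\<Sum>k<N. of_real (X k) * G k k * of_real (X k)) + 2 * (\<Sum>k<N. \<Sum>j<k. of_real (X j) * G j k * of_real (X k))"
    by (rule sum_square_symmetric) (simp add: Gsym mult_ac)
  also have "(\<Sum>k<N. of_real (X k) * G k k * of_real (X k))
     = (\<Sum>k<N. of_real (1 - t\<^sup>2) * G k k - 2 * of_real t * (of_real (X k) * G k k))"
  proof (rule sum.cong[OF refl])
    fix k assume "k \<in> {..<N}"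
    hence "spin y i k = -1 \<or> spin y i k = 1" using y i by (auto simp: spin_def PiE_iff)
    hence "X k * X k = (1 - t\<^sup>2) - 2 * t * X k" by (auto simp: X_def algebra_simps power2_eq_square)
    from arg_cong[OF this, of complex_of_real]
    have "of_real (X k) * of_real (X k) = (of_real (1 - t\<^sup>2) - 2 * of_real t * of_real (X k) :: complex)"
      by (simp only: of_real_diff of_real_mult of_real_numeral)
    moreover have "of_real (X k) * G k k * of_real (X k) = (of_real (X k) * of_real (X k)) * G k k"
      by (simp only: mult_ac)
    ultimately show "of_real (X k) * G k k * of_real (X k) = of_real (1 - t\<^sup>2) * G k k - 2 * of_real t * (of_real (X k) * G k k)"
      by (simp only: left_diff_distrib mult.assoc)
  qed
  also have "\<dots> = of_real (1 - t\<^sup>2) * (\<Sum>k<N. G k k) - 2 * of_real t * (\<Sum>k<N. of_real (X k) * G k k)"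
    by (simp only: sum_subtractf sum_distrib_left)
  also have "(\<Sum>k<N. \<Sum>j<k. of_real (X j) * G j k * of_real (X k)) = (\<Sum>k<N. of_real (X k) * (\<Sum>j<k. G j k * of_real (X j)))"
    by (simp only: sum_distrib_left mult_ac)
  finally have 1: "(\<Sum>j\<in>{..<N} - {i}. \<Sum>k\<in>{..<N} - {i}. of_real (centred b t y i j) * G j k * of_real (centred b t y k i))
    = of_real (b\<^sup>2) * (of_real (1 - t\<^sup>2) * (\<Sum>k<N. G k k) - 2 * of_real t * (\<Sum>k<N. of_real (X k) * G k k)
       + 2 * (\<Sum>k<N. of_real (X k) * (\<Sum>j<k. G j k * of_real (X j))))" .
  have 2: "res_trace ({..<N} - {i}) (centred b t y) z = (\<Sum>k<N. G k k)"
    unfolding res_trace_def G_def[symmetric] using G0 by (intro ext) auto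
  have "of_real (b\<^sup>2) * (of_real (1 - t\<^sup>2) * g - 2 * of_real t * S + 2 * Q) - of_real (b\<^sup>2 * (1 - t\<^sup>2)) * g
     = of_real (b\<^sup>2) * (2 * Q - 2 * of_real t * S)" for g S Q :: complex
    by (simp only: of_real_mult of_real_diff of_real_1 right_diff_distrib left_diff_distrib distrib_left mult.assoc mult_1_left mult_1_right) simp
  thus ?thesis
    unfolding fluctuation_def G_def[symmetric] 1 2 .
qed

text \<open>The minor does not involve the spins of row \<open>i\<close>, so the tail bounds apply to the real and imaginary parts of
  both sums in \<open>fluctuation_expansion\<close>, with the Frobenius norm of the minor as scale.\<close>

lemma fluctuation_tail:
  fixes N :: nat and z :: complex and b t K :: real
  assumes t: "\<bar>t\<bar> \<le> 1" and z: "Im z > 0" and i: "i < N" and K: "K \<ge> 1"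
  shows "bprob t ({..<N} \<times> {..<N}) (\<lambda>y.
      cmod (fluctuation {..<N} (centred b t y) (b\<^sup>2 * (1 - t\<^sup>2)) z i)
        > 8 * b\<^sup>2 * K\<^sup>2 * frobenius ({..<N} - {i}) (centred b t y) z)
    \<le> (4 * real N + 8) * exp (- (K\<^sup>2 / 2))"
proof -
  define J where "J = {..<N} \<times> {..<N}"
  (* The position in the upper triangle of the spin at (i, j). *)
  define r where "r j = (min i j, max i j)" for j
  define G where "G y = res ({..<N} - {i}) (centred b t y) z" for y
  define F where "F y = frobenius ({..<N} - {i}) (centred b t y) z" for y
  let ?p = "2 * exp (- (K\<^sup>2 / 2))"
  have J: "finite J" by (simp add: J_def)
  let ?lin = "\<lambda>P y. \<bar>\<Sum>k<N. (y (r k) - t) * P (G y k k)\<bar>"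
  let ?quad = "\<lambda>P y. \<bar>\<Sum>k<N. (y (r k) - t) * (\<Sum>j<k. P (G y j k) * (y (r j) - t))\<bar>"
  let ?Z = "\<lambda>y. fluctuation {..<N} (centred b t y) (b\<^sup>2 * (1 - t\<^sup>2)) z i"
  have inj: "inj_on r {..<N}"
  proof (rule inj_onI)
    fix j k assume "r j = r k"
    hence "min i j = min i k" "max i j = max i k" by (auto simp: r_def)
    thus "j = k" by linarith
  qed
  have sub: "r ` {..<N} \<subseteq> J" using i by (auto simp: r_def J_def)
  have yr: "y (r j) = spin y i j" for y j by (auto simp: r_def spin_def min_def max_def)
  have ignG: "ignores (r ` {..<N}) G"
    unfolding ignores_def
  proof (intro allI impI)
    fix y p c assume "p \<in> r ` {..<N}"
    then obtain m where m: "p = r m" by auto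
    have "fst p = i \<or> snd p = i" by (simp add: m r_def min_def max_def)
    hence "spin (y(p := c)) j k = spin y j k" if "j \<noteq> i" "k \<noteq> i" for j k
      using that by (auto simp: spin_def)
    thus "G (y(p := c)) = G y"
      unfolding G_def by (intro res_cong) (auto simp: centred_def)
  qed
  have Fdef: "F y = sqrt (\<Sum>j<N. \<Sum>k<N. (cmod (G y j k))\<^sup>2)" for y
  proof -
    have G0: "G y j k = 0" if "j = i \<or> k = i" for j k
      using res_outside[OF _ symmetric_on_centred z, of "{..<N} - {i}" j k b t y] that by (auto simp: G_def)
    have ext: "(\<Sum>j\<in>{..<N} - {i}. f j) = (\<Sum>j<N. f j)" if "f i = 0" for f :: "nat \<Rightarrow> real"
      using that i by (subst sum.remove[of "{..<N}" i]) auto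
    have "(\<Sum>j\<in>{..<N} - {i}. \<Sum>k\<in>{..<N} - {i}. (cmod (G y j k))\<^sup>2) = (\<Sum>j<N. \<Sum>k<N. (cmod (G y j k))\<^sup>2)"
      using G0 by (subst ext, simp, subst ext) auto
    thus ?thesis by (simp add: F_def frobenius_def G_def[symmetric])
  qed
  have F0: "F y \<ge> 0" for y by (simp add: Fdef sum_nonneg)
  have F2: "(F y)\<^sup>2 = (\<Sum>j<N. \<Sum>k<N. (cmod (G y j k))\<^sup>2)" for y by (simp add: Fdef sum_nonneg)
  have ignF: "ignores (r ` {..<N}) F" using ignG by (simp add: ignores_def Fdef)
  have tails: "bprob t J (\<lambda>y. ?lin P y > K * F y) \<le> ?p"
    "bprob t J (\<lambda>y. ?quad P y > K\<^sup>2 * F y) \<le> 2 * (real N + 1) * exp (- (K\<^sup>2 / 2))"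
    if P: "\<And>w. \<bar>P w\<bar> \<le> cmod w" for P :: "complex \<Rightarrow> real"
  proof -
    have P2: "(P w)\<^sup>2 \<le> (cmod w)\<^sup>2" for w using power_mono[OF P[of w], of 2] by simp
    have ign: "ignores (r ` {..<N}) (\<lambda>y. P (G y j k))" for j k using ignG by (simp add: ignores_def)
    (* P stands for the real or the imaginary part. *)
    have off: "(\<Sum>k<N. \<Sum>j<k. (P (G y j k))\<^sup>2) \<le> (F y)\<^sup>2" for y
    proof -
      have "(\<Sum>k<N. \<Sum>j<k. (P (G y j k))\<^sup>2) \<le> (\<Sum>k<N. \<Sum>j<N. (cmod (G y j k))\<^sup>2)"
      proof (rule sum_mono)
        fix k assume k: "k \<in> {..<N}"
        have "(\<Sum>j<k. (P (G y j k))\<^sup>2) \<le> (\<Sum>j<k. (cmod (G y j k))\<^sup>2)" using P2 by (intro sum_mono)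
        also have "\<dots> \<le> (\<Sum>j<N. (cmod (G y j k))\<^sup>2)" using k by (intro sum_mono2) auto
        finally show "(\<Sum>j<k. (P (G y j k))\<^sup>2) \<le> (\<Sum>j<N. (cmod (G y j k))\<^sup>2)" .
      qed
      also have "\<dots> = (F y)\<^sup>2" unfolding F2 by (rule sum.swap)
      finally show ?thesis .
    qed
    show "bprob t J (\<lambda>y. ?quad P y > K\<^sup>2 * F y)
        \<le> 2 * (real N + 1) * exp (- (K\<^sup>2 / 2))"
      by (rule quadratic_form_tail[OF J t inj sub ign ignF F0 off]) (use K in simp)
    have diag: "(\<Sum>k<N. (P (G y k k))\<^sup>2) \<le> (F y)\<^sup>2" for y
      unfolding F2
    proof (rule sum_mono)
      fix k assume k: "k \<in> {..<N}"
      have "(P (G y k k))\<^sup>2 \<le> (cmod (G y k k))\<^sup>2" by (rule P2)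
      also have "\<dots> \<le> (\<Sum>j<N. (cmod (G y k j))\<^sup>2)" using k by (intro member_le_sum) auto
      finally show "(P (G y k k))\<^sup>2 \<le> (\<Sum>j<N. (cmod (G y k j))\<^sup>2)" .
    qed
    have "bprob t J (\<lambda>y. ?lin P y > K * F y \<and> (\<Sum>k<N. (P (G y k k))\<^sup>2) \<le> (F y)\<^sup>2) \<le> ?p"
      by (rule self_normalized_tail_abs[OF J t inj sub _ ignF F0]) (use K in \<open>auto intro: ignores_subset[OF ign]\<close>)
    thus "bprob t J (\<lambda>y. ?lin P y > K * F y) \<le> ?p" using diag by simp
  qed
  have "bprob t J (\<lambda>y. cmod (?Z y) > 8 * b\<^sup>2 * K\<^sup>2 * F y)
     \<le> bprob t J (\<lambda>y. (?lin Re y > K * F y \<or> ?lin Im y > K * F y) \<or> (?quad Re y > K\<^sup>2 * F y \<or> ?quad Im y > K\<^sup>2 * F y))"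
  proof (rule bprob_mono[OF t], rule ccontr)
    fix y assume y: "y \<in> J \<rightarrow>\<^sub>E {-1, 1}"
      and big: "cmod (?Z y) > 8 * b\<^sup>2 * K\<^sup>2 * F y"
      and "\<not> ((?lin Re y > K * F y \<or> ?lin Im y > K * F y) \<or> (?quad Re y > K\<^sup>2 * F y \<or> ?quad Im y > K\<^sup>2 * F y))"
    hence small: "?lin Re y \<le> K * F y" "?lin Im y \<le> K * F y" "?quad Re y \<le> K\<^sup>2 * F y" "?quad Im y \<le> K\<^sup>2 * F y" by auto
    have KK: "K * F y \<le> K\<^sup>2 * F y"
      using K F0[of y] by (intro mult_right_mono) (auto simp: power2_eq_square)
    define S where "S = (\<Sum>k<N. of_real (spin y i k - t) * G y k k)"
    define T where "T = (\<Sum>k<N. of_real (spin y i k - t) * (\<Sum>j<k. G y j k * of_real (spin y i j - t)))"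
    have S: "cmod S \<le> 2 * (K\<^sup>2 * F y)"
      using cmod_le[of S] small(1,2) KK by (simp add: yr S_def)
    have T: "cmod T \<le> 2 * (K\<^sup>2 * F y)"
      using cmod_le[of T] small(3,4) by (simp add: yr T_def)
    have "?Z y = of_real (b\<^sup>2) * (2 * T - 2 * of_real t * S)"
      unfolding G_def S_def T_def by (rule fluctuation_expansion[OF y[unfolded J_def] z i])
    hence eq: "cmod (?Z y) = b\<^sup>2 * cmod (2 * T - 2 * of_real t * S)"
      by (simp only: norm_mult norm_of_real abs_power2)
    have "cmod (2 * T - 2 * of_real t * S) \<le> cmod (2 * T) + cmod (2 * of_real t * S)"
      by (rule norm_triangle_ineq4)
    also have "\<dots> = 2 * cmod T + 2 * (\<bar>t\<bar> * cmod S)"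
      by (simp add: norm_mult)
    also have "\<dots> \<le> 2 * cmod T + 2 * (1 * cmod S)"
      using t by (intro add_left_mono mult_left_mono mult_right_mono) auto
    also have "\<dots> \<le> 8 * (K\<^sup>2 * F y)" using S T by linarith
    finally have "b\<^sup>2 * cmod (2 * T - 2 * of_real t * S) \<le> b\<^sup>2 * (8 * (K\<^sup>2 * F y))"
      by (intro mult_left_mono) auto
    hence "cmod (?Z y) \<le> b\<^sup>2 * (8 * (K\<^sup>2 * F y))"
      unfolding eq .
    thus False using big by (simp add: mult_ac)
  qed
  also have "\<dots> \<le> (?p + ?p) + (2 * (real N + 1) * exp (- (K\<^sup>2 / 2)) + 2 * (real N + 1) * exp (- (K\<^sup>2 / 2)))"
    by (intro order_trans[OF bprob_disj[OF t]] add_mono tails abs_Re_le_cmod abs_Im_le_cmod)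
  finally show ?thesis by (simp add: F_def J_def algebra_simps)
qed

section \<open>Local law for the ensemble\<close>

definition sc_error :: "real \<Rightarrow> nat \<Rightarrow> complex \<Rightarrow> (nat \<times> nat \<Rightarrow> real) \<Rightarrow> real" where
  "sc_error b N z y = cmod (res_trace {..<N} (\<lambda>i j. b * spin y i j) z / of_nat N - m_sc z)"

definition control :: "nat \<Rightarrow> complex \<Rightarrow> real" where
  "control N z = (1 / sqrt (real N * Im z)) / sqrt (\<bar>\<bar>Re z\<bar> - 2\<bar> + Im z + 1 / sqrt (real N * Im z))"

text \<open>A union bound over the grid of \<open>deterministic_local_law\<close> and over all rows. The requirements on \<open>B0\<close> stem from the
  diagonal entries, from the variance mismatch \<open>(c\<^sup>2 - t\<^sup>2) / (1 - c\<^sup>2)\<close> together with the scale of the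
  fluctuations, and from the range of the spectral domain.\<close>

lemma bias_local_law:
  fixes a c t K H B0 :: real and N :: nat and z :: complex
  assumes t: "\<bar>t\<bar> < 1" "\<bar>\<bar>t\<bar> - c\<bar> \<le> 1 / sqrt (real N)" and c: "0 < c" "c < 1"
    and a: "a > 0" "a\<^sup>2 = 1 / (1 - c\<^sup>2)"
    and N: "N \<ge> 3" and K: "K \<ge> 1" and scale: "real N * Im z \<ge> 1"
    and H: "Im z + 4 \<le> H" "H \<le> real N ^ 7"
    and B0: "2 * a * sqrt H \<le> B0" "8 * a\<^sup>2 * sqrt H \<le> B0" "sqrt (\<bar>\<bar>Re z\<bar> - 2\<bar> + Im z + 1) \<le> B0" "1 \<le> B0"
    and small: "28 * (B0 * K\<^sup>2) * (1 / sqrt (real N * Im z)) \<le> 1 / 1024"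
  shows "bprob t ({..<N} \<times> {..<N}) (\<lambda>y. sc_error (a / sqrt (real N)) N z y > 2000 * (B0 * K\<^sup>2) * control N z)
     \<le> (4 * real N ^ 4 + 1) * (real N * ((4 * real N + 8) * exp (- (K\<^sup>2 / 2))))"
proof -
  define J where "J = {..<N} \<times> {..<N}"
  define b where "b = a / sqrt (real N)"
  define B where "B = B0 * K\<^sup>2"
  define v where "v = b\<^sup>2 * (1 - t\<^sup>2)"
  define zz where "zz j = z + of_real (real j / real N ^ 4) * \<i>" for j
  have N0: "real N > 0" "real N \<ge> 1" using N by auto
  have t1: "\<bar>t\<bar> \<le> 1" using t by simp
  have K2: "K\<^sup>2 \<ge> 1" using K by simp
  have B0B: "B0 \<le> B" using B0(4) K2 mult_left_mono[of 1 "K\<^sup>2" B0] by (simp add: B_def)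
  have b2: "b\<^sup>2 = a\<^sup>2 / real N" using N0 by (simp add: b_def power_divide)
  have b0: "b > 0" using a N0 by (simp add: b_def)
  have Imz: "Im z > 0" using zero_less_mult_pos[of "real N" "Im z"] scale N0 by linarith
  have Im: "Im (zz j) > 0" for j using Imz N0 by (simp add: zz_def add_pos_nonneg)
  have H1: "sqrt H \<ge> 1" using H(1) Imz by simp
  have fr: "x / sqrt (real N) \<le> B / sqrt (real N * H)" if "x * sqrt H \<le> B" for x
    using that N0 H1 by (simp add: real_sqrt_mult field_simps)
  let ?F = "\<lambda>j i y. frobenius ({..<N} - {i}) (centred b t y) (zz j)"
  let ?bad = "\<lambda>(j, i) y. cmod (fluctuation {..<N} (centred b t y) v (zz j) i)
        > 8 * b\<^sup>2 * K\<^sup>2 * ?F j i y"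
  have "bprob t J (\<lambda>y. sc_error b N z y > 2000 * B * control N z) \<le> bprob t J (\<lambda>y. \<exists>p\<in>{..4 * N ^ 4} \<times> {..<N}. ?bad p y)"
  proof (rule bprob_mono[OF t1], rule ccontr)
    fix y assume y: "y \<in> J \<rightarrow>\<^sub>E {-1, 1}" and big: "sc_error b N z y > 2000 * B * control N z"
      and "\<not> (\<exists>p\<in>{..4 * N ^ 4} \<times> {..<N}. ?bad p y)"
    hence good: "cmod (fluctuation {..<N} (centred b t y) v (zz j) i)
        \<le> 8 * b\<^sup>2 * K\<^sup>2 * ?F j i y" if "i < N" "j \<le> 4 * N ^ 4" for i j
      using that by force
    have "cmod (res_trace {..<N} (\<lambda>i j. centred b t y i j + b * t) z / of_nat N - m_sc z)
       \<le> 2000 * B * ((1 / sqrt (real N * Im z)) / sqrt (\<bar>\<bar>Re z\<bar> - 2\<bar> + Im z + 1 / sqrt (real N * Im z)))"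
    proof (rule deterministic_local_law[where v = v and H = H])
      show "symmetric_on {..<N} (centred b t y)" by (rule symmetric_on_centred)
      show "1 \<le> B" using B0B B0(4) by simp
      fix i j assume i: "i < N"
      have "y (i, i) = -1 \<or> y (i, i) = 1" using y i by (auto simp: J_def PiE_iff)
      hence "\<bar>spin y i i - t\<bar> \<le> 2" using t1 by (auto simp: spin_def)
      hence "\<bar>centred b t y i i\<bar> \<le> b * 2" using b0 by (simp add: centred_def abs_mult)
      also have "b * 2 = 2 * a / sqrt (real N)" by (simp add: b_def)
      also have "\<dots> \<le> B / sqrt (real N * H)" using B0(1) B0B by (intro fr) simp
      finally show "\<bar>centred b t y i i\<bar> \<le> B / sqrt (real N * H)" .
      assume j: "j \<le> 4 * N ^ 4"
      have "8 * b\<^sup>2 * K\<^sup>2 \<le> B / real N"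
      proof -
        have "8 * a\<^sup>2 * 1 \<le> 8 * a\<^sup>2 * sqrt H" using H1 by (intro mult_left_mono) auto
        hence "8 * a\<^sup>2 \<le> B0" using B0(2) by simp
        hence "8 * a\<^sup>2 * K\<^sup>2 \<le> B" unfolding B_def by (intro mult_right_mono) auto
        thus ?thesis using N0 by (simp add: b2 divide_right_mono)
      qed
      hence "8 * b\<^sup>2 * K\<^sup>2 * ?F j i y \<le> B / real N * ?F j i y"
        by (intro mult_right_mono) (auto simp: frobenius_def intro!: sum_nonneg)
      thus "cmod (fluctuation {..<N} (centred b t y) v (z + of_real (real j / real N ^ 4) * \<i>) i)
        \<le> B / real N * frobenius ({..<N} - {i}) (centred b t y) (z + of_real (real j / real N ^ 4) * \<i>)"
        using good[OF i j] unfolding zz_def by linarith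
    next
      have c2: "1 - c\<^sup>2 > 0" using c by (simp add: power_less_one_iff abs_square_less_1)
      have "v * real N = a\<^sup>2 * (1 - t\<^sup>2)" using N0 by (simp add: v_def b2)
      also have "a\<^sup>2 * (1 - t\<^sup>2) = a\<^sup>2 * (1 - c\<^sup>2) + a\<^sup>2 * (c\<^sup>2 - t\<^sup>2)" by (simp add: algebra_simps)
      also have "a\<^sup>2 * (1 - c\<^sup>2) = 1" using c2 a(2) by simp
      finally have "v * real N - 1 = a\<^sup>2 * ((c - \<bar>t\<bar>) * (c + \<bar>t\<bar>))"
        by (simp add: algebra_simps power2_eq_square[of c] power2_eq_square[of t] flip: abs_mult)
      hence "\<bar>v * real N - 1\<bar> = a\<^sup>2 * (\<bar>c - \<bar>t\<bar>\<bar> * \<bar>c + \<bar>t\<bar>\<bar>)"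
        by (simp add: abs_mult)
      also have "\<dots> \<le> a\<^sup>2 * (1 / sqrt (real N) * 2)"
        using t c by (intro mult_left_mono mult_mono) auto
      also have "\<dots> = 2 * a\<^sup>2 / sqrt (real N)" by simp
      also have "\<dots> \<le> B / sqrt (real N * H)"
      proof (rule fr)
        have "2 * a\<^sup>2 * sqrt H \<le> 8 * a\<^sup>2 * sqrt H" using H1 by (intro mult_right_mono) auto
        thus "2 * a\<^sup>2 * sqrt H \<le> B" using B0(2) B0B by linarith
      qed
      finally show "\<bar>v * real N - 1\<bar> \<le> B / sqrt (real N * H)" .
      show "28 * B * (1 / sqrt (real N * Im z)) \<le> 1 / 1024" using small by (simp add: B_def)
      show "sqrt (\<bar>\<bar>Re z\<bar> - 2\<bar> + Im z + 1) \<le> B" using B0(3) B0B by linarith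
    qed (use N scale H in auto)
    moreover have "(\<lambda>i j. centred b t y i j + b * t) = (\<lambda>i j. b * spin y i j)"
      by (simp add: centred_def algebra_simps)
    ultimately show False using big by (simp add: sc_error_def control_def)
  qed
  also have "\<dots> \<le> real (card ({..4 * N ^ 4} \<times> {..<N})) * ((4 * real N + 8) * exp (- (K\<^sup>2 / 2)))"
  proof (rule bprob_UN[OF t1])
    fix p assume "p \<in> {..4 * N ^ 4} \<times> {..<N}"
    then obtain j i where p: "p = (j, i)" "i < N" by auto
    show "bprob t J (?bad p) \<le> (4 * real N + 8) * exp (- (K\<^sup>2 / 2))"
      using fluctuation_tail[OF t1 Im[of j] p(2) K, of b] by (simp add: p(1) J_def v_def)
  qed simp
  also have "real (card ({..4 * N ^ 4} \<times> {..<N})) = (4 * real N ^ 4 + 1) * real N"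
    by (simp add: card_cartesian_product algebra_simps)
  finally show ?thesis by (simp add: J_def b_def B_def mult.assoc)
qed

text \<open>Finitely many \<open>N\<close> can be absorbed into the constant, since probabilities are at most 1.\<close>

lemma stoch_dominatedI:
  assumes "\<And>N. N \<ge> 1 \<Longrightarrow> prob_space (P N)"
    and "\<And>N u. N \<ge> 1 \<Longrightarrow> u \<in> U N \<Longrightarrow> X N u \<in> borel_measurable (P N)"
    and "\<And>N u. N \<ge> 1 \<Longrightarrow> u \<in> U N \<Longrightarrow> Y N u \<in> borel_measurable (P N)"
    and "\<And>N u \<omega>. N \<ge> 1 \<Longrightarrow> u \<in> U N \<Longrightarrow> \<omega> \<in> space (P N) \<Longrightarrow> 0 \<le> Y N u \<omega>"
    and tail: "\<And>\<epsilon> D. \<epsilon> > 0 \<Longrightarrow> D > 0 \<Longrightarrow> eventually (\<lambda>N. \<forall>u\<in>U N.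
        emeasure (P N) {\<omega> \<in> space (P N). cmod (X N u \<omega>) > real N powr \<epsilon> * Y N u \<omega>} \<le> ennreal (real N powr (- D))) sequentially"
  shows "stoch_dominated P U X Y"
  unfolding stoch_dominated_def
proof (intro conjI allI ballI impI)
  fix \<epsilon> D :: real assume pos: "\<epsilon> > 0" "D > 0"
  let ?A = "\<lambda>N u. {\<omega> \<in> space (P N). cmod (X N u \<omega>) > real N powr \<epsilon> * Y N u \<omega>}"
  from tail[OF pos] obtain N0 where N0: "\<And>N u. N \<ge> N0 \<Longrightarrow> u \<in> U N \<Longrightarrow>
    emeasure (P N) (?A N u) \<le> ennreal (real N powr (- D))"
    by (auto simp: eventually_sequentially)
  (* For N < N0 the right-hand side C * N^(-D) exceeds 1. *)
  define C where "C = real (Suc N0) powr D"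
  have C: "C \<ge> 1" unfolding C_def using \<open>D > 0\<close> by (intro ge_one_powr_ge_zero) auto
  show "\<exists>C\<ge>0. \<forall>N\<ge>1. (SUP u\<in>U N. emeasure (P N) (?A N u))
      \<le> ennreal (C * real N powr (- D))"
  proof (intro exI[of _ C] conjI allI impI SUP_least)
    fix N u assume N: "N \<ge> (1::nat)" and u: "u \<in> U N"
    interpret prob_space "P N" using assms(1)[OF N] .
    show "emeasure (P N) (?A N u) \<le> ennreal (C * real N powr (- D))"
    proof (cases "N \<ge> N0")
      case True
      have "real N powr (- D) \<le> C * real N powr (- D)"
        using mult_right_mono[OF C, of "real N powr (- D)"] by simp
      thus ?thesis using N0[OF True u] by (meson ennreal_leI order_trans)
    next
      case False
      have "1 = real N powr D * real N powr (- D)" using N by (simp add: powr_add[symmetric])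
      also have "\<dots> \<le> C * real N powr (- D)"
        unfolding C_def using False \<open>D > 0\<close> by (intro mult_right_mono powr_mono2) auto
      finally have "1 \<le> ennreal (C * real N powr (- D))" by simp
      thus ?thesis using emeasure_le_1 order_trans by blast
    qed
  qed (use C in auto)
qed (use assms in auto)

lemma mem_spectral_domain:
  assumes "z \<in> spectral_domain a b \<tau> N" "N \<ge> 1" "\<tau> > 0"
  shows "Im z > 0" "real N * Im z \<ge> real N powr \<tau>" "real N * Im z \<ge> 1"
proof -
  have N: "real N > 0" using assms(2) by simp
  have 1: "1 / real N powr (1 - \<tau>) \<le> Im z" using assms(1) by (simp add: spectral_domain_def)
  have "1 / real N powr (1 - \<tau>) > 0" using N by simp
  thus "Im z > 0" using 1 by linarith
  have "real N * (1 / real N powr (1 - \<tau>)) = real N powr \<tau>"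
    using N by (simp add: powr_diff)
  thus 2: "real N * Im z \<ge> real N powr \<tau>" using mult_left_mono[OF 1, of "real N"] N by simp
  have "real N powr \<tau> \<ge> 1" using assms(2,3) by (intro ge_one_powr_ge_zero) auto
  thus "real N * Im z \<ge> 1" using 2 by linarith
qed

lemma eventually_union_bound_small:
  fixes \<delta> D C k :: real
  assumes "\<delta> > 0" "k > 0" "C > 0" "D > 0"
  shows "eventually (\<lambda>N::nat. (4 * real N ^ 4 + 1) * (real N * ((4 * real N + 8) * exp (- (real N powr \<delta> / 2))))
      + C * exp (- (k / 2 * real N)) \<le> real N powr (- D)) at_top"
proof -
  have "eventually (\<lambda>N::nat. (4 * real N ^ 4 + 1) * (real N * ((4 * real N + 8) * exp (- (real N powr \<delta> / 2))))
      \<le> real N powr (- D) / 2) at_top"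
    using assms by real_asymp
  moreover have "eventually (\<lambda>N::nat. C * exp (- (k / 2 * real N)) \<le> real N powr (- D) / 2) at_top"
    using assms by real_asymp
  ultimately show ?thesis by eventually_elim linarith
qed

lemma empirical_stieltjes_ensemble:
  assumes "Im z > 0"
  shows "empirical_stieltjes (a \<cdot>\<^sub>m Matrix.mat N N (\<lambda>(i, j). 1 / sqrt (real N) * (if i \<le> j then X (i, j) \<omega> else X (j, i) \<omega>))) z
     = res_trace {..<N} (\<lambda>i j. a / sqrt (real N) * spin (\<lambda>p. X p \<omega>) i j) z / of_nat N"
proof -
  have "a \<cdot>\<^sub>m Matrix.mat N N (\<lambda>(i, j). 1 / sqrt (real N) * (if i \<le> j then X (i, j) \<omega> else X (j, i) \<omega>))
     = Matrix.mat N N (\<lambda>(i, j). a / sqrt (real N) * spin (\<lambda>p. X p \<omega>) i j)"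
    by (intro eq_matI) (auto simp: spin_def)
  thus ?thesis
    using empirical_stieltjes_eq_res_trace[OF _ assms, of N "\<lambda>i j. a / sqrt (real N) * spin (\<lambda>p. X p \<omega>) i j"]
    by (simp add: symmetric_on_def spin_def)
qed

text \<open>Choose \<open>K\<^sup>2 = N\<^sup>\<delta>\<close> with \<open>\<delta> < \<epsilon>\<close>, so that the constant \<open>2000 B0 K\<^sup>2\<close> is below \<open>N\<^sup>\<epsilon>\<close>, and with
  \<open>\<delta> < \<tau> / 2\<close>, so that \<open>K\<^sup>2 / sqrt (N \<eta>)\<close> tends to 0. The failure probability
  is then of order \<open>exp (- N\<^sup>\<delta> / 2)\<close> times a polynomial.\<close>

lemma ensemble_tail:
  fixes P :: "nat \<Rightarrow> 'a measure" and H :: "nat \<Rightarrow> 'a \<Rightarrow> real mat"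
  assumes \<beta>: "\<beta> > 1" and \<tau>: "0 < \<tau>" "\<tau> < 1" and ens: "curie_weiss_ensemble \<beta> P H"
    and \<epsilon>: "\<epsilon> > 0" "D > 0"
  defines "a \<equiv> (1 - (cw_magnetization \<beta>)\<^sup>2) powr (- 1 / 2)"
  assumes meas: "\<And>N z. N \<ge> 1 \<Longrightarrow> Im z > 0 \<Longrightarrow>
      (\<lambda>\<omega>. cmod (empirical_stieltjes (a \<cdot>\<^sub>m H N \<omega>) z - m_sc z)) \<in> borel_measurable (P N)"
  shows "eventually (\<lambda>N. \<forall>z\<in>spectral_domain (- 1 / \<tau>) (1 / \<tau>) \<tau> N.
      emeasure (P N) {\<omega> \<in> space (P N). cmod (empirical_stieltjes (a \<cdot>\<^sub>m H N \<omega>) z - m_sc z)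
          > real N powr \<epsilon> * control N z} \<le> ennreal (real N powr (- D))) sequentially"
proof -
  let ?\<Delta> = "\<lambda>N z \<omega>. cmod (empirical_stieltjes (a \<cdot>\<^sub>m H N \<omega>) z - m_sc z)"
  define c where "c = cw_magnetization \<beta>"
  note c = cw_magnetization[OF \<beta>, folded c_def]
  have c2: "1 - c\<^sup>2 > 0" using c by (simp add: power_less_one_iff abs_square_less_1)
  have a0: "a = (1 - c\<^sup>2) powr (- 1 / 2)" by (simp add: a_def c_def)
  have "a\<^sup>2 = (1 - c\<^sup>2) powr (- 1 / 2 + - 1 / 2)" by (simp only: a0 power2_eq_square powr_add)
  also have "- 1 / 2 + - 1 / 2 = (- 1 :: real)" by simp
  finally have a: "a > 0" "a\<^sup>2 = 1 / (1 - c\<^sup>2)"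
    using c2 by (simp_all add: a0 powr_minus_divide)
  define x0 where "x0 = \<beta> * c"
  have x0: "x0 > 0" "cw_force \<beta> x0 = 0" "tanh x0 = c"
    using \<beta> c by (auto simp: x0_def cw_force_def)
  obtain k where k: "k > 0" "\<And>x. cw_potential \<beta> x - cw_potential \<beta> x0 \<ge> k * (\<bar>x\<bar> - x0)\<^sup>2"
    using cw_potential_lower[OF x0(1,2)] by blast
  define C where "C = 2 * sqrt (1 / (\<beta> * k))"
  have C: "C > 0" using \<beta> k(1) by (simp add: C_def)
  define Hm where "Hm = 1 / \<tau> + 4"
  define B0 where "B0 = 1 + 2 * a * sqrt Hm + 8 * a\<^sup>2 * sqrt Hm + sqrt (2 / \<tau> + 3)"
  have nn: "0 \<le> 2 * a * sqrt Hm" "0 \<le> 8 * a\<^sup>2 * sqrt Hm" "0 \<le> sqrt (2 / \<tau> + 3)"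
    using a(1) \<tau> by (auto simp: Hm_def)
  (* Half of the minimum, so that both comparisons are strict. *)
  define \<delta> where "\<delta> = min \<epsilon> (\<tau> / 2) / 2"
  have \<delta>: "\<delta> > 0" "\<delta> < \<epsilon>" "\<delta> < \<tau> / 2" using \<epsilon> \<tau> by (auto simp: \<delta>_def min_def)
  have ev1: "eventually (\<lambda>N::nat. Hm \<le> real N ^ 7) at_top" by real_asymp
  have ev2: "eventually (\<lambda>N::nat. 28 * 1024 * B0 * real N powr \<delta> \<le> real N powr (\<tau> / 2)) at_top"
    using \<delta> by real_asymp
  have ev3: "eventually (\<lambda>N::nat. 2000 * B0 * real N powr \<delta> \<le> real N powr \<epsilon>) at_top"
    using \<delta> by real_asymp
  show ?thesis
    using ev1 ev2 ev3 eventually_union_bound_small[OF \<delta>(1) k(1) C \<epsilon>(2)] eventually_ge_at_top[of 3]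
  proof eventually_elim
    case (elim N)
    have N: "N \<ge> 3" "N \<ge> 1" "real N \<ge> 1" using elim by auto
    define K where "K = real N powr (\<delta> / 2)"
    have K: "K \<ge> 1" unfolding K_def using N \<delta> by (intro ge_one_powr_ge_zero) auto
    have K2: "K\<^sup>2 = real N powr \<delta>" using N by (simp add: K_def powr_power)
    define J where "J = {..<N} \<times> {..<N}"
    from ens N obtain X where X: "curie_weiss (P N) \<beta> J X"
      and HX: "\<And>\<omega>. \<omega> \<in> space (P N) \<Longrightarrow> H N \<omega> = Matrix.mat N N (\<lambda>(i, j).
           1 / sqrt (real N) * (if i \<le> j then X (i, j) \<omega> else X (j, i) \<omega>))"
      unfolding curie_weiss_ensemble_def J_def by blast
    show ?case
    proof
      fix z assume z: "z \<in> spectral_domain (- 1 / \<tau>) (1 / \<tau>) \<tau> N"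
      note zN = mem_spectral_domain[OF z N(2) \<tau>(1)]
      have zb: "\<bar>Re z\<bar> \<le> 1 / \<tau>" "Im z \<le> 1 / \<tau>" using z by (auto simp: spectral_domain_def)
      let ?b = "a / sqrt (real N)"
      let ?Q = "\<lambda>y. sc_error ?b N z y > 2000 * (B0 * K\<^sup>2) * control N z"
      let ?p = "(4 * real N ^ 4 + 1) * (real N * ((4 * real N + 8) * exp (- (K\<^sup>2 / 2))))"
      have control: "control N z \<ge> 0" using zN by (auto simp: control_def)
      have "cw_prob \<beta> J ?Q \<le> ?p + 2 * sqrt (1 / (\<beta> * k)) * exp (- (k / 2 * (real (card J) * (1 / sqrt (real N))\<^sup>2)))"
      proof (rule cw_prob_concentration[OF _ _ _ x0(1,2) k])
        show "J \<noteq> {}" using N by (auto simp: J_def lessThan_empty_iff)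
        fix t :: real assume t: "\<bar>t\<bar> < 1" "\<bar>\<bar>t\<bar> - tanh x0\<bar> \<le> 1 / sqrt (real N)"
        show "bprob t J ?Q \<le> ?p"
          unfolding J_def
        proof (rule bias_local_law[where H = Hm and c = c])
          show "\<bar>\<bar>t\<bar> - c\<bar> \<le> 1 / sqrt (real N)" using t(2) x0(3) by simp
          show "Im z + 4 \<le> Hm" using zb by (simp add: Hm_def)
          show "2 * a * sqrt Hm \<le> B0" "8 * a\<^sup>2 * sqrt Hm \<le> B0" "1 \<le> B0" using nn by (simp_all add: B0_def)
          have "sqrt (\<bar>\<bar>Re z\<bar> - 2\<bar> + Im z + 1) \<le> sqrt (2 / \<tau> + 3)"
            using zb by (intro real_sqrt_le_mono) (simp add: abs_le_iff, linarith)
          thus "sqrt (\<bar>\<bar>Re z\<bar> - 2\<bar> + Im z + 1) \<le> B0" using nn unfolding B0_def by linarith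
          have "real N powr (\<tau> / 2) \<le> sqrt (real N * Im z)"
          proof (rule real_le_rsqrt)
            have "(real N powr (\<tau> / 2))\<^sup>2 = real N powr \<tau>" using N by (simp add: powr_power)
            thus "(real N powr (\<tau> / 2))\<^sup>2 \<le> real N * Im z" using zN(2) by simp
          qed
          hence "28 * 1024 * B0 * real N powr \<delta> \<le> sqrt (real N * Im z)" using elim(2) by linarith
          moreover have "sqrt (real N * Im z) > 0" using zN by simp
          ultimately show "28 * (B0 * K\<^sup>2) * (1 / sqrt (real N * Im z)) \<le> 1 / 1024"
            unfolding K2 by (simp add: field_simps)
        qed (use t c a N K zN elim in auto)
      qed (use \<beta> in \<open>auto simp: J_def\<close>)
      also have "real (card J) * (1 / sqrt (real N))\<^sup>2 = real N"
        using N by (simp add: J_def card_cartesian_product power_divide)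
      finally have cw: "cw_prob \<beta> J ?Q \<le> real N powr (- D)"
        using elim(4) unfolding K2 C_def by linarith
      define A where "A = {\<omega> \<in> space (P N). ?\<Delta> N z \<omega>
          > real N powr \<epsilon> * control N z}"
      have "A \<in> sets (P N)" unfolding A_def using meas[OF N(2) zN(1)] by measurable
      hence "emeasure (P N) A \<le> ennreal (cw_prob \<beta> J ?Q)"
      proof (rule curie_weiss_emeasure_le[OF X])
        fix \<omega> assume \<omega>: "\<omega> \<in> A"
        have "res_trace {..<N} (\<lambda>i j. ?b * spin (\<lambda>p\<in>J. X p \<omega>) i j) z = res_trace {..<N} (\<lambda>i j. ?b * spin (\<lambda>p. X p \<omega>) i j) z"
        proof -
          have "res {..<N} (\<lambda>i j. ?b * spin (\<lambda>p\<in>J. X p \<omega>) i j) z = res {..<N} (\<lambda>i j. ?b * spin (\<lambda>p. X p \<omega>) i j) z"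
            by (rule res_cong) (auto simp: spin_def J_def)
          thus ?thesis by (simp add: res_trace_def)
        qed
        hence "sc_error ?b N z (\<lambda>p\<in>J. X p \<omega>) = ?\<Delta> N z \<omega>"
          using \<omega> empirical_stieltjes_ensemble[OF zN(1), of a N X \<omega>] HX[of \<omega>] by (simp add: sc_error_def A_def)
        hence "sc_error ?b N z (\<lambda>p\<in>J. X p \<omega>) > real N powr \<epsilon> * control N z"
          using \<omega> by (simp add: A_def)
        moreover have "2000 * (B0 * K\<^sup>2) * control N z \<le> real N powr \<epsilon> * control N z"
          using elim(3) control unfolding K2 by (intro mult_right_mono) (simp_all add: mult_ac)
        ultimately show "?Q (\<lambda>p\<in>J. X p \<omega>)" by linarith
      qed
      also have "\<dots> \<le> ennreal (real N powr (- D))" by (rule ennreal_leI[OF cw])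
      finally show "emeasure (P N) {\<omega> \<in> space (P N). ?\<Delta> N z \<omega>
          > real N powr \<epsilon> * control N z} \<le> ennreal (real N powr (- D))" by (simp add: A_def)
    qed
  qed
qed

lemma ensemble_measurable:
  fixes P :: "nat \<Rightarrow> 'a measure"
  assumes "curie_weiss_ensemble \<beta> P H" "N \<ge> 1" "Im z > 0"
  shows "prob_space (P N)"
    and "(\<lambda>\<omega>. cmod (empirical_stieltjes (a \<cdot>\<^sub>m H N \<omega>) z - m_sc z)) \<in> borel_measurable (P N)"
proof -
  from assms(1,2) obtain X where X: "curie_weiss (P N) \<beta> ({..<N} \<times> {..<N}) X"
      and HX: "\<And>\<omega>. \<omega> \<in> space (P N) \<Longrightarrow> H N \<omega> = Matrix.mat N N (\<lambda>(i, j).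
           1 / sqrt (real N) * (if i \<le> j then X (i, j) \<omega> else X (j, i) \<omega>))"
    unfolding curie_weiss_ensemble_def by blast
  show "prob_space (P N)" using X by (simp add: curie_weiss_def)
  have Xm: "X p \<in> borel_measurable (P N)" if "p \<in> {..<N} \<times> {..<N}" for p
    using X that unfolding curie_weiss_def by blast
  have r: "(\<lambda>\<omega>. res {..<N} (\<lambda>i j. a / sqrt (real N) * spin (\<lambda>p. X p \<omega>) i j) z i i) \<in> borel_measurable (P N)" for i
  proof (rule borel_measurable_res)
    show "(\<lambda>\<omega>. a / sqrt (real N) * spin (\<lambda>p. X p \<omega>) i j) \<in> borel_measurable (P N)"
      if "i \<in> {..<N}" "j \<in> {..<N}" for i j
      using Xm[of "(i, j)"] Xm[of "(j, i)"] that unfolding spin_def by (cases "i \<le> j") auto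
  qed (use assms(3) in \<open>auto simp: symmetric_on_def spin_def\<close>)
  have "(\<lambda>\<omega>. cmod (res_trace {..<N} (\<lambda>i j. a / sqrt (real N) * spin (\<lambda>p. X p \<omega>) i j) z / of_nat N
      - m_sc z)) \<in> borel_measurable (P N)"
    unfolding res_trace_def using r by measurable
  thus "(\<lambda>\<omega>. cmod (empirical_stieltjes (a \<cdot>\<^sub>m H N \<omega>) z - m_sc z)) \<in> borel_measurable (P N)"
    by (rule measurable_cong[THEN iffD1, rotated]) (simp only: HX empirical_stieltjes_ensemble[OF assms(3)])
qed

theorem theorem14:
  fixes \<beta> \<tau> :: real
    and P :: "nat \<Rightarrow> 'a measure"
    and H :: "nat \<Rightarrow> 'a \<Rightarrow> real mat"
  assumes "\<beta> > 1"
    and "0 < \<tau>" and "\<tau> < 1"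
    and "curie_weiss_ensemble \<beta> P H"
  shows "let c = cw_magnetization \<beta>;
             s = (\<lambda>N z \<omega>. empirical_stieltjes ((1 - c\<^sup>2) powr (- 1 / 2) \<cdot>\<^sub>m H N \<omega>) z);
             m = stieltjes_transform semicircle;
             \<kappa> = (\<lambda>z. \<bar>\<bar>Re z\<bar> - 2\<bar>)
         in
           stoch_dominated P (spectral_domain (- 1 / \<tau>) (1 / \<tau>) \<tau>)
             (\<lambda>N z \<omega>. complex_of_real (cmod (s N z \<omega> - m z)))
             (\<lambda>N z \<omega>. (1 / sqrt (real N * Im z)) /
                        sqrt (\<kappa> z + Im z + 1 / sqrt (real N * Im z))) \<and>
           stoch_dominated P (spectral_domain (- 2 + \<tau>) (2 - \<tau>) \<tau>)
             (\<lambda>N z \<omega>. complex_of_real (cmod (s N z \<omega> - m z)))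
             (\<lambda>N z \<omega>. 1 / sqrt (real N * Im z))"
proof -
  define a where "a = (1 - (cw_magnetization \<beta>)\<^sup>2) powr (- 1 / 2)"
  let ?\<Delta> = "\<lambda>N z \<omega>. cmod (empirical_stieltjes (a \<cdot>\<^sub>m H N \<omega>) z - m_sc z)"
  note ens = assms(4)
  have prob: "prob_space (P N)" if "N \<ge> 1" for N
    using ensemble_measurable(1)[OF ens that, of \<i>] by simp
  have meas: "?\<Delta> N z \<in> borel_measurable (P N)" if "N \<ge> 1" "Im z > 0" for N z
    by (rule ensemble_measurable(2)[OF ens that])
  have measC: "(\<lambda>\<omega>. complex_of_real (?\<Delta> N z \<omega>)) \<in> borel_measurable (P N)"
    if "N \<ge> 1" "z \<in> spectral_domain l u \<tau> N" for N z l u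
  proof -
    have [measurable]: "?\<Delta> N z \<in> borel_measurable (P N)"
      by (rule meas[OF that(1) mem_spectral_domain(1)[OF that(2,1) assms(2)]])
    show ?thesis by measurable
  qed
  have nonneg: "0 \<le> real N * Im z" if "N \<ge> 1" "z \<in> spectral_domain l u \<tau> N" for N z l u
    using mem_spectral_domain(3)[OF that(2,1) assms(2)] by linarith
  have tail: "eventually (\<lambda>N. \<forall>z\<in>spectral_domain (- 1 / \<tau>) (1 / \<tau>) \<tau> N.
      emeasure (P N) {\<omega> \<in> space (P N). ?\<Delta> N z \<omega> > real N powr \<epsilon> * control N z} \<le> ennreal (real N powr (- D))) sequentially"
    if "\<epsilon> > 0" "D > 0" for \<epsilon> D
    using ensemble_tail[OF assms that] meas unfolding a_def by blast
  have part1: "stoch_dominated P (spectral_domain (- 1 / \<tau>) (1 / \<tau>) \<tau>)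
      (\<lambda>N z \<omega>. complex_of_real (?\<Delta> N z \<omega>)) (\<lambda>N z \<omega>. control N z)"
  proof (rule stoch_dominatedI[OF prob measC])
    show "0 \<le> control N z" if "N \<ge> 1" "z \<in> spectral_domain (- 1 / \<tau>) (1 / \<tau>) \<tau> N" for N z
      using nonneg[OF that] mem_spectral_domain(1)[OF that(2,1) assms(2)] by (simp add: control_def)
  qed (use tail in simp_all)
  have part2: "stoch_dominated P (spectral_domain (- 2 + \<tau>) (2 - \<tau>) \<tau>)
      (\<lambda>N z \<omega>. complex_of_real (?\<Delta> N z \<omega>)) (\<lambda>N z \<omega>. 1 / sqrt (real N * Im z))"
  proof (rule stoch_dominatedI[OF prob measC])
    show "0 \<le> 1 / sqrt (real N * Im z)" if "N \<ge> 1" "z \<in> spectral_domain (- 2 + \<tau>) (2 - \<tau>) \<tau> N" for N z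
      using nonneg[OF that] by simp
    fix \<epsilon> D :: real assume \<epsilon>: "\<epsilon> > 0" and D: "D > 0"
    have ev: "eventually (\<lambda>N::nat. 1 / sqrt \<tau> * real N powr (\<epsilon> / 2) \<le> real N powr \<epsilon>) at_top"
      using \<epsilon> by real_asymp
    have "\<epsilon> / 2 > 0" using \<epsilon> by simp
    show "eventually (\<lambda>N. \<forall>z\<in>spectral_domain (- 2 + \<tau>) (2 - \<tau>) \<tau> N.
        emeasure (P N) {\<omega> \<in> space (P N). cmod (complex_of_real (?\<Delta> N z \<omega>)) > real N powr \<epsilon> * (1 / sqrt (real N * Im z))}
          \<le> ennreal (real N powr (- D))) sequentially"
      using tail[OF \<open>\<epsilon> / 2 > 0\<close> D] ev eventually_ge_at_top[of 1]
    proof eventually_elim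
      case (elim N)
      show ?case
      proof
        fix z assume z: "z \<in> spectral_domain (- 2 + \<tau>) (2 - \<tau>) \<tau> N"
        note zN = mem_spectral_domain[OF z elim(3) assms(2)]
        (* Equivalent to (\<tau> - 1)^2 \<ge> 0; it makes the second spectral domain a subset of the first. *)
        have "2 - \<tau> \<le> 1 / \<tau>"
          using assms(2) sum_squares_ge_zero[of "\<tau> - 1" 0] by (simp add: field_simps)
        hence z': "z \<in> spectral_domain (- 1 / \<tau>) (1 / \<tau>) \<tau> N"
          using z by (auto simp: spectral_domain_def)
        have \<kappa>: "\<tau> \<le> \<bar>\<bar>Re z\<bar> - 2\<bar>" using z by (auto simp: spectral_domain_def)
        let ?\<psi> = "1 / sqrt (real N * Im z)"
        have "control N z \<le> ?\<psi> / sqrt \<tau>"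
          unfolding control_def using \<kappa> zN assms(2)
          by (intro frac_le real_sqrt_le_mono) (auto intro: add_increasing2)
        hence "real N powr (\<epsilon> / 2) * control N z \<le> real N powr (\<epsilon> / 2) * (?\<psi> / sqrt \<tau>)"
          by (intro mult_left_mono) auto
        also have "\<dots> = (1 / sqrt \<tau> * real N powr (\<epsilon> / 2)) * ?\<psi>" by simp
        also have "\<dots> \<le> real N powr \<epsilon> * ?\<psi>"
          using elim(2) zN by (intro mult_right_mono) auto
        finally have le: "real N powr (\<epsilon> / 2) * control N z \<le> real N powr \<epsilon> * ?\<psi>" .
        have [measurable]: "?\<Delta> N z \<in> borel_measurable (P N)" by (rule meas[OF elim(3) zN(1)])
        have "emeasure (P N) {\<omega> \<in> space (P N). cmod (complex_of_real (?\<Delta> N z \<omega>)) > real N powr \<epsilon> * ?\<psi>}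
           \<le> emeasure (P N) {\<omega> \<in> space (P N). ?\<Delta> N z \<omega> > real N powr (\<epsilon> / 2) * control N z}"
          using le by (intro emeasure_mono) auto
        also have "\<dots> \<le> ennreal (real N powr (- D))" using elim(1) z' by blast
        finally show "emeasure (P N) {\<omega> \<in> space (P N). cmod (complex_of_real (?\<Delta> N z \<omega>)) > real N powr \<epsilon> * ?\<psi>}
           \<le> ennreal (real N powr (- D))" .
      qed
    qed
  qed auto
  show ?thesis
    using part1 part2 unfolding Let_def control_def a_def by blast
qed

end
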